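(* Let $\xi$ be the Piggyback web CA, started from a uniformly random seed of $0$s and $1$s on $[0,L]$. For each of the following signatures $B$, let $\eta^B$ be the ether with signature $B$ generated by Piggyback from the initial condition $B^\infty$. Then $$\liminf_{L\to\infty}\mathbf P(\xi\text{ is a replicator with ether }\eta^B)\ge p_B,$$ where the pairs $(B,p_B)$ are: $(0,\ 0.5)$; $(2,\ 0.0398)$; $(02,\ 0.0142)$; $(0002,\ 0.0258)$; $(00000002,\ 0.0099)$; $(00002022,\ 0.0303)$; $(00020222,\ 0.0209)$; $(00022222,\ 0.1297)$; $(0002000200022222,\ 0.0362)$; $(0002000200202002,\ 0.0216)$. Here, for the signature $00002022$ (which is the only one whose ether is not symmetric), the event is understood as "$\xi$ is a replicator whose ether is $\eta^B$ or its reflection $\overline{\eta^B}$".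
   Context: All intervals are subsets of $\mathbb Z$. A 3-state, range-2 CA evolves by $\xi_{t+1}(x)=f(\xi_t(x-2),\xi_t(x-1),\xi_t(x),\xi_t(x+1),\xi_t(x+2))$, $\xi_t(x)\in\{0,1,2\}$; write $\xi(x,t)=\xi_t(x)$. With $\delta(a)=\mathbf 1[a=1]$, put $\ell=\delta(a)+\delta(b)+\delta(c)\bmod 2$, $r=\delta(c)+\delta(d)+\delta(e)\bmod2$, and let $N_{12}(\cdot)$ be the number of its arguments that lie in $\{1,2\}$. The Piggyback rule is: $f(a,b,c,d,e)=1$ if $b+c+d$ is odd; $f(a,b,c,d,e)=2$ if $b+c+d$ is even and either $N_{12}(\ell,c,r)=2$, or [$N_{12}(\ell,c,r)\le1$ and $N_{12}(\ell,b,c,d,r)\in\{1,3\}$]; and $f(a,b,c,d,e)=0$ otherwise. Uniformly random seed on $[0,L]$: $\xi_0(x)$ for $x\in[0,L]$ are independent, equal to $0$ or $1$ with probability $1/2$ each, and $\xi_0(x)=0$ for $x\notin[0,L]$. Let $\lambda^\bullet$ be the binary CA $\lambda_{t+1}(x)=\lambda_t(x-1)+\lambda_t(x)+\lambda_t(x+1)\bmod 2$ started from a single $1$ at the origin, $\Lambda=\{(x,t):\lambda^\bullet(x,t)=1\}$, and $\Lambda(\rho)\subset\mathbb Z^2$ the set of points at $\ell^1$-distance at most $\rho$ from $\Lambda$. An ether is an element $\eta\in\{0,2\}^{\mathbb Z^2}$ periodic in both coordinates; ethers are equivalent if they are translates of each other. A set $K\subseteq\mathbb Z\times[0,\infty)$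 is filled with $\eta$ if $\xi$ agrees on $K$ with some ether equivalent to $\eta$. $\xi$ is a replicator with ether $\eta$ if for some $\rho<\infty$ each bounded connected component of $\mathbb Z^2\setminus\Lambda(\rho)$ (nearest-neighbour adjacency) is filled with $\eta$. For a finite string $B$, $B^\infty$ is the bi-infinite periodic repetition of $B$. The signature of an ether $\eta$ is the string $B$ such that for some $t$, $\eta(\cdot,t)$ is a translate of $B^\infty$, chosen lexicographically first among shortest such strings; ethers are equivalent iff they have the same signature. The reflection $\bar\eta$ is $\bar\eta(x,t)=\eta(-x,t)$; $\eta$ is symmetric if $\bar\eta$ is equivalent to $\eta$. *)

theory Defs
  imports "HOL-Probability.Probability"
begin

text \<open>States are natural numbers; \<^term>\<open>0\<close>, \<^term>\<open>1\<close>, \<^term>\<open>2\<close> are the only values that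
  the rule produces, and the only ones in the initial conditions considered.
  A configuration maps space to states; a space-time configuration takes the space
  coordinate first.\<close>

definition one_ind :: "nat \<Rightarrow> nat" where
  "one_ind a = (if a = 1 then 1 else 0)"

definition N12 :: "nat list \<Rightarrow> nat" where
  "N12 vs = length (filter (\<lambda>v. v \<in> {1, 2}) vs)"

definition piggyback :: "nat \<Rightarrow> nat \<Rightarrow> nat \<Rightarrow> nat \<Rightarrow> nat \<Rightarrow> nat" where
  "piggyback a b c d e =
    (let l = (one_ind a + one_ind b + one_ind c) mod 2;
         r = (one_ind c + one_ind d + one_ind e) mod 2
     in if odd (b + c + d) then 1
        else if N12 [l, c, r] = 2 \<or> (N12 [l, c, r] \<le> 1 \<and> N12 [l, b, c, d, r] \<in> {1, 3}) then 2
        else 0)"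

definition piggyback_step :: "(int \<Rightarrow> nat) \<Rightarrow> (int \<Rightarrow> nat)" where
  "piggyback_step \<xi> x = piggyback (\<xi> (x - 2)) (\<xi> (x - 1)) (\<xi> x) (\<xi> (x + 1)) (\<xi> (x + 2))"

definition piggyback_evol :: "(int \<Rightarrow> nat) \<Rightarrow> int \<Rightarrow> nat \<Rightarrow> nat" where
  "piggyback_evol \<xi>0 x t = (piggyback_step ^^ t) \<xi>0 x"

definition uniform_seed :: "nat \<Rightarrow> (int \<Rightarrow> nat) pmf" where
  "uniform_seed L = Pi_pmf {0..int L} 0 (\<lambda>_. pmf_of_set {0, 1})"

definition lambda_step :: "(int \<Rightarrow> nat) \<Rightarrow> (int \<Rightarrow> nat)" where
  "lambda_step \<xi> x = (\<xi> (x - 1) + \<xi> x + \<xi> (x + 1)) mod 2"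

definition lambda_bullet :: "int \<Rightarrow> nat \<Rightarrow> nat" where
  "lambda_bullet x t = (lambda_step ^^ t) (\<lambda>y. if y = 0 then 1 else 0) x"

definition Lam :: "(int \<times> int) set" where
  "Lam = {(x, int t) | x t. lambda_bullet x t = 1}"

definition l1_dist :: "int \<times> int \<Rightarrow> int \<times> int \<Rightarrow> int" where
  "l1_dist p q = \<bar>fst p - fst q\<bar> + \<bar>snd p - snd q\<bar>"

text \<open>Distances between lattice points are integers, so nothing is lost by an integral
  radius, and the distance to \<^const>\<open>Lam\<close> is attained.\<close>

definition Lam_nbhd :: "nat \<Rightarrow> (int \<times> int) set" where
  "Lam_nbhd \<rho> = {p. \<exists>q\<in>Lam. l1_dist p q \<le> int \<rho>}"

text \<open>Nearest neighbours in the lattice are the pairs of points at \<open>\<ell>\<^sup>1\<close>-distance one.\<close>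

definition nn_components :: "(int \<times> int) set \<Rightarrow> (int \<times> int) set set" where
  "nn_components S = S // {(p, q). p \<in> S \<and> q \<in> S \<and> l1_dist p q = 1}\<^sup>*"

definition ether :: "(int \<Rightarrow> int \<Rightarrow> nat) \<Rightarrow> bool" where
  "ether \<eta> \<longleftrightarrow>
    (\<forall>x t. \<eta> x t \<in> {0, 2}) \<and>
    (\<exists>p>0. \<forall>x t. \<eta> (x + p) t = \<eta> x t) \<and>
    (\<exists>q>0. \<forall>x t. \<eta> x (t + q) = \<eta> x t)"

definition ether_equiv :: "(int \<Rightarrow> int \<Rightarrow> nat) \<Rightarrow> (int \<Rightarrow> int \<Rightarrow> nat) \<Rightarrow> bool" where
  "ether_equiv \<eta> \<eta>' \<longleftrightarrow> (\<exists>a b. \<forall>x t. \<eta>' x t = \<eta> (x + a) (t + b))"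

definition reflect :: "(int \<Rightarrow> int \<Rightarrow> nat) \<Rightarrow> (int \<Rightarrow> int \<Rightarrow> nat)" where
  "reflect \<eta> x t = \<eta> (- x) t"

definition symmetric_ether :: "(int \<Rightarrow> int \<Rightarrow> nat) \<Rightarrow> bool" where
  "symmetric_ether \<eta> \<longleftrightarrow> ether_equiv \<eta> (reflect \<eta>)"

definition bi_infinite :: "nat list \<Rightarrow> int \<Rightarrow> nat" where
  "bi_infinite B x = B ! nat (x mod int (length B))"

definition occurs_in :: "nat list \<Rightarrow> (int \<Rightarrow> int \<Rightarrow> nat) \<Rightarrow> bool" where
  "occurs_in B \<eta> \<longleftrightarrow> B \<noteq> [] \<and> (\<exists>t a. \<forall>x. \<eta> x t = bi_infinite B (x + a))"

text \<open>\<^const>\<open>lenlex\<close> compares lengths first and then lexicographically.\<close>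

definition is_signature :: "nat list \<Rightarrow> (int \<Rightarrow> int \<Rightarrow> nat) \<Rightarrow> bool" where
  "is_signature B \<eta> \<longleftrightarrow>
    occurs_in B \<eta> \<and>
    (\<forall>B'. occurs_in B' \<eta> \<longrightarrow> B' = B \<or> (B, B') \<in> lenlex {(i, j). i < j})"

text \<open>An ether lives on all of \<open>\<int>\<^sup>2\<close>, while the automaton only runs forward. The ether
  generated from \<open>B\<^sup>\<infinity>\<close> is the doubly periodic extension of the trajectory; it is
  unique if it exists.\<close>

definition generates_ether :: "nat list \<Rightarrow> (int \<Rightarrow> int \<Rightarrow> nat) \<Rightarrow> bool" where
  "generates_ether B \<eta> \<longleftrightarrow>
    ether \<eta> \<and> (\<forall>x t. \<eta> x (int t) = piggyback_evol (bi_infinite B) x t)"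

definition ether_of :: "nat list \<Rightarrow> (int \<Rightarrow> int \<Rightarrow> nat)" where
  "ether_of B = (THE \<eta>. generates_ether B \<eta>)"

lemma ether_periodic_mult:
  assumes "\<And>x t. \<eta> x (t + q) = \<eta> x (t::int)"
  shows "\<eta> x (t + int n * q) = \<eta> x t"
proof (induction n)
  case (Suc n)
  have "\<eta> x (t + int (Suc n) * q) = \<eta> x ((t + int n * q) + q)"
    by (simp add: algebra_simps)
  then show ?case using assms Suc by simp
qed simp

lemma generates_ether_unique:
  assumes "generates_ether B \<eta>" and "generates_ether B \<eta>'"
  shows "\<eta> = \<eta>'"
proof (intro ext)
  fix x t
  obtain q where q: "q > 0" "\<And>x t. \<eta> x (t + q) = \<eta> x t"
    using assms(1) unfolding generates_ether_def ether_def by blast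
  obtain q' where q': "q' > 0" "\<And>x t. \<eta>' x (t + q') = \<eta>' x t"
    using assms(2) unfolding generates_ether_def ether_def by blast
  define s where "s = t + \<bar>t\<bar> * (q * q')"
  have "\<bar>t\<bar> * 1 \<le> \<bar>t\<bar> * (q * q')"
    using q(1) q'(1) by (intro mult_left_mono) (auto simp: int_one_le_iff_zero_less)
  then have "s \<ge> 0" unfolding s_def by linarith
  then have "\<eta> x s = \<eta>' x s"
    using assms unfolding generates_ether_def by (metis nonneg_int_cases)
  moreover have "\<eta> x s = \<eta> x t"
    using ether_periodic_mult[of \<eta> q x t "nat (\<bar>t\<bar> * q')"] q q'
    by (simp add: s_def algebra_simps)
  moreover have "\<eta>' x s = \<eta>' x t"
    using ether_periodic_mult[of \<eta>' q' x t "nat (\<bar>t\<bar> * q)"] q q'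
    by (simp add: s_def algebra_simps)
  ultimately show "\<eta> x t = \<eta>' x t" by simp
qed

lemma ether_of_eq: "generates_ether B \<eta> \<Longrightarrow> ether_of B = \<eta>"
  unfolding ether_of_def using generates_ether_unique by blast

definition filled :: "(int \<Rightarrow> nat \<Rightarrow> nat) \<Rightarrow> (int \<Rightarrow> int \<Rightarrow> nat) \<Rightarrow> (int \<times> int) set \<Rightarrow> bool" where
  "filled \<xi> \<eta> K \<longleftrightarrow>
    K \<subseteq> UNIV \<times> {0..} \<and>
    (\<exists>\<eta>'. ether_equiv \<eta> \<eta>' \<and> (\<forall>(x, t)\<in>K. \<xi> x (nat t) = \<eta>' x t))"

text \<open>A subset of \<open>\<int>\<^sup>2\<close> is bounded iff it is finite. Each component may be filled with a
  different translate of the ether.\<close>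

definition replicator :: "(int \<Rightarrow> nat \<Rightarrow> nat) \<Rightarrow> (int \<Rightarrow> int \<Rightarrow> nat) \<Rightarrow> bool" where
  "replicator \<xi> \<eta> \<longleftrightarrow>
    (\<exists>\<rho>. \<forall>K\<in>nn_components (- Lam_nbhd \<rho>). finite K \<longrightarrow> filled \<xi> \<eta> K)"

end

theory Submission
  imports Defs "HOL-Library.Z2"
begin

text \<open>
  The cells in state 1 follow the additive rule, so the support of a seed replicates itself along
  the Pascal triangle modulo 2. Just before a void of that triangle opens, provided that it is wider
  than \<open>4 \<cdot> 2\<^sup>k\<close>, the ones form translates of one fixed sequence of rows \<open>W\<^sub>j\<close>, where
  \<open>W\<^sub>j\<close> is found \<open>j\<close> steps before the opening; these rows depend on \<open>k\<close> and the seed only.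
  The nonzero cells of a 1-free configuration again follow the additive rule, so the filling of a void
  is determined by the nonzero cells at its opening.

  The first nonzero row among \<open>W\<^sub>1, W\<^sub>2, \<dots>\<close> is \<open>\<dots>110110\<dots>\<close>. The unknown 0/2-cells in its
  gaps are traced back through the preceding rows: such a parity either becomes a cell inside
  a pattern 101, where it flips at each step, or meets a 1, where it becomes known. If within 15 rows
  everything is known, the ether does not depend on the rest of the history.
  A row of period 16 is a polynomial in \<open>1 + X\<close> modulo \<open>(1 + X)\<^sup>1\<^sup>6\<close>, and its class modulo
  translation and time evolution is read off a normal form of its coefficients.

  Two adjacent cells of each \<open>W\<^sub>j\<close> are independent uniform bits, so the probabilities are counts of
  bit strings of length 30, obtained by a depth-first search inside the logic. Summing over the index
  of the first nonzero row gives the factor \<open>4 / 3\<close>, and over the 48 translates the factor 48.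
\<close>

section \<open>Additive rows and the Piggyback rule\<close>

text \<open>The obstacle is the history above a void: its 0/2-cells differ from void to void and are
  not controlled, while the ones agree for all wide voids. So only the ones may decide the ether,
  and each parity that they leave open is carried as an unknown. The common rows come from
  self-similarity: a void wider than \<open>4 * 2^k\<close> opens at a multiple of
  \<open>2^k\<close>, and \<open>2^k\<close> rows earlier the triangle shows a 110-pattern with
  spacing \<open>2^k\<close>. The number 16 enters because 16 steps of the additive rule add the
  cells at distances -16, 0 and 16. In the row \<open>...110110...\<close> the gaps lie in one class
  modulo 3, so within a period of 48 they can be indexed by their position modulo 16. One step later
  each gap value has spread to three cells, and 16 steps after that the three summands come from the
  three classes modulo 3, which leaves a row of period 16. The bits are independent because a seed
  shaped like row \<open>n\<close> of the triangle has no influence on \<open>W_1\<close>, ...,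
  \<open>W_n\<close>, which makes the map from seeds to bits triangular. Whatever the search
  abandons only lowers the count, and only lower bounds are claimed.\<close>

declare add_bit_eq_xor [simp del] mult_bit_eq_and [simp del]

type_synonym row = "int \<Rightarrow> bit"

section \<open>The additive rule as a linear map over the two-element field\<close>

definition lam :: "row \<Rightarrow> row" where
  "lam f x = f (x - 1) + f x + f (x + 1)"

definition shift :: "int \<Rightarrow> row \<Rightarrow> row" where
  "shift a f x = f (x + a)"

lemma bit_add_self [simp]: "(a::bit) + a = 0" "a + (a + b) = b"
  by (cases a; cases b; simp)+

lemma lam_shift: "lam (shift a f) = shift a (lam f)"
  by (simp add: lam_def shift_def fun_eq_iff algebra_simps)

lemma lam_pow_shift: "(lam ^^ n) (shift a f) = shift a ((lam ^^ n) f)"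
  by (induction n) (simp_all add: lam_shift)

lemma lam_zero [simp]: "lam (\<lambda>_. 0) = (\<lambda>_. 0)"
  by (simp add: lam_def fun_eq_iff)

lemma lam_pow_zero [simp]: "(lam ^^ n) (\<lambda>_. 0) = (\<lambda>_. 0)"
  by (induction n) simp_all

lemma lam_sum: "lam (\<lambda>x. \<Sum>i\<in>I. f i x) = (\<lambda>x. \<Sum>i\<in>I. lam (f i) x)"
  by (simp add: lam_def fun_eq_iff sum.distrib)

lemma lam_pow_sum: "(lam ^^ n) (\<lambda>x. \<Sum>i\<in>I. f i x) = (\<lambda>x. \<Sum>i\<in>I. (lam ^^ n) (f i) x)"
  by (induction n) (simp_all add: lam_sum)

lemma lam_mult: "lam (\<lambda>x. c * f x) = (\<lambda>x. c * lam f x)"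
  by (simp add: lam_def fun_eq_iff algebra_simps)

lemma lam_pow_mult: "(lam ^^ n) (\<lambda>x. c * f x) = (\<lambda>x. c * (lam ^^ n) f x)"
  by (induction n) (simp_all add: lam_mult)

text \<open>Frobenius: over the two-element field, squaring \<open>X^-1 + 1 + X\<close> squares each
  term.\<close>

lemma lam_pow_two_power:
  "(lam ^^ (2 ^ k)) f x = f (x - 2 ^ k) + f x + f (x + 2 ^ k)"
proof (induction k arbitrary: f x)
  case (Suc k)
  have "(lam ^^ (2 ^ Suc k)) f = (lam ^^ (2 ^ k)) ((lam ^^ (2 ^ k)) f)"
    by (simp add: mult_2 funpow_add)
  then show ?case
    by (simp add: Suc.IH algebra_simps)
qed (simp add: lam_def)

lemma lam_pow_cong:
  assumes "\<And>y. \<bar>y - x\<bar> \<le> int n \<Longrightarrow> f y = g y"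
  shows "(lam ^^ n) f x = (lam ^^ n) g x"
  using assms
proof (induction n arbitrary: x)
  case (Suc n)
  have "(lam ^^ n) f y = (lam ^^ n) g y" if "\<bar>y - x\<bar> \<le> 1" for y
    by (rule Suc.IH) (use that Suc.prems in auto)
  then show ?case by (simp add: lam_def[of "(lam ^^ n) f"] lam_def[of "(lam ^^ n) g"])
qed simp

lemma lam_periodic:
  assumes "lam f = (\<lambda>_. 0)"
  shows "f (x + 1) = f x + f (x - 1)" "f (x + 3) = f x"
proof -
  have r: "f (y + 1) = f y + f (y - 1)" for y
    using fun_cong[OF assms, of y]
    by (cases "f y"; cases "f (y - 1)"; cases "f (y + 1)"; simp add: lam_def)
  show "f (x + 1) = f x + f (x - 1)" by (rule r)
  show "f (x + 3) = f x"
    using r[of "x + 2"] r[of "x + 1"] by (simp add: algebra_simps)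
qed

section \<open>The Piggyback rule seen through its ones and its nonzero cells\<close>

definition nz :: "(int \<Rightarrow> nat) \<Rightarrow> row" where "nz \<xi> x = of_bool (\<xi> x \<noteq> 0)"
definition ones :: "(int \<Rightarrow> nat) \<Rightarrow> row" where "ones \<xi> x = of_bool (\<xi> x = 1)"
definition states :: "(int \<Rightarrow> nat) \<Rightarrow> bool" where "states \<xi> \<longleftrightarrow> (\<forall>x. \<xi> x \<in> {0, 1, 2})"

text \<open>The quantities \<open>l\<close> and \<open>r\<close> of the rule are the ones of the
  next row at the two neighbours. In a new pattern 101 both count, so \<open>N12 [l, c, r]\<close>
  is 2 or 3 and the cell flips between zero and nonzero. In a new pattern 000 neither counts, and
  only the parity of the nonzero cells among \<open>b\<close>, \<open>c\<close>, \<open>d\<close>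
  matters.\<close>

lemma piggyback_cases:
  assumes "a \<in> {0,1,2}" "b \<in> {0,1,2}" "c \<in> {0,1,2}" "d \<in> {0,1,2}" "e \<in> {0,1,2}"
  defines "o1 \<equiv> \<lambda>v::nat. of_bool (v = 1) :: bit" and "n \<equiv> \<lambda>v::nat. of_bool (v \<noteq> 0) :: bit"
  shows "o1 (piggyback a b c d e) = o1 b + o1 c + o1 d"
    and "piggyback a b c d e \<in> {0,1,2}"
    and "o1 a + o1 b + o1 c = 1 \<Longrightarrow> o1 b + o1 c + o1 d = 0 \<Longrightarrow> o1 c + o1 d + o1 e = 1 \<Longrightarrow>
      n (piggyback a b c d e) = 1 + n c"
    and "o1 a + o1 b + o1 c = 0 \<Longrightarrow> o1 b + o1 c + o1 d = 0 \<Longrightarrow> o1 c + o1 d + o1 e = 0 \<Longrightarrow>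
      n (piggyback a b c d e) = n b + n c + n d"
  using assms(1-5) unfolding o1_def n_def
  by (elim insertE emptyE; simp add: piggyback_def one_ind_def N12_def)+

lemma piggyback_step_ones:
  assumes "states \<xi>"
  shows "ones (piggyback_step \<xi>) = lam (ones \<xi>)" "states (piggyback_step \<xi>)"
  using assms piggyback_cases(1,2)[of "\<xi> (x-2)" "\<xi> (x-1)" "\<xi> x" "\<xi> (x+1)" "\<xi> (x+2)" for x]
  unfolding states_def ones_def lam_def piggyback_step_def fun_eq_iff by blast+

lemma piggyback_step_nz:
  assumes "states \<xi>"
  defines "w \<equiv> ones (piggyback_step \<xi>)"
  shows "w (x - 1) = 1 \<Longrightarrow> w x = 0 \<Longrightarrow> w (x + 1) = 1 \<Longrightarrow> nz (piggyback_step \<xi>) x = 1 + nz \<xi> x"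
    and "w (x - 1) = 0 \<Longrightarrow> w x = 0 \<Longrightarrow> w (x + 1) = 0 \<Longrightarrow> nz (piggyback_step \<xi>) x = lam (nz \<xi>) x"
proof -
  have w: "w = lam (ones \<xi>)" unfolding w_def by (rule piggyback_step_ones[OF assms(1)])
  have s: "\<xi> y \<in> {0,1,2}" for y using assms(1) by (simp add: states_def)
  note c = piggyback_cases(3,4)[OF s s s s s, of "x-2" "x-1" x "x+1" "x+2"]
  show "w (x - 1) = 1 \<Longrightarrow> w x = 0 \<Longrightarrow> w (x + 1) = 1 \<Longrightarrow> nz (piggyback_step \<xi>) x = 1 + nz \<xi> x"
    using c(1) unfolding w lam_def nz_def ones_def piggyback_step_def by (simp add: algebra_simps)
  show "w (x - 1) = 0 \<Longrightarrow> w x = 0 \<Longrightarrow> w (x + 1) = 0 \<Longrightarrow> nz (piggyback_step \<xi>) x = lam (nz \<xi>) x"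
    using c(2) unfolding w lam_def nz_def ones_def piggyback_step_def by (simp add: algebra_simps)
qed

lemma piggyback_step_cong:
  assumes "\<And>y. \<bar>y - x\<bar> \<le> 2 * int n \<Longrightarrow> \<xi> y = \<zeta> y"
  shows "(piggyback_step ^^ n) \<xi> x = (piggyback_step ^^ n) \<zeta> x"
  using assms
proof (induction n arbitrary: x)
  case (Suc n)
  have "(piggyback_step ^^ n) \<xi> y = (piggyback_step ^^ n) \<zeta> y" if "\<bar>y - x\<bar> \<le> 2" for y
    by (rule Suc.IH) (use that Suc.prems in auto)
  then show ?case
    by (simp add: piggyback_step_def[of "(piggyback_step ^^ n) \<xi>"] piggyback_step_def[of "(piggyback_step ^^ n) \<zeta>"])
qed simp

lemma piggyback_pow_ones:
  assumes "states \<xi>"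
  shows "states ((piggyback_step ^^ n) \<xi>)" "ones ((piggyback_step ^^ n) \<xi>) = (lam ^^ n) (ones \<xi>)"
  by (induction n) (simp_all add: assms piggyback_step_ones)

section \<open>The counting machine\<close>

fun xorl :: "bool list \<Rightarrow> bool list \<Rightarrow> bool list" where
  "xorl (a # as) (b # bs) = (a \<noteq> b) # xorl as bs"
| "xorl _ _ = []"

text \<open>Inverts \<open>lam\<close> from left to right: \<open>a\<close> and \<open>b\<close> are
  the first two cells of the earlier row, the list is the later row without its first cell. The last
  computed cell is dropped, so that rows keep their length.\<close>

fun sweep :: "bool \<Rightarrow> bool \<Rightarrow> bool list \<Rightarrow> bool list" where
  "sweep a b [] = [a]"
| "sweep a b (c # cs) = a # sweep b (c \<noteq> (a \<noteq> b)) cs"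

datatype kind = A | R1 | R2 | R3 | R4 | R5
text \<open>\<open>Item k l c\<close> is an unknown parity of nonzero cells, over the positions \<open>l + i\<close> with \<open>i\<close> in
  \<open>offsets k\<close> (defined below); \<open>c\<close> is what it contributes to the code of the final row.
  Kind \<open>A\<close> is the middle of a pattern 101; \<open>R1\<close> to \<open>R5\<close> lie in a run of zeros that widens
  by two cells with each row, and \<open>roof\<close> lists what is left of them when the run ends.\<close>
datatype item = Item kind nat "bool list"

text \<open>A run that would outgrow \<open>R5\<close> is abandoned, which loses bit strings but
  never miscounts one.\<close>

fun grow :: "kind \<Rightarrow> kind option" where
  "grow A = Some R1"
| "grow R1 = Some R2"
| "grow R2 = Some R3"
| "grow R3 = Some R4"
| "grow R4 = Some R5"
| "grow R5 = None"

text \<open>Any three consecutive cells of a row 110110... contain two ones and one gap. So the ones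
  cancel when \<open>lam\<close> is summed over the offsets, and what is left are the gaps that
  occur an odd number of times. The gaps are the cells congruent to 0, 1 or 2 modulo 3, according to
  which of \<open>a\<close>, \<open>b\<close> and their sum is 0.\<close>

fun roof :: "kind \<Rightarrow> bool \<Rightarrow> bool \<Rightarrow> nat list" where
  "roof A a b = []"
| "roof R1 a b = (if \<not> a then [0] else if \<not> b then [1] else [2])"
| "roof R2 a b = (if \<not> a then [0] else if \<not> b then [4] else [2])"
| "roof R3 a b = (if \<not> a then [0, 3, 6] else if \<not> b then [1] else [5])"
| "roof R4 a b = (if \<not> a then [0] else if \<not> b then [4] else [8])"
| "roof R5 a b = (if \<not> a then [0, 6, 9] else if \<not> b then [1, 4, 10] else [2, 5, 8])"

text \<open>The list starts with the cells at \<open>l\<close> and \<open>l + 1\<close> of the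
  earlier row; together with the later row they determine the earlier one over the whole item. The
  Boolean tells whether the parity is complemented, which happens only in a pattern 101.\<close>

fun lift_item :: "kind \<Rightarrow> nat \<Rightarrow> bool list \<Rightarrow> bool list \<Rightarrow> (item list \<times> bool) option" where
  "lift_item k l c (a # b # _) =
    (if \<not> a \<and> \<not> b then map_option (\<lambda>k'. ([Item k' (l - 1) c], k = A)) (grow k)
     else if k = A then Some (if a then [] else [Item A l c], \<not> a)
     else Some (map (\<lambda>i. Item A (i + l) c) (roof k a b), False))"
| "lift_item k l c _ = None"

fun join :: "bool list \<Rightarrow> (item list \<times> bool) option \<Rightarrow> (item list \<times> bool list) option
    \<Rightarrow> (item list \<times> bool list) option" where
  "join c (Some (new, flip)) (Some (its, s)) = Some (new @ its, if flip then xorl s c else s)"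
| "join c _ _ = None"

fun lift_items :: "bool list \<Rightarrow> item list \<Rightarrow> bool list \<Rightarrow> (item list \<times> bool list) option" where
  "lift_items v [] s = Some ([], s)"
| "lift_items v (Item k l c # its) s = join c (lift_item k l c (drop l v)) (lift_items v its s)"

text \<open>Lists are coefficients of powers of \<open>u = 1 + X\<close>. As \<open>X\<^sup>d = 1 + u\<^sup>d\<close> for a power of two \<open>d\<close>,
  and \<open>X (1 + X + X\<^sup>2) = 1 + u\<^sup>3\<close>, the factors \<open>1 + u\<^sup>d\<close> with \<open>d = 1, 2, 3, 4, 6, 8, 12\<close> are
  compositions of translations and time steps; \<open>elim d\<close> uses one to clear the coefficient \<open>d\<close> places
  above the lowest one.\<close>
definition elim :: "nat \<Rightarrow> bool list \<Rightarrow> bool list" where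
  "elim d c = (case drop d c of True # _ \<Rightarrow> xorl c (replicate d False @ c) | _ \<Rightarrow> c)"

text \<open>The numbers are positions in the list \<open>words\<close>. Class 5 occurs twice, for
  the asymmetric ether and its mirror image. The length of a list is part of the key: it records how
  often \<open>u\<close> divides the row.\<close>

definition normal_forms :: "(bool list \<times> nat) list" where
  "normal_forms =
    [([], 0),
     ([True], 1),
     ([True, False], 2),
     ([True, False, False, False], 3),
     ([True, False, False, False, False, False, False, False], 4),
     ([True, False, False, False, False, True, False, False], 5),
     ([True, False, False, False, False, True, False, True], 5),
     ([True, False, False, False, False, True, False], 6),
     ([True, False, False, False, False, False, False, True], 7),
     ([True, False, False, False, False, False, False, False, False, False, False, False, False, False, False, True], 8),
     ([True, False, False, False, False, False, False, False, False, False, False, False, False, False, True, True], 9)]"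

definition nf_class :: "bool list \<Rightarrow> nat" where
  "nf_class c = (case map_of normal_forms c of Some k \<Rightarrow> k | None \<Rightarrow> 10)"

text \<open>The order is ascending because a factor \<open>1 + u^d\<close> changes only coefficients
  from \<open>d\<close> on, so that cleared ones stay cleared. The coefficients 5, 7, 9, 10, 11, 13,
  14 and 15 remain and form the invariant.\<close>

definition ether_class :: "bool list \<Rightarrow> nat" where
  "ether_class c = nf_class (fold elim [1, 2, 3, 4, 6, 8, 12] (dropWhile Not c))"

text \<open>Running off the end is intended: class 10, which stands for all other ethers, has no
  entry in the accumulator of length ten.\<close>

fun bump :: "nat \<Rightarrow> nat \<Rightarrow> nat list \<Rightarrow> nat list" where
  "bump k x [] = []"
| "bump 0 x (y # ys) = (y + x) # ys"
| "bump (Suc k) x (y # ys) = y # bump k x ys"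

text \<open>The two components count the bit strings of length \<open>2 n\<close> that resolve a single item as zero and as one.\<close>
fun law :: "kind \<Rightarrow> nat \<Rightarrow> nat \<times> nat" where
  "law A (Suc n) = (2 * 4 ^ n + snd (law A n) + snd (law R1 n), fst (law A n) + fst (law R1 n))"
| "law R1 (Suc n) = (3 * fst (law A n) + fst (law R2 n), 3 * snd (law A n) + snd (law R2 n))"
| "law R2 (Suc n) = (3 * fst (law A n), 3 * snd (law A n))"
| "law R4 (Suc n) = (3 * fst (law A n), 3 * snd (law A n))"
| "law k n = (0, 0)"

text \<open>When a run of one of these kinds ends, a single item of kind \<open>A\<close> is left,
  so the counts for one item obey a recursion. The roofs of \<open>R3\<close> and \<open>R5\<close>
  can consist of three items.\<close>

fun closed :: "item list \<Rightarrow> bool" where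
  "closed [] \<longleftrightarrow> True"
| "closed [Item k l c] \<longleftrightarrow> k \<in> {A, R1, R2, R4}"
| "closed _ \<longleftrightarrow> False"

fun close :: "nat \<Rightarrow> item list \<Rightarrow> bool list \<Rightarrow> nat list \<Rightarrow> nat list" where
  "close n [] s acc = bump (ether_class s) (4 ^ n) acc"
| "close n [Item k l c] s acc =
     bump (ether_class s) (fst (law k n)) (bump (ether_class (xorl s c)) (snd (law k n)) acc)"
| "close n _ s acc = acc"

type_synonym counter = "bool list \<Rightarrow> item list \<Rightarrow> bool list \<Rightarrow> nat list \<Rightarrow> nat list"

definition visit_opt :: "counter \<Rightarrow> bool list \<Rightarrow> (item list \<times> bool list) option \<Rightarrow> nat list \<Rightarrow> nat list" where
  "visit_opt f v r acc = (case r of None \<Rightarrow> acc | Some (its, s) \<Rightarrow> f v its s acc)"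

definition visit :: "counter \<Rightarrow> bool \<Rightarrow> bool \<Rightarrow> counter" where
  "visit f a b w its s acc =
    (let v = sweep a b (tl w) in visit_opt f v (lift_items v its s) acc)"

definition branch :: "bool \<Rightarrow> counter \<Rightarrow> counter" where
  "branch restricted f w its s acc =
    (let acc' = visit f False True w its s (visit f False False w its s acc)
     in if restricted then acc'
        else visit f True True w its s (visit f True False w its s acc'))"

text \<open>The search gives up three levels before the end, so its result is only a lower bound.\<close>
primrec dfs :: "nat \<Rightarrow> counter" where
  "dfs 0 w its s acc = (if closed its then close 0 its s acc else acc)"
| "dfs (Suc n) w its s acc =
    (if closed its then close (Suc n) its s acc
     else if n < 3 then acc else branch False (dfs n) w its s acc)"

fun count_top :: "bool list \<Rightarrow> counter" where
  "count_top [] = dfs 7"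
| "count_top (f # fs) = branch f (count_top fs)"

text \<open>The width 79 suffices for 15 backward steps, each of which extends an item by at most
  one cell on either side: the first gap used is at 17 > 15, and the last one satisfies 62 + 1 + 15
  < 79. The sixteen gaps 17, 20, ..., 62 represent all classes modulo 16, as 3 is invertible
  there.\<close>

definition root_row :: "bool list" where
  "root_row = map (\<lambda>i. i mod 3 \<noteq> 2) [0..<79]"

text \<open>Since \<open>X = 1 + u\<close>, multiplication by \<open>X\<close> adds the list to its
  shift by one place; \<open>xorl\<close> truncates, which is reduction modulo \<open>u^16\<close>
  for lists of length 16.\<close>

fun times_X :: "nat \<Rightarrow> bool list \<Rightarrow> bool list" where
  "times_X 0 c = c"
| "times_X (Suc n) c = times_X n (xorl c (False # c))"

definition monomial :: "nat \<Rightarrow> bool list" where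
  "monomial z = times_X z (True # replicate 15 False)"

definition root_items :: "item list" where
  "root_items = map (\<lambda>z. Item A z (monomial z)) [17, 20, 23, 26, 29, 32, 35, 38, 41, 44, 47, 50, 53, 56, 59, 62]"

text \<open>The restricted bits change under translation by 3, 6, 12 and 24 cells respectively. This makes the
  48 translates of the counted set disjoint.\<close>
definition restrictions :: "bool list" where
  "restrictions = [True, True, False, True, False, False, False, True]"

section \<open>Evaluation of the count\<close>

text \<open>Level numbers, offsets and class numbers are rewritten as unary numerals, so that the simplifier
  can match on them; only the counts are binary.\<close>

abbreviation (input) un3 :: nat where "un3 \<equiv> Suc (Suc (Suc 0))"
abbreviation (input) un4 :: nat where "un4 \<equiv> Suc un3"
abbreviation (input) un5 :: nat where "un5 \<equiv> Suc un4"
abbreviation (input) un6 :: nat where "un6 \<equiv> Suc un5"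
abbreviation (input) un7 :: nat where "un7 \<equiv> Suc un6"
abbreviation (input) un8 :: nat where "un8 \<equiv> Suc un7"
abbreviation (input) un9 :: nat where "un9 \<equiv> Suc un8"
abbreviation (input) un10 :: nat where "un10 \<equiv> Suc un9"
abbreviation (input) un11 :: nat where "un11 \<equiv> Suc un10"
abbreviation (input) un12 :: nat where "un12 \<equiv> Suc un11"

text \<open>The arguments are the coefficients 5, 7, 9, 10, 11, 13, 14 and 15, those that no
  elimination clears.\<close>

fun nf16 :: "bool \<Rightarrow> bool \<Rightarrow> bool \<Rightarrow> bool \<Rightarrow> bool \<Rightarrow> bool \<Rightarrow> bool \<Rightarrow> bool \<Rightarrow> nat" where
  "nf16 False False False False False False False True = 8"
| "nf16 False False False False False False True True = 9"
| "nf16 _ _ _ _ _ _ _ _ = 10"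

text \<open>The patterns anticipate what the eliminations leave: the leading coefficient is 1 and
  the places 1, 2, 3, 4 and 6 are clear. Where no normal form has the given length, the entries stay
  arbitrary.\<close>

lemma nf_class_eval:
  "nf_class [] = 0"
  "nf_class [True] = (Suc 0)"
  "nf_class [True, False] = (Suc (Suc 0))"
  "nf_class [True, False, False, False] = un3"
  "nf_class [True, False, False, False, False, False, False, False] = un4"
  "nf_class [True, False, False, False, False, True, False, False] = un5"
  "nf_class [True, False, False, False, False, True, False, True] = un5"
  "nf_class [True, False, False, False, False, True, False] = un6"
  "nf_class [True, False, False, False, False, False, False, True] = un7"
  "nf_class [True,False,False,False,False,False,False] = un10"
  "nf_class [x0, x1, x2] = un10"
  "nf_class [x0, x1, x2, x3, x4] = un10"
  "nf_class [x0, x1, x2, x3, x4, x5] = un10"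
  "nf_class [x0, x1, x2, x3, x4, x5, x6, x7, x8] = un10"
  "nf_class [x0, x1, x2, x3, x4, x5, x6, x7, x8, x9] = un10"
  "nf_class [x0, x1, x2, x3, x4, x5, x6, x7, x8, x9, x10] = un10"
  "nf_class [x0, x1, x2, x3, x4, x5, x6, x7, x8, x9, x10, x11] = un10"
  "nf_class [x0, x1, x2, x3, x4, x5, x6, x7, x8, x9, x10, x11, x12] = un10"
  "nf_class [x0, x1, x2, x3, x4, x5, x6, x7, x8, x9, x10, x11, x12, x13] = un10"
  "nf_class [x0, x1, x2, x3, x4, x5, x6, x7, x8, x9, x10, x11, x12, x13, x14] = un10"
  by (simp_all add: nf_class_def normal_forms_def)

lemma nf_class_eval16:
  "nf_class [True, False, False, False, False, a, False, b, False, c, d, e, False, f, g, h] =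
    nf16 a b c d e f g h"
  by (cases a; cases b; cases c; cases d; cases e; cases f; cases g; cases h;
    simp add: nf_class_def normal_forms_def)

lemma nf16_eval:
  "nf16 True b c d e f g h = un10"
  "nf16 False True c d e f g h = un10"
  "nf16 False False True d e f g h = un10"
  "nf16 False False False True e f g h = un10"
  "nf16 False False False False True f g h = un10"
  "nf16 False False False False False True g h = un10"
  "nf16 False False False False False False False False = un10"
  "nf16 False False False False False False False True = un8"
  "nf16 False False False False False False True False = un10"
  "nf16 False False False False False False True True = un9"
  by simp_all

lemma lift_item_eval:
  "lift_item A l c (True # b # bs) = Some ([], False)"
  "lift_item A l c (False # True # bs) = Some ([Item A l c], True)"
  "lift_item A (Suc l) c (False # False # bs) = Some ([Item R1 l c], True)"
  "lift_item R1 (Suc l) c (False # False # bs) = Some ([Item R2 l c], False)"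
  "lift_item R2 (Suc l) c (False # False # bs) = Some ([Item R3 l c], False)"
  "lift_item R3 (Suc l) c (False # False # bs) = Some ([Item R4 l c], False)"
  "lift_item R4 (Suc l) c (False # False # bs) = Some ([Item R5 l c], False)"
  "lift_item R5 l c (False # False # bs) = None"
  "lift_item R1 l c (False # True # bs) = Some ([Item A l c], False)"
  "lift_item R1 l c (True # False # bs) = Some ([Item A (Suc l) c], False)"
  "lift_item R1 l c (True # True # bs) = Some ([Item A (Suc (Suc l)) c], False)"
  "lift_item R2 l c (False # True # bs) = Some ([Item A l c], False)"
  "lift_item R2 l c (True # False # bs) = Some ([Item A (Suc (Suc (Suc (Suc l)))) c], False)"
  "lift_item R2 l c (True # True # bs) = Some ([Item A (Suc (Suc l)) c], False)"
  "lift_item R3 l c (False # True # bs) = Some ([Item A l c, Item A (Suc (Suc (Suc l))) c, Item A (Suc (Suc (Suc (Suc (Suc (Suc l)))))) c], False)"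
  "lift_item R3 l c (True # False # bs) = Some ([Item A (Suc l) c], False)"
  "lift_item R3 l c (True # True # bs) = Some ([Item A (Suc (Suc (Suc (Suc (Suc l))))) c], False)"
  "lift_item R4 l c (False # True # bs) = Some ([Item A l c], False)"
  "lift_item R4 l c (True # False # bs) = Some ([Item A (Suc (Suc (Suc (Suc l)))) c], False)"
  "lift_item R4 l c (True # True # bs) = Some ([Item A (Suc (Suc (Suc (Suc (Suc (Suc (Suc (Suc l)))))))) c], False)"
  "lift_item R5 l c (False # True # bs) = Some ([Item A l c, Item A (Suc (Suc (Suc (Suc (Suc (Suc l)))))) c, Item A (Suc (Suc (Suc (Suc (Suc (Suc (Suc (Suc (Suc l))))))))) c], False)"
  "lift_item R5 l c (True # False # bs) = Some ([Item A (Suc l) c, Item A (Suc (Suc (Suc (Suc l)))) c, Item A (Suc (Suc (Suc (Suc (Suc (Suc (Suc (Suc (Suc (Suc l)))))))))) c], False)"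
  "lift_item R5 l c (True # True # bs) = Some ([Item A (Suc (Suc l)) c, Item A (Suc (Suc (Suc (Suc (Suc l))))) c, Item A (Suc (Suc (Suc (Suc (Suc (Suc (Suc (Suc l)))))))) c], False)"
  by simp_all

lemma join_eval:
  "join c (Some (new, False)) (Some (its, s)) = Some (new @ its, s)"
  "join c (Some (new, True)) (Some (its, s)) = Some (new @ its, xorl s c)"
  "join c None r = None"
  "join c q None = None"
  by simp_all

lemma drop_eval:
  "drop 0 xs = xs"
  "drop (Suc 0) (a # xs) = xs"
  "drop (Suc (Suc 0)) (a # b # xs) = xs"
  "drop un3 (a # b # c # xs) = xs"
  "drop (Suc (Suc (Suc (Suc n)))) (a # b # c # d # xs) = drop n xs"
  "drop (Suc (Suc (Suc (Suc n)))) [a, b, c] = []"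
  "drop (Suc (Suc (Suc n))) [a, b] = []"
  "drop (Suc (Suc n)) [a] = []"
  by simp_all

lemma sweep_eval:
  "sweep a b [] = [a]"
  "sweep False False (False # cs) = False # sweep False False cs"
  "sweep False False (True # cs) = False # sweep False True cs"
  "sweep False True (False # cs) = False # sweep True True cs"
  "sweep False True (True # cs) = False # sweep True False cs"
  "sweep True False (False # cs) = True # sweep False True cs"
  "sweep True False (True # cs) = True # sweep False False cs"
  "sweep True True (False # cs) = True # sweep True False cs"
  "sweep True True (True # cs) = True # sweep True True cs"
  by simp_all

lemma xorl_eval:
  "xorl [] bs = []"
  "xorl as [] = []"
  "xorl (False # as) (False # bs) = False # xorl as bs"
  "xorl (False # as) (True # bs) = True # xorl as bs"
  "xorl (True # as) (False # bs) = True # xorl as bs"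
  "xorl (True # as) (True # bs) = False # xorl as bs"
  by simp_all

fun xorl_pad :: "bool list \<Rightarrow> nat \<Rightarrow> bool list \<Rightarrow> bool list" where
  "xorl_pad cs 0 ds = xorl cs ds"
| "xorl_pad (c # cs) (Suc n) ds = c # xorl_pad cs n ds"
| "xorl_pad [] n ds = []"

lemma xorl_pad: "xorl cs (replicate n False @ ds) = xorl_pad cs n ds"
  by (induction cs n ds rule: xorl_pad.induct) auto

definition elim_test :: "bool list \<Rightarrow> nat \<Rightarrow> bool list \<Rightarrow> bool list" where
  "elim_test bs d c = (case bs of True # _ \<Rightarrow> xorl_pad c d c | _ \<Rightarrow> c)"

lemma elim_eval:
  "elim d c = elim_test (drop d c) d c"
  "elim_test [] d c = c"
  "elim_test (False # bs) d c = c"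
  "elim_test (True # bs) d c = xorl_pad c d c"
  by (simp_all add: elim_def elim_test_def xorl_pad split: list.split bool.split)

lemma dropWhile_eval:
  "dropWhile Not [] = []"
  "dropWhile Not (False # c) = dropWhile Not c"
  "dropWhile Not (True # c) = True # c"
  by simp_all

lemma ether_class_eval: "ether_class c = nf_class (elim un12 (elim un8
    (elim un6 (elim un4 (elim un3 (elim (Suc (Suc 0)) (elim (Suc 0) (dropWhile Not c))))))))"
  by (simp add: ether_class_def numeral_eq_Suc)

text \<open>The search proper is entered at level 7 and branches only as long as the next level is
  at least 3, so these are all the levels at which a node is closed.\<close>

lemma law_eval:
  "fst (law A un3) = 34"
  "snd (law A un3) = 14"
  "fst (law R1 un3) = 30"
  "snd (law R1 un3) = 6"
  "fst (law R2 un3) = 24"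
  "snd (law R2 un3) = 6"
  "fst (law R4 un3) = 24"
  "snd (law R4 un3) = 6"
  "fst (law A un4) = 148"
  "snd (law A un4) = 64"
  "fst (law R1 un4) = 126"
  "snd (law R1 un4) = 48"
  "fst (law R2 un4) = 102"
  "snd (law R2 un4) = 42"
  "fst (law R4 un4) = 102"
  "snd (law R4 un4) = 42"
  "fst (law A un5) = 624"
  "snd (law A un5) = 274"
  "fst (law R1 un5) = 546"
  "snd (law R1 un5) = 234"
  "fst (law R2 un5) = 444"
  "snd (law R2 un5) = 192"
  "fst (law R4 un5) = 444"
  "snd (law R4 un5) = 192"
  "fst (law A un6) = 2556"
  "snd (law A un6) = 1170"
  "fst (law R1 un6) = 2316"
  "snd (law R1 un6) = 1014"
  "fst (law R2 un6) = 1872"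
  "snd (law R2 un6) = 822"
  "fst (law R4 un6) = 1872"
  "snd (law R4 un6) = 822"
  "fst (law A un7) = 10376"
  "snd (law A un7) = 4872"
  "fst (law R1 un7) = 9540"
  "snd (law R1 un7) = 4332"
  "fst (law R2 un7) = 7668"
  "snd (law R2 un7) = 3510"
  "fst (law R4 un7) = 7668"
  "snd (law R4 un7) = 3510"
  by simp_all

definition pow4 :: "nat \<Rightarrow> nat" where "pow4 n = 4 ^ n"

lemma pow4_eval:
  "pow4 un3 = 64"
  "pow4 un4 = 256"
  "pow4 un5 = 1024"
  "pow4 un6 = 4096"
  "pow4 un7 = 16384"
  by (simp_all add: pow4_def)

definition expand :: "counter \<Rightarrow> counter" where "expand f w its s acc = branch False f w its s acc"
definition expand2 :: "counter \<Rightarrow> counter" where "expand2 f w its s acc = branch True f w its s acc"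
definition enter :: "counter \<Rightarrow> counter" where
  "enter f v its s acc = visit_opt f v (lift_items v its s) acc"

lemma branch_eval:
  "expand f (w0 # w) its s acc =
    enter f (sweep True True w) its s (enter f (sweep True False w) its s
      (enter f (sweep False True w) its s (enter f (sweep False False w) its s acc)))"
  "expand2 f (w0 # w) its s acc =
    enter f (sweep False True w) its s (enter f (sweep False False w) its s acc)"
  "enter f v its s acc = visit_opt f v (lift_items v its s) acc"
  "visit_opt f v None acc = acc"
  "visit_opt f v (Some (its, s)) acc = f v its s acc"
  by (simp_all add: expand_def expand2_def branch_def enter_def visit_def visit_opt_def Let_def)

lemma dfs_eval_closed:
  "dfs n w [] s acc = bump (ether_class s) (pow4 n) acc"
  "dfs n w [Item A l c] s acc =
    bump (ether_class s) (fst (law A n)) (bump (ether_class (xorl s c)) (snd (law A n)) acc)"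
  "dfs n w [Item R1 l c] s acc =
    bump (ether_class s) (fst (law R1 n)) (bump (ether_class (xorl s c)) (snd (law R1 n)) acc)"
  "dfs n w [Item R2 l c] s acc =
    bump (ether_class s) (fst (law R2 n)) (bump (ether_class (xorl s c)) (snd (law R2 n)) acc)"
  "dfs n w [Item R4 l c] s acc =
    bump (ether_class s) (fst (law R4 n)) (bump (ether_class (xorl s c)) (snd (law R4 n)) acc)"
  by (cases n; simp add: pow4_def)+

lemma dfs_eval_open:
  "dfs 0 w [Item R3 l c] s acc = acc"
  "dfs (Suc 0) w [Item R3 l c] s acc = acc"
  "dfs (Suc (Suc 0)) w [Item R3 l c] s acc = acc"
  "dfs un3 w [Item R3 l c] s acc = acc"
  "dfs (Suc (Suc (Suc (Suc n)))) w [Item R3 l c] s acc = expand (dfs (Suc (Suc (Suc n)))) w [Item R3 l c] s acc"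
  "dfs 0 w [Item R5 l c] s acc = acc"
  "dfs (Suc 0) w [Item R5 l c] s acc = acc"
  "dfs (Suc (Suc 0)) w [Item R5 l c] s acc = acc"
  "dfs un3 w [Item R5 l c] s acc = acc"
  "dfs (Suc (Suc (Suc (Suc n)))) w [Item R5 l c] s acc = expand (dfs (Suc (Suc (Suc n)))) w [Item R5 l c] s acc"
  "dfs 0 w (i # j # is) s acc = acc"
  "dfs (Suc 0) w (i # j # is) s acc = acc"
  "dfs (Suc (Suc 0)) w (i # j # is) s acc = acc"
  "dfs un3 w (i # j # is) s acc = acc"
  "dfs (Suc (Suc (Suc (Suc n)))) w (i # j # is) s acc = expand (dfs (Suc (Suc (Suc n)))) w (i # j # is) s acc"
  by (simp_all add: expand_def)

lemma count_top_eval: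
  "count_top [] w its s acc = dfs un7 w its s acc"
  "count_top (True # fs) w its s acc = expand2 (count_top fs) w its s acc"
  "count_top (False # fs) w its s acc = expand (count_top fs) w its s acc"
  by (simp_all add: expand_def expand2_def numeral_eq_Suc)

lemma append_eval: "[] @ ys = ys" "(x # xs) @ ys = x # (xs @ ys)"
  by simp_all

lemmas count_eval = lift_items.simps lift_item_eval join_eval drop_eval drop_Nil sweep_eval xorl_eval
  xorl_pad.simps elim_eval dropWhile_eval ether_class_eval nf_class_eval nf_class_eval16 nf16_eval bump.simps law_eval
  pow4_eval branch_eval dfs_eval_closed dfs_eval_open count_top_eval append_eval
  arith_simps add_0 add_0_right

lemma root_items_numeral:
  "root_items = [Item A 17 [True, True, False, False, False, False, False, False, False, False, False, False, False, False, False, False],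
    Item A 20 [True, False, False, False, True, False, False, False, False, False, False, False, False, False, False, False],
    Item A 23 [True, True, True, True, True, True, True, True, False, False, False, False, False, False, False, False],
    Item A 26 [True, False, True, False, False, False, False, False, True, False, True, False, False, False, False, False],
    Item A 29 [True, True, False, False, True, True, False, False, True, True, False, False, True, True, False, False],
    Item A 32 [True, False, False, False, False, False, False, False, False, False, False, False, False, False, False, False],
    Item A 35 [True, True, True, True, False, False, False, False, False, False, False, False, False, False, False, False],
    Item A 38 [True, False, True, False, True, False, True, False, False, False, False, False, False, False, False, False],
    Item A 41 [True, True, False, False, False, False, False, False, True, True, False, False, False, False, False, False],
    Item A 44 [True, False, False, False, True, False, False, False, True, False, False, False, True, False, False, False],
    Item A 47 [True, True, True, True, True, True, True, True, True, True, True, True, True, True, True, True],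
    Item A 50 [True, False, True, False, False, False, False, False, False, False, False, False, False, False, False, False],
    Item A 53 [True, True, False, False, True, True, False, False, False, False, False, False, False, False, False, False],
    Item A 56 [True, False, False, False, False, False, False, False, True, False, False, False, False, False, False, False],
    Item A 59 [True, True, True, True, False, False, False, False, True, True, True, True, False, False, False, False],
    Item A 62 [True, False, True, False, True, False, True, False, True, False, True, False, True, False, True, False]]"
  by (simp only: root_items_def list.map monomial_def eval_nat_numeral BitM.simps One_nat_def times_X.simps xorl_eval replicate.simps)

lemmas root_items_eval = root_items_numeral[unfolded eval_nat_numeral BitM.simps One_nat_def]

lemma root_row_eval: "root_row = [True, True, False, True, True, False, True, True, False, True, True, False, True, True, False, True, True, False, True, True, False, True, True, False, True, True, False, True, True, False, True, True, False, True, True, False, True, True, False, True, True, False, True, True, False, True, True, False, True, True, False, True, True, False, True, True, False, True, True, False, True, True, False, True, True, False, True, True, False, True, True, False, True, True, False, True, True, False, True]"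
  unfolding root_row_def by (simp add: upt_conv_Cons)

lemma count_result:
  "count_top restrictions root_row root_items [False, False, False, False, False, False, False, False, False, False, False, False, False, False, False, False] [0, 0, 0, 0, 0, 0, 0, 0, 0, 0] =
    [33554432, 2809292, 1003704, 1776808, 719680, 2062900, 1442028, 9182360, 2481888, 1525972]"
  by (simp only: restrictions_def root_row_eval root_items_eval count_eval)

section \<open>Soundness of the machine\<close>

text \<open>These are the supports of the powers of \<open>1 + X + X^2\<close> modulo 2, displaced
  by one: over zeros a parity is pulled back by applying \<open>lam\<close> to its set of positions,
  while the left end \<open>l\<close> of the run moves one cell to the left.\<close>

fun offsets :: "kind \<Rightarrow> nat list" where
  "offsets A = [0]"
| "offsets R1 = [1]"
| "offsets R2 = [1, 2, 3]"
| "offsets R3 = [1, 3, 5]"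
| "offsets R4 = [1, 2, 4, 6, 7]"
| "offsets R5 = [1, 5, 9]"

fun width :: "kind \<Rightarrow> nat" where
  "width A = 1" | "width R1 = 2" | "width R2 = 4" | "width R3 = 6" | "width R4 = 8" | "width R5 = 10"

section \<open>Items and one step backwards in time\<close>

fun item_val :: "row \<Rightarrow> item \<Rightarrow> bit" where
  "item_val g (Item k l c) = (\<Sum>i\<leftarrow>offsets k. g (int l + int i))"

fun item_ok :: "row \<Rightarrow> item \<Rightarrow> bool" where
  "item_ok w (Item k l c) \<longleftrightarrow>
    (if k = A then w (int l - 1) = 1 \<and> w (int l) = 0 \<and> w (int l + 1) = 1
     else (\<forall>i\<le>width k. w (int l + int i) = 0))"

fun room :: "nat \<Rightarrow> item \<Rightarrow> bool" where
  "room n (Item k l c) \<longleftrightarrow> n < l \<and> l + width k + n < 79"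

fun code_of :: "item \<Rightarrow> bool list" where "code_of (Item k l c) = c"

definition row_list :: "row \<Rightarrow> bool list" where
  "row_list w = map (\<lambda>i. w (int i) = 1) [0..<79]"

lemma roof_sum:
  fixes h :: row
  assumes h: "\<And>j. - 1 \<le> j \<Longrightarrow> j \<le> int (width k) + 1 \<Longrightarrow>
      (if j mod 3 = 0 then a else if j mod 3 = 1 then b else a \<noteq> b) \<Longrightarrow> h j = 1"
    and "a \<or> b" "k \<noteq> A"
  shows "(\<Sum>i\<leftarrow>offsets k. h (int i - 1) + h (int i) + h (int i + 1)) = (\<Sum>i\<leftarrow>roof k a b. h (int i))"
proof -
  have s: "x + (1 + y) = 1 + (x + y)" "1 + (1 + y) = y" "(1::bit) + 1 = 0" for x y :: bit
    by (cases x; cases y; simp)+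
  show ?thesis
  proof (cases k)
    case R1 then show ?thesis using assms(2) h[of 0] h[of 1] h[of 2]
      by (cases a; cases b) (simp_all add: s)
  next
    case R2 then show ?thesis using assms(2) h[of 0] h[of 2] h[of 4]
      by (cases a; cases b) (simp_all add: s add.commute add.left_commute add.assoc)
  next
    case R3 then show ?thesis using assms(2) h[of 0] h[of 1] h[of 3] h[of 5] h[of 6]
      by (cases a; cases b) (simp_all add: s add.commute add.left_commute add.assoc)
  next
    case R4 then show ?thesis using assms(2) h[of 0] h[of 4] h[of 8]
      by (cases a; cases b) (simp_all add: s add.commute add.left_commute add.assoc)
  next
    case R5 then show ?thesis using assms(2) h[of 0] h[of 1] h[of 2] h[of 4] h[of 5] h[of 6] h[of 8] h[of 9] h[of 10]
      by (cases a; cases b) (simp_all add: s add.commute add.left_commute add.assoc)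
  qed (use assms in simp)
qed

lemma all_le_two: "(\<forall>i\<le>2::nat. P i) \<longleftrightarrow> P 0 \<and> P 1 \<and> P 2"
  by (auto simp: numeral_2_eq_2 le_Suc_eq)

text \<open>Where \<open>w\<close> vanishes, \<open>lam v = w\<close> is a recursion of period 3 for
  the earlier row \<open>v\<close>, and it reaches one cell beyond the run on both sides. If the
  cells at \<open>l\<close> and \<open>l + 1\<close> are 0, then \<open>v\<close> vanishes there and
  the run has widened; otherwise \<open>v\<close> reads 110110... and each of its zeros is the
  middle of a 101.\<close>

lemma lift_item_sound:
  assumes lam: "lam v = w" and ok: "item_ok w (Item k l c)" and room: "room (Suc n) (Item k l c)"
    and step: "lift_item k l c (drop l (row_list v)) = Some (new, flip)"
  shows "\<forall>it\<in>set new. item_ok v it \<and> room n it \<and> code_of it = c"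
    and "states \<xi> \<Longrightarrow> ones \<xi> = v \<Longrightarrow> item_val (nz (piggyback_step \<xi>)) (Item k l c) =
      of_bool flip + (\<Sum>it\<leftarrow>new. item_val (nz \<xi>) it)"
proof -
  have len: "Suc l < 79" "1 \<le> l" using room by (cases k; simp)+
  then have "drop l (row_list v) = (v (int l) = 1) # (v (int l + 1) = 1) # drop (l + 2) (row_list v)"
    by (simp add: row_list_def Cons_nth_drop_Suc[symmetric] add.commute)
  then have st: "lift_item k l c ((v (int l) = 1) # (v (int l + 1) = 1) # drop (l + 2) (row_list v)) = Some (new, flip)"
    using step by simp
  have w: "w x = v (x - 1) + v x + v (x + 1)" for x using lam by (simp add: lam_def fun_eq_iff)
  have nzA: "w (x - 1) = 1 \<Longrightarrow> w x = 0 \<Longrightarrow> w (x + 1) = 1 \<Longrightarrow> nz (piggyback_step \<xi>) x = 1 + nz \<xi> x"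
    and nzZ: "w (x - 1) = 0 \<Longrightarrow> w x = 0 \<Longrightarrow> w (x + 1) = 0 \<Longrightarrow> nz (piggyback_step \<xi>) x = nz \<xi> (x - 1) + nz \<xi> x + nz \<xi> (x + 1)"
    and nz1: "v x = 1 \<Longrightarrow> nz \<xi> x = 1"
    if "states \<xi>" "ones \<xi> = v" for \<xi> x
  proof -
    have "ones (piggyback_step \<xi>) = w" using piggyback_step_ones(1)[OF that(1)] that(2) lam by simp
    then show "w (x - 1) = 1 \<Longrightarrow> w x = 0 \<Longrightarrow> w (x + 1) = 1 \<Longrightarrow> nz (piggyback_step \<xi>) x = 1 + nz \<xi> x"
      and "w (x - 1) = 0 \<Longrightarrow> w x = 0 \<Longrightarrow> w (x + 1) = 0 \<Longrightarrow> nz (piggyback_step \<xi>) x = nz \<xi> (x - 1) + nz \<xi> x + nz \<xi> (x + 1)"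
      using piggyback_step_nz[OF that(1), of x] by (simp_all add: lam_def)
    show "v x = 1 \<Longrightarrow> nz \<xi> x = 1" using fun_cong[OF that(2), of x] by (auto simp: ones_def nz_def)
  qed
  have lm: "int (l - Suc 0) = int l - 1" using len by simp
  define g where "g i = v (int l + i)" for i
  have gi: "v (int l + i) = g i" "v (i + int l) = g i" "v (int l) = g 0" "v (int l - 1) = g (-1)" "v (int l - 2) = g (-2)" for i by (simp_all add: g_def add.commute)
  have Z: "g (int i + 1) = g (int i) + g (int i - 1)" if "k \<noteq> A" "i \<le> width k" for i
  proof -
    have "w (int l + int i) = 0" using ok that by auto
    then show ?thesis unfolding w g_def
      by (cases "v (int l + int i)"; cases "v (int l + int i - 1)"; cases "v (int l + int i + 1)"; simp add: algebra_simps)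
  qed
  define pat :: "int \<Rightarrow> bit" where "pat r = (if r = 0 then g 0 else if r = 1 then g 1 else g 0 + g 1)" for r
  have g_nat: "g (int i) = pat (int i mod 3) \<and> g (int i + 1) = pat ((int i + 1) mod 3)" if "k \<noteq> A" "i \<le> width k" for i
    using that(2)
  proof (induction i)
    case (Suc i)
    have IH: "g (int i) = pat (int i mod 3)" "g (int i + 1) = pat ((int i + 1) mod 3)" using Suc by simp_all
    have "g (int i + 2) = g (int i + 1) + g (int i)" using Z[OF that(1) Suc.prems] by (simp add: algebra_simps)
    moreover have "int i mod 3 = 0 \<or> int i mod 3 = 1 \<or> int i mod 3 = 2" by presburger
    moreover have "(int i + 1) mod 3 = (int i mod 3 + 1) mod 3" "(int i + 2) mod 3 = (int i mod 3 + 2) mod 3" by presburger+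
    ultimately have "g (int i + 2) = pat ((int i + 2) mod 3)" unfolding IH
      by (elim disjE) (simp_all add: pat_def add.commute add.left_commute)
    then show ?case using IH(2) by (simp add: algebra_simps)
  qed (simp add: pat_def)
  have G: "v (int l + j) = pat (j mod 3)" if "k \<noteq> A" "- 1 \<le> j" "j \<le> int (width k) + 1" for j
  proof -
    have "j = -1 \<or> 0 \<le> j \<and> j \<le> int (width k) \<or> j = int (width k) + 1"
      using that by linarith
    then consider "j = -1" | i where "j = int i" "i \<le> width k" | "j = int (width k) + 1"
      by (metis nonneg_int_cases of_nat_le_iff)
    then show ?thesis
    proof cases
      case 1
      have "g (- 1) = g 0 + g 1" using Z[OF that(1), of 0] by (simp add: add.left_commute add.commute)
      then show ?thesis using 1 by (simp add: gi(1)[of "-1"] pat_def del: add_uminus_conv_diff)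
    qed (use g_nat[OF that(1)] in \<open>auto simp: g_def\<close>)
  qed
  show "\<forall>it\<in>set new. item_ok v it \<and> room n it \<and> code_of it = c"
  proof (cases "k = A")
    case True
    have "w (int l - 1) = 1" "w (int l) = 0" "w (int l + 1) = 1" using ok True by auto
    then show ?thesis using st True len room unfolding w
      by (cases "v (int l)"; cases "v (int l + 1)"; cases "v (int l - 1)"; auto simp: gi of_nat_diff all_le_two)
  next
    case False
    show ?thesis
    proof (cases "g 0 = 0 \<and> g 1 = 0")
      case True
      then have v0: "v (int l + j) = 0" if "- 1 \<le> j" "j \<le> int (width k) + 1" for j
        using G[OF False that] by (simp add: pat_def)
      then have "v (int (l - 1) + int i) = 0" if "i \<le> width k + 2" for i
      proof -
        have "v (int l + (int i - 1)) = 0" by (rule v0) (use that in auto)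
        moreover have "int (l - 1) + int i = int l + (int i - 1)" using len by simp
        ultimately show ?thesis by presburger
      qed
      then show ?thesis using st True False len room by (cases k) (auto simp: gi)
    next
      case nonzero: False
      have A_ok: "item_ok v (Item A (i + l) c)" if "1 \<le> i + 1" "i \<le> width k" "pat (int i mod 3) = 0" for i
      proof -
        have "v (int l + (int i - 1)) = pat ((int i - 1) mod 3)" "v (int l + int i) = pat (int i mod 3)"
          "v (int l + (int i + 1)) = pat ((int i + 1) mod 3)"
          using that by (intro G[OF False]; simp)+
        moreover have "int i mod 3 = 0 \<or> int i mod 3 = 1 \<or> int i mod 3 = 2" by presburger
        moreover have "(int i + 1) mod 3 = (int i mod 3 + 1) mod 3" "(int i - 1) mod 3 = (int i mod 3 + 2) mod 3" by presburger+
        ultimately have "v (int l + (int i - 1)) = 1 \<and> v (int l + int i) = 0 \<and> v (int l + (int i + 1)) = 1"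
          using nonzero that(3)
          by (elim disjE; cases "g 0"; cases "g 1"; simp add: pat_def split: if_splits)
        moreover have "int (i + l) - 1 = int l + (int i - 1)" "int (i + l) = int l + int i" "int (i + l) + 1 = int l + (int i + 1)" by simp_all
        ultimately show ?thesis by (simp only: item_ok.simps if_True) simp
      qed
      have new: "new = map (\<lambda>i. Item A (i + l) c) (roof k (g 0 = 1) (g 1 = 1))"
        using st nonzero False by (auto simp: gi)
      have "\<forall>i\<in>set (roof k (g 0 = 1) (g 1 = 1)). i \<le> width k \<and> pat (int i mod 3) = 0"
        using nonzero by (cases k; cases "g 0"; cases "g 1"; simp add: pat_def)
      then show ?thesis using A_ok room unfolding new by (auto simp del: item_ok.simps)
    qed
  qed
  show "item_val (nz (piggyback_step \<xi>)) (Item k l c) =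
      of_bool flip + (\<Sum>it\<leftarrow>new. item_val (nz \<xi>) it)" if "states \<xi>" "ones \<xi> = v"
  proof (cases "k = A")
    case True
    \<comment> \<open>A 1 at \<open>l\<close> is a nonzero cell and flips to zero, which makes the
      parity known.\<close>
    then show ?thesis using st ok nzA[OF that, of "int l"] nz1[OF that]
      by (cases "v (int l)"; cases "v (int l + 1)"; auto simp: lm)
  next
    case False
    define h where "h j = nz \<xi> (int l + j)" for j
    have hv: "h j = 1" if "- 1 \<le> j" "j \<le> int (width k) + 1" "pat (j mod 3) = 1" for j
      unfolding h_def using G[OF False that(1,2)] that(3) nz1[OF \<open>states \<xi>\<close> \<open>ones \<xi> = v\<close>] by simp
    have "nz (piggyback_step \<xi>) (int l + int i) = h (int i - 1) + h (int i) + h (int i + 1)" if "1 \<le> i" "i + 1 \<le> width k" for i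
    proof -
      have "w (int l + int (i - 1)) = 0" "w (int l + int i) = 0" "w (int l + int (i + 1)) = 0"
        using ok False that by (simp_all del: of_nat_add of_nat_diff of_nat_Suc One_nat_def)
      then show ?thesis using nzZ[OF \<open>states \<xi>\<close> \<open>ones \<xi> = v\<close>, of "int l + int i"] that
        by (simp add: h_def of_nat_diff algebra_simps)
    qed
    moreover have "\<forall>i\<in>set (offsets k). 1 \<le> i \<and> i + 1 \<le> width k" using False by (cases k) auto
    ultimately have L: "item_val (nz (piggyback_step \<xi>)) (Item k l c) =
        (\<Sum>i\<leftarrow>offsets k. h (int i - 1) + h (int i) + h (int i + 1))"
      by (simp cong: map_cong)
    have hs: "nz \<xi> (int l) = h 0" "nz \<xi> (int l + j) = h j" "nz \<xi> (j + int l) = h j"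
       "nz \<xi> (int (l - Suc 0) + j) = h (j - 1)" "nz \<xi> (j + int (l - Suc 0)) = h (j - 1)" for j
      using len by (simp_all add: h_def add.commute of_nat_diff algebra_simps)
    show ?thesis
    proof (cases "g 0 = 0 \<and> g 1 = 0")
      case True
      then show ?thesis unfolding L using st False
        by (cases k) (auto simp: gi hs add.commute add.left_commute add.assoc)
    next
      case nonzero: False
      have new: "new = map (\<lambda>i. Item A (i + l) c) (roof k (g 0 = 1) (g 1 = 1))" "\<not> flip"
        using st nonzero False by (auto simp: gi)
      have "(\<Sum>i\<leftarrow>offsets k. h (int i - 1) + h (int i) + h (int i + 1)) =
          (\<Sum>i\<leftarrow>roof k (g 0 = 1) (g 1 = 1). h (int i))"
      proof (rule roof_sum)
        show "h j = 1" if "- 1 \<le> j" "j \<le> int (width k) + 1"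
          "if j mod 3 = 0 then g 0 = 1 else if j mod 3 = 1 then g 1 = 1 else (g 0 = 1) \<noteq> (g 1 = 1)" for j
        proof (rule hv[OF that(1,2)])
          show "pat (j mod 3) = 1" using that(3) by (cases "g 0"; cases "g 1") (auto simp: pat_def split: if_splits)
        qed
      qed (use nonzero False in auto)
      then show ?thesis unfolding L new using new(2) by (simp add: hs comp_def)
    qed
  qed
qed

text \<open>Bits that remain after the last item has disappeared are ignored; this is why a node
  without items is counted with all \<open>4 ^ n\<close> continuations.\<close>

fun resolve :: "(bool \<times> bool) list \<Rightarrow> bool list \<Rightarrow> item list \<Rightarrow> bool list \<Rightarrow> bool list option" where
  "resolve bs w [] s = Some s"
| "resolve [] w (it # its) s = None"
| "resolve ((a, b) # bs) w (it # its) s =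
    (case lift_items (sweep a b (tl w)) (it # its) s of None \<Rightarrow> None
     | Some (its', s') \<Rightarrow> resolve bs (sweep a b (tl w)) its' s')"

section \<open>Rows of period 16 as polynomials in \<open>u = 1 + X\<close>\<close>

definition dl :: "row \<Rightarrow> row" where "dl f x = f x + f (x - 1)"

text \<open>A Horner scheme: \<open>dl\<close> is multiplication by \<open>u\<close>, with
  \<open>X\<close> moving a row one cell to the right, and the constant 1 is the row with ones at
  the multiples of 16.\<close>

fun rowY :: "bool list \<Rightarrow> row" where
  "rowY [] x = 0"
| "rowY (c # cs) x = of_bool (c \<and> 16 dvd x) + dl (rowY cs) x"

lemma dl_add: "dl (\<lambda>x. f x + g x) = (\<lambda>x. dl f x + dl g x)"
  by (simp add: dl_def fun_eq_iff add.commute add.left_commute add.assoc)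

lemma dl_pow_add: "(dl ^^ n) (\<lambda>x. f x + g x) = (\<lambda>x. (dl ^^ n) f x + (dl ^^ n) g x)"
  by (induction n) (simp_all add: dl_add)

lemma dl_zero [simp]: "dl (\<lambda>_. 0) = (\<lambda>_. 0)" by (simp add: dl_def fun_eq_iff)
lemma dl_pow_zero [simp]: "(dl ^^ n) (\<lambda>_. 0) = (\<lambda>_. 0)" by (induction n) simp_all

lemma dl_pow_two_power: "(dl ^^ (2 ^ k)) f x = f x + f (x - 2 ^ k)"
proof (induction k arbitrary: f x)
  case (Suc k)
  have "(dl ^^ (2 ^ Suc k)) f = (dl ^^ (2 ^ k)) ((dl ^^ (2 ^ k)) f)" by (simp add: mult_2 funpow_add)
  then show ?case by (simp add: Suc.IH algebra_simps)
qed (simp add: dl_def)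

lemma rowY_periodic: "rowY c (x + 16) = rowY c x"
proof (induction c arbitrary: x)
  case (Cons a c)
  have "(16::int) dvd x + 16 \<longleftrightarrow> 16 dvd x" by presburger
  then show ?case using Cons[of x] Cons[of "x - 1"] by (simp add: dl_def algebra_simps)
qed simp

text \<open>\<open>(1 + X)^16 = 1 + X^16\<close>, which annihilates period 16.\<close>

lemma dl_16: "(dl ^^ 16) (rowY c) = (\<lambda>_. 0)"
  using dl_pow_two_power[of 4 "rowY c"] rowY_periodic[of c "x - 16" for x] by (simp add: fun_eq_iff)

lemma rowY_Cons: "rowY (c # cs) = (\<lambda>x. of_bool (c \<and> 16 dvd x) + dl (rowY cs) x)" by (simp add: fun_eq_iff)

lemma rowY_append: "rowY (as @ bs) = (\<lambda>x. rowY as x + (dl ^^ length as) (rowY bs) x)"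
proof (induction as)
  case (Cons a as)
  show ?case by (simp add: fun_eq_iff Cons.IH dl_add add.assoc)
qed (simp add: fun_eq_iff)

lemma rowY_replicate_False: "rowY (replicate n False) = (\<lambda>_. 0)"
proof (induction n)
  case (Suc n) then show ?case by (simp add: fun_eq_iff dl_def)
qed (simp add: fun_eq_iff)

lemma xorl_take: "length c \<le> length d \<Longrightarrow> xorl c d = xorl c (take (length c) d)"
  by (induction c d rule: xorl.induct) auto

lemma length_xorl: "length (xorl c d) = min (length c) (length d)"
  by (induction c d rule: xorl.induct) auto

lemma rowY_xorl: "length c = length d \<Longrightarrow> rowY (xorl c d) = (\<lambda>x. rowY c x + rowY d x)"
proof (induction c d rule: xorl.induct)
  case (1 a as b bs)
  then have "dl (rowY (xorl as bs)) = (\<lambda>x. dl (rowY as) x + dl (rowY bs) x)" by (simp add: dl_add)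
  then show ?case by (cases a; cases b; simp add: rowY_Cons add.commute add.left_commute add.assoc)
qed (auto simp: fun_eq_iff)

text \<open>The coefficients that \<open>xorl\<close> cuts off would carry a factor
  \<open>u^(k + n) = u^16\<close>, so the truncated list still represents the product with
  \<open>1 + u^d\<close>.\<close>

lemma rowY_elim_step:
  assumes "length c = n" "k + n = 16"
  shows "(dl ^^ k) (rowY (xorl c (replicate d False @ c))) = (\<lambda>x. (dl ^^ k) (rowY c) x + (dl ^^ (k + d)) (rowY c) x)"
proof -
  let ?p = "replicate d False @ c"
  have "rowY ?p = (\<lambda>x. rowY (take n ?p) x + (dl ^^ length (take n ?p)) (rowY (drop n ?p)) x)"
    by (metis append_take_drop_id rowY_append)
  also have "length (take n ?p) = n" using assms by simp
  finally have "(dl ^^ k) (rowY ?p) = (\<lambda>x. (dl ^^ k) (rowY (take n ?p)) x + (dl ^^ (k + n)) (rowY (drop n ?p)) x)"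
    by (simp add: dl_pow_add funpow_add del: append_take_drop_id take_append drop_append)
  also have "(dl ^^ (k + n)) (rowY (drop n ?p)) = (\<lambda>_. 0)" using assms(2) by (simp add: dl_16)
  finally have "(dl ^^ k) (rowY ?p) = (dl ^^ k) (rowY (take n ?p))" by simp
  moreover have "rowY ?p = (dl ^^ d) (rowY c)" by (simp add: rowY_append rowY_replicate_False)
  moreover have "rowY (xorl c ?p) = (\<lambda>x. rowY c x + rowY (take n ?p) x)"
    using rowY_xorl[of c "take n ?p"] xorl_take[of c ?p] assms(1) by simp
  ultimately show ?thesis by (simp add: dl_pow_add funpow_add)
qed

lemma times_X_rowY: "length c = 16 \<Longrightarrow> rowY (times_X z c) x = rowY c (x - int z) \<and> length (times_X z c) = 16"
proof (induction z arbitrary: c x)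
  case (Suc z)
  have "rowY (xorl c (False # c)) x = rowY c (x - 1)" for x
    using fun_cong[OF rowY_elim_step[of c 16 0 1, OF Suc.prems], of x] by (simp add: dl_def)
  then show ?case using Suc.IH[of "xorl c (False # c)" x] Suc.prems by (simp add: length_xorl algebra_simps)
qed simp

lemma rowY_monomial: "rowY (monomial z) x = of_bool (16 dvd x - int z)" "length (monomial z) = 16"
  using times_X_rowY[of "True # replicate 15 False" z x] rowY_replicate_False[of 15]
  by (simp_all add: monomial_def rowY_Cons)

text \<open>The final row is kept as an affine function of the unknown parities, with codes as
  coefficients. Parities can therefore be exchanged for parities one row earlier while all of them
  are still unknown.\<close>

lemma lift_items_sound:
  assumes lam: "lam v = w" and "\<forall>it\<in>set its. item_ok w it \<and> room (Suc n) it \<and> length (code_of it) = 16"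
    and "length s = 16"
    and "lift_items (row_list v) its s = Some (its', s')"
  shows "(\<forall>it\<in>set its'. item_ok v it \<and> room n it \<and> length (code_of it) = 16) \<and> length s' = 16 \<and>
    (\<forall>\<xi>. states \<xi> \<longrightarrow> ones \<xi> = v \<longrightarrow> (\<forall>z.
      rowY s z + (\<Sum>it\<leftarrow>its. rowY (code_of it) z * item_val (nz (piggyback_step \<xi>)) it) =
      rowY s' z + (\<Sum>it\<leftarrow>its'. rowY (code_of it) z * item_val (nz \<xi>) it)))"
  using assms(2-)
proof (induction its arbitrary: its' s')
  case (Cons it its)
  obtain k l c where it: "it = Item k l c" by (cases it)
  obtain new flip its1 s1 where 1: "lift_item k l c (drop l (row_list v)) = Some (new, flip)"
      "lift_items (row_list v) its s = Some (its1, s1)" "its' = new @ its1" "s' = (if flip then xorl s1 c else s1)"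
    using Cons.prems(3) unfolding it
    by (cases "lift_item k l c (drop l (row_list v))"; cases "lift_items (row_list v) its s") auto
  have ok: "item_ok w (Item k l c)" "room (Suc n) (Item k l c)" and c: "length c = 16"
    using Cons.prems(1) it by auto
  note S = lift_item_sound[OF lam ok 1(1)]
  have IH: "(\<forall>it\<in>set its1. item_ok v it \<and> room n it \<and> length (code_of it) = 16) \<and> length s1 = 16 \<and>
    (\<forall>\<xi>. states \<xi> \<longrightarrow> ones \<xi> = v \<longrightarrow> (\<forall>z.
      rowY s z + (\<Sum>it\<leftarrow>its. rowY (code_of it) z * item_val (nz (piggyback_step \<xi>)) it) =
      rowY s1 z + (\<Sum>it\<leftarrow>its1. rowY (code_of it) z * item_val (nz \<xi>) it)))"
    using Cons.IH[OF _ Cons.prems(2) 1(2)] Cons.prems(1) by simp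
  have "rowY s z + (\<Sum>it\<leftarrow>it # its. rowY (code_of it) z * item_val (nz (piggyback_step \<xi>)) it) =
      rowY s' z + (\<Sum>it\<leftarrow>its'. rowY (code_of it) z * item_val (nz \<xi>) it)"
    if "states \<xi>" "ones \<xi> = v" for \<xi> z
  proof -
    have new: "(\<Sum>it\<leftarrow>new. rowY (code_of it) z * item_val (nz \<xi>) it) = rowY c z * (\<Sum>it\<leftarrow>new. item_val (nz \<xi>) it)"
      using S(1) by (simp add: sum_list_const_mult[symmetric] cong: map_cong)
    have s': "rowY s' z = rowY s1 z + rowY c z * of_bool flip"
      using rowY_xorl[of s1 c] IH c by (simp add: 1(4))
    have "rowY s z + (\<Sum>it\<leftarrow>its. rowY (code_of it) z * item_val (nz (piggyback_step \<xi>)) it) =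
      rowY s1 z + (\<Sum>it\<leftarrow>its1. rowY (code_of it) z * item_val (nz \<xi>) it)" using IH that by blast
    then show ?thesis unfolding 1(3) s' using S(2)[OF that] new by (simp add: it algebra_simps)
  qed
  then show ?case using IH S(1) c 1(3,4) by (auto simp: length_xorl)
qed simp

lemma sweep_rows: "sweep (f (p::int)) (f (p + 1)) (map (\<lambda>i. g (p + 1 + int i)) [0..<n]) = map (\<lambda>i. f (p + int i)) [0..<Suc n]"
  if "\<And>x. p < x \<Longrightarrow> f (x + 1) = (g x \<noteq> (f x \<noteq> f (x - 1)))"
  using that
proof (induction n arbitrary: p)
  case (Suc n)
  have e: "map (\<lambda>i. h (q + int i)) [0..<Suc m] = h q # map (\<lambda>i. h (q + 1 + int i)) [0..<m]" for h :: "int \<Rightarrow> bool" and q m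
    by (simp add: upt_conv_Cons map_Suc_upt[symmetric] algebra_simps del: upt_Suc)
  have "sweep (f (p + 1)) (f (p + 1 + 1)) (map (\<lambda>i. g (p + 1 + 1 + int i)) [0..<n]) = map (\<lambda>i. f (p + 1 + int i)) [0..<Suc n]"
    using Suc.IH[of "p + 1"] Suc.prems by simp
  moreover have "(g (p + 1) \<noteq> (f p \<noteq> f (p + 1))) = f (p + 1 + 1)" using Suc.prems[of "p + 1"] by auto
  ultimately show ?case unfolding e[of g] e[of f p] by (simp del: upt_Suc)
qed simp

lemma sweep_row_list:
  assumes "lam v = w"
  shows "sweep (v 0 = 1) (v 1 = 1) (tl (row_list w)) = row_list v"
proof -
  have "tl (row_list w) = map (\<lambda>i. w (0 + 1 + int i) = 1) [0..<78]"
    by (simp add: row_list_def upt_conv_Cons map_Suc_upt[symmetric] map_tl[symmetric] del: upt_Suc)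
  moreover have "(v (x + 1) = 1) = ((w x = 1) \<noteq> ((v x = 1) \<noteq> (v (x - 1) = 1)))" for x
    using fun_cong[OF assms, of x] by (cases "v x"; cases "v (x - 1)"; cases "v (x + 1)"; cases "w x"; simp add: lam_def)
  ultimately show ?thesis using sweep_rows[of 0 "\<lambda>x. v x = 1" "\<lambda>x. w x = 1" 78]
    by (simp add: row_list_def del: upt_Suc)
qed

text \<open>As \<open>r\<close> is computed from the rows \<open>W\<close> alone, the right-hand
  side is the same for all \<open>\<xi>\<close> with these ones: the history has been forgotten. The
  items live in row \<open>W m\<close>, \<open>\<xi>\<close> lives \<open>n\<close> rows
  earlier.\<close>

lemma resolve_sound:
  assumes rows: "\<And>j. lam (W (Suc j)) = W j"
    and its: "\<forall>it\<in>set its. item_ok (W m) it \<and> room n it \<and> length (code_of it) = 16" and "length s = 16"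
    and "resolve (map (\<lambda>j. (W (Suc j) 0 = 1, W (Suc j) 1 = 1)) [m..<m + n]) (row_list (W m)) its s = Some r"
    and "states \<xi>" "ones \<xi> = W (m + n)"
  shows "rowY r z = rowY s z + (\<Sum>it\<leftarrow>its. rowY (code_of it) z * item_val (nz ((piggyback_step ^^ n) \<xi>)) it)"
  using its assms(3-)
proof (induction n arbitrary: m its s)
  case 0
  then show ?case by (cases its) auto
next
  case (Suc n)
  show ?case
  proof (cases its)
    case (Cons it its0)
    have upt: "[m..<m + Suc n] = m # [Suc m..<Suc m + n]" by (simp add: upt_conv_Cons del: upt_Suc)
    obtain its' s' where l: "lift_items (row_list (W (Suc m))) its s = Some (its', s')"
      and r: "resolve (map (\<lambda>j. (W (Suc j) 0 = 1, W (Suc j) 1 = 1)) [Suc m..<Suc m + n]) (row_list (W (Suc m))) its' s' = Some r"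
      using Suc.prems(3) unfolding Cons upt by (simp add: sweep_row_list[OF rows] split: option.splits prod.splits del: upt_Suc lift_items.simps)
    let ?\<xi> = "(piggyback_step ^^ n) \<xi>"
    have "ones ?\<xi> = (lam ^^ n) (W (Suc m + n))" using piggyback_pow_ones[OF Suc.prems(4)] Suc.prems(5) by simp
    also have "\<dots> = W (Suc m)" by (induction n) (use rows in \<open>simp_all add: funpow_swap1\<close>)
    finally have o: "ones ?\<xi> = W (Suc m)" .
    note L = lift_items_sound[OF rows Suc.prems(1,2) l]
    have "rowY r z = rowY s' z + (\<Sum>it\<leftarrow>its'. rowY (code_of it) z * item_val (nz ?\<xi>) it)"
      by (rule Suc.IH) (use L r Suc.prems(4,5) in auto)
    then show ?thesis using L o piggyback_pow_ones(1)[OF Suc.prems(4)] by simp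
  qed (use Suc.prems in simp)
qed

section \<open>The row that fills a resolved void\<close>

lemma piggyback_step_shift: "piggyback_step (\<lambda>x. \<xi> (x + a)) = (\<lambda>x. piggyback_step \<xi> (x + a))"
  by (simp add: piggyback_step_def fun_eq_iff algebra_simps)

lemma piggyback_pow_shift: "(piggyback_step ^^ n) (\<lambda>x. \<xi> (x + a)) = (\<lambda>x. (piggyback_step ^^ n) \<xi> (x + a))"
  by (induction n) (simp_all add: piggyback_step_shift)

lemma void_step:
  assumes "states \<xi>" "ones \<xi> = (\<lambda>_. 0)"
  shows "ones (piggyback_step \<xi>) = (\<lambda>_. 0)" "nz (piggyback_step \<xi>) = lam (nz \<xi>)"
proof -
  show o: "ones (piggyback_step \<xi>) = (\<lambda>_. 0)" using piggyback_step_ones(1)[OF assms(1)] assms(2) by simp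
  show "nz (piggyback_step \<xi>) = lam (nz \<xi>)"
    using piggyback_step_nz(2)[OF assms(1)] by (simp add: o fun_eq_iff)
qed

lemma void_pow:
  assumes "states \<xi>" "ones \<xi> = (\<lambda>_. 0)"
  shows "ones ((piggyback_step ^^ n) \<xi>) = (\<lambda>_. 0)" "nz ((piggyback_step ^^ n) \<xi>) = (lam ^^ n) (nz \<xi>)"
  using assms(2) by (induction n) (simp_all add: void_step piggyback_pow_ones(1)[OF assms(1)])

lemma root_items_eq: "root_items = map (\<lambda>q. Item A (3 * q + 17) (monomial (3 * q + 17))) [0..<16]"
  by (simp add: root_items_def upt_conv_Cons)

text \<open>The 32 steps are 15 from \<open>W 16\<close> to the row 110110..., one to the opening,
  and 16 within the void, which turn period 48 into period 16.\<close>

theorem resolved_void: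
  assumes rows: "\<And>j. lam (W (Suc j)) = W j" and W0: "W 0 = (\<lambda>_. 0)"
    and W1: "\<And>x. W 1 x = of_bool (x mod 3 \<noteq> 2)"
    and res: "resolve (map (\<lambda>j. (W (Suc j) 0 = 1, W (Suc j) 1 = 1)) [1..<16]) root_row root_items (replicate 16 False) = Some r"
    and \<xi>: "states \<xi>" "ones \<xi> = W 16"
  shows "states ((piggyback_step ^^ 32) \<xi>) \<and> ones ((piggyback_step ^^ 32) \<xi>) = (\<lambda>_. 0) \<and>
    nz ((piggyback_step ^^ 32) \<xi>) = lam (rowY r)"
proof -
  have root_row: "row_list (W 1) = root_row"
    unfolding row_list_def root_row_def
  proof (rule map_cong)
    fix i :: nat
    have "int i mod 3 = int (i mod 3)" by (simp add: zmod_int)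
    then show "(W 1 (int i) = 1) = (i mod 3 \<noteq> 2)" unfolding W1 by simp
  qed simp
  have its: "\<forall>it\<in>set root_items. item_ok (W 1) it \<and> room 15 it \<and> length (code_of it) = 16"
  proof -
    have "item_ok (W 1) (Item A (3 * q + 17) c)" for q c
    proof -
      have "(int (3 * q + 17) - 1) mod 3 \<noteq> 2" "int (3 * q + 17) mod 3 = 2" "(int (3 * q + 17) + 1) mod 3 \<noteq> 2" by presburger+
      then show ?thesis unfolding item_ok.simps W1 by simp
    qed
    then show ?thesis unfolding root_items_eq by (auto simp: rowY_monomial simp del: item_ok.simps)
  qed
  \<comment> \<open>General in \<open>\<zeta>\<close>, since it is applied below to translates of
    \<open>\<xi>\<close> by multiples of 48. These have the same ones, but possibly other
    2s.\<close>
  have win: "nz ((piggyback_step ^^ 15) \<zeta>) (int (3 * q + 17)) = rowY r (int (3 * q + 17))"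
    if "states \<zeta>" "ones \<zeta> = W 16" "q < 16" for \<zeta> q
  proof -
    let ?f = "nz ((piggyback_step ^^ 15) \<zeta>)" and ?z = "int (3 * q + 17)"
    have "rowY r ?z = rowY (replicate 16 False) ?z + (\<Sum>it\<leftarrow>root_items. rowY (code_of it) ?z * item_val ?f it)"
      by (rule resolve_sound[OF rows its]) (use res that root_row in auto)
    also have "\<dots> = (\<Sum>p\<leftarrow>[0..<16]. of_bool (16 dvd ?z - int (3 * p + 17)) * ?f (int (3 * p + 17)))"
      by (simp add: root_items_eq rowY_replicate_False rowY_monomial comp_def)
    also have "\<dots> = (\<Sum>p\<in>{0..<16}. of_bool (16 dvd ?z - int (3 * p + 17)) * ?f (int (3 * p + 17)))"
      by (simp add: interv_sum_list_conv_sum_set_nat)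
    also have "\<dots> = (\<Sum>p\<in>{q}. ?f (int (3 * p + 17)))"
    proof (intro sum.mono_neutral_cong_right)
      show "\<forall>p\<in>{0..<16} - {q}. of_bool (16 dvd ?z - int (3 * p + 17)) * ?f (int (3 * p + 17)) = 0"
      proof
        fix p assume p: "p \<in> {0..<16} - {q}"
        define d where "d = int q - int p"
        have d: "?z - int (3 * p + 17) = 3 * d" "d \<noteq> 0" "\<bar>d\<bar> < 16" using p that(3) by (auto simp: d_def)
        have "\<not> 16 dvd 3 * d"
        proof
          assume "16 dvd 3 * d"
          \<comment> \<open>11 is the inverse of 3 modulo 16, and 33 d - 32 d = d.\<close>
          then have "16 dvd 11 * (3 * d) - 16 * (2 * d)" by (rule dvd_diff[OF dvd_mult dvd_triv_left])
          then have "16 dvd d" by simp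
          from dvd_imp_le_int[OF d(2) this] show False using d(3) by simp
        qed
        then have "\<not> 16 dvd ?z - int (3 * p + 17)" unfolding d(1) .
        then show "of_bool (16 dvd ?z - int (3 * p + 17)) * ?f (int (3 * p + 17)) = 0" by simp
      qed
    qed (use that(3) in auto)
    finally show ?thesis by simp
  qed
  \<comment> \<open>Sixteen steps lead from \<open>W 16\<close> to zero, so any three cells at
    mutual distance 16 add up to zero; this recursion has period 3 in steps of 16.\<close>
  have period: "W 16 (x + 48) = W 16 x" for x
  proof -
    have "(lam ^^ n) (W n) = (\<lambda>_. 0)" for n by (induction n) (simp_all add: rows W0 funpow_swap1)
    then have "W 16 (y - 16) + W 16 y + W 16 (y + 16) = 0" for y
      using lam_pow_two_power[of 4 "W 16" y] by simp
    from this[of "x + 16"] this[of "x + 32"] show ?thesis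
      by (cases "W 16 x"; cases "W 16 (x + 16)"; cases "W 16 (x + 32)"; cases "W 16 (x + 48)"; simp add: algebra_simps)
  qed
  have period': "W 16 (x + 48 * int k) = W 16 x" "W 16 (x - 48 * int k) = W 16 x" for x k
  proof -
    show P: "W 16 (x + 48 * int k) = W 16 x" for x by (induction k) (use period[of "x + 48 * int k" for k] in \<open>simp_all add: algebra_simps\<close>)
    show "W 16 (x - 48 * int k) = W 16 x" using P[of "x - 48 * int k"] by simp
  qed
  have period'': "W 16 (x + 48 * k) = W 16 x" for x and k :: int
    using period'[of x "nat \<bar>k\<bar>"] by (cases "k \<ge> 0") auto
  let ?\<xi>1 = "(piggyback_step ^^ 15) \<xi>"
  have at2: "nz ?\<xi>1 x = rowY r x" if "x mod 3 = 2" for x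
  proof -
    define k where "k = (x - 17) div 48"
    define q where "q = nat (((x - 17) mod 48) div 3)"
    have "int q = ((x - 17) mod 48) div 3" unfolding q_def by simp
    moreover have "((x - 17) mod 48) div 3 * 3 = (x - 17) mod 48"
    proof -
      have "3 dvd x - 17" using that by presburger
      then have "3 dvd (x - 17) mod 48" by (intro dvd_mod) simp_all
      then show ?thesis by (rule dvd_div_mult_self)
    qed
    moreover have "(x - 17) mod 48 < 48" by simp
    moreover have "x = (x - 17) mod 48 + 17 + 48 * k" unfolding k_def by presburger
    ultimately have q: "q < 16" "x = int (3 * q + 17) + 48 * k" by linarith+
    have "nz ((piggyback_step ^^ 15) (\<lambda>x. \<xi> (x + 48 * k))) (int (3 * q + 17)) = rowY r (int (3 * q + 17))"
      using \<xi> by (intro win q) (auto simp: states_def ones_def fun_eq_iff period'')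
    then have "nz ?\<xi>1 x = rowY r (int (3 * q + 17))" by (simp add: piggyback_pow_shift nz_def q(2))
    also have "\<dots> = rowY r x"
    proof -
      have P: "rowY r (y + 16 * int m) = rowY r y" for y m
        by (induction m) (use rowY_periodic[of r "y + 16 * int m" for m] in \<open>simp_all add: algebra_simps\<close>)
      show ?thesis using P[of "int (3 * q + 17)" "nat (3 * k)"] P[of x "nat (- 3 * k)"] q(2) by (cases "k \<ge> 0") (simp_all add: algebra_simps)
    qed
    finally show ?thesis .
  qed
  have st1: "states ?\<xi>1" "ones ?\<xi>1 = W 1"
  proof -
    show "states ?\<xi>1" by (rule piggyback_pow_ones[OF \<xi>(1)])
    have "(lam ^^ n) (W (Suc n)) = W 1" for n by (induction n) (simp_all add: rows funpow_swap1)
    from this[of 15] show "ones ?\<xi>1 = W 1" using piggyback_pow_ones(2)[OF \<xi>(1), of 15] \<xi>(2) by simp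
  qed
  have nz1: "nz ?\<xi>1 x = (if x mod 3 = 2 then rowY r x else 1)" for x
  proof (cases "x mod 3 = 2")
    case False
    have "ones ?\<xi>1 x = 1" using fun_cong[OF st1(2), of x] W1[of x] False by simp
    then have "?\<xi>1 x = 1" by (simp add: ones_def)
    then show ?thesis using False by (simp add: nz_def)
  qed (simp add: at2)
  let ?\<xi>0 = "piggyback_step ?\<xi>1"
  have o0: "ones ?\<xi>0 = (\<lambda>_. 0)" using piggyback_step_ones(1)[OF st1(1)] st1(2) rows[of 0] W0 by simp
  have s0: "states ?\<xi>0" by (rule piggyback_step_ones(2)[OF st1(1)])
  \<comment> \<open>Each cell sees exactly one gap and two ones, which cancel. So every gap value is
    copied to itself and its two neighbours.\<close>
  have nz0: "nz ?\<xi>0 x = (if x mod 3 = 0 then rowY r (x - 1) else if x mod 3 = 1 then rowY r (x + 1) else rowY r x)" for x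
  proof -
    have "nz ?\<xi>0 x = nz ?\<xi>1 (x - 1) + nz ?\<xi>1 x + nz ?\<xi>1 (x + 1)"
      using piggyback_step_nz(2)[OF st1(1), of x] by (simp add: o0 lam_def)
    moreover have "x mod 3 = 0 \<or> x mod 3 = 1 \<or> x mod 3 = 2" by presburger
    moreover have "(x - 1) mod 3 = (x mod 3 + 2) mod 3" "(x + 1) mod 3 = (x mod 3 + 1) mod 3" by presburger+
    ultimately show ?thesis by (elim disjE) (simp_all add: nz1 add.commute add.left_commute)
  qed
  \<comment> \<open>The cells at \<open>x - 16\<close>, \<open>x\<close> and \<open>x + 16\<close>
    lie in three different classes modulo 3, and by the period 16 of \<open>rowY r\<close> they
    contribute its values at \<open>x - 1\<close>, \<open>x\<close> and \<open>x + 1\<close> in some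
    order.\<close>
  have "nz ((piggyback_step ^^ 16) ?\<xi>0) x = lam (rowY r) x" for x
  proof -
    have "nz ((piggyback_step ^^ 16) ?\<xi>0) x = nz ?\<xi>0 (x - 16) + nz ?\<xi>0 x + nz ?\<xi>0 (x + 16)"
      using void_pow(2)[OF s0 o0, of 16] lam_pow_two_power[of 4 "nz ?\<xi>0" x] by simp
    moreover have "x mod 3 = 0 \<or> x mod 3 = 1 \<or> x mod 3 = 2" by presburger
    moreover have "(x - 16) mod 3 = (x mod 3 + 2) mod 3" "(x + 16) mod 3 = (x mod 3 + 1) mod 3" by presburger+
    moreover have "rowY r (y - 16) = rowY r y" "rowY r (y + 16) = rowY r y" for y
      using rowY_periodic[of r y] rowY_periodic[of r "y - 16"] by simp_all
    from this(1)[of "x - 1"] this(1)[of "x + 1"] this(1)[of x] this(2)[of "x - 1"] this(2)[of "x + 1"] this(2)[of x]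
    have "rowY r (x - 17) = rowY r (x - 1)" "rowY r (x - 15) = rowY r (x + 1)" "rowY r (x - 16) = rowY r x"
        "rowY r (x + 15) = rowY r (x - 1)" "rowY r (x + 17) = rowY r (x + 1)" "rowY r (x + 16) = rowY r x" by (simp_all add: algebra_simps)
    ultimately show ?thesis by (elim disjE) (simp_all add: nz0 lam_def add.commute add.left_commute)
  qed
  moreover have "(piggyback_step ^^ 32) \<xi> = (piggyback_step ^^ 16) ?\<xi>0"
    by (simp add: funpow_add[symmetric, THEN fun_cong, unfolded o_apply] flip: funpow.simps(2)[THEN fun_cong, unfolded o_apply])
  ultimately show ?thesis using void_pow(1)[OF s0 o0] piggyback_pow_ones(1)[OF s0] by auto
qed

section \<open>Counting resolved boundary data\<close>

definition admissible :: "bool list \<Rightarrow> (bool \<times> bool) list set" where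
  "admissible fs = {bs. list_all2 (\<lambda>f b. f \<longrightarrow> \<not> fst b) fs bs}"

definition choices :: "bool \<Rightarrow> (bool \<times> bool) set" where
  "choices f = {b. f \<longrightarrow> \<not> fst b}"

definition resolved :: "bool list \<Rightarrow> item list \<Rightarrow> bool list \<Rightarrow> nat \<Rightarrow> (bool \<times> bool) list set" where
  "resolved w its s k = {bs. \<exists>r. resolve bs w its s = Some r \<and> ether_class r = k}"

definition num :: "bool list \<Rightarrow> bool list \<Rightarrow> item list \<Rightarrow> bool list \<Rightarrow> nat \<Rightarrow> nat" where
  "num fs w its s k = card (admissible fs \<inter> resolved w its s k)"

definition num_opt :: "bool list \<Rightarrow> bool list \<Rightarrow> (item list \<times> bool list) option \<Rightarrow> nat \<Rightarrow> nat" where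
  "num_opt fs v r k = (case r of None \<Rightarrow> 0 | Some (its, s) \<Rightarrow> num fs v its s k)"

lemma admissible_Nil: "admissible [] = {[]}"
  by (auto simp: admissible_def)

lemma admissible_Cons: "admissible (f # fs) = (\<Union>b\<in>choices f. (#) b ` admissible fs)"
  by (fastforce simp: admissible_def choices_def list_all2_Cons1)

lemma finite_admissible [simp]: "finite (admissible fs)"
  by (induction fs) (simp_all add: admissible_Nil admissible_Cons)

lemma card_admissible: "card (admissible (replicate n False)) = 4 ^ n"
proof (induction n)
  case (Suc n)
  have "choices False = UNIV" by (simp add: choices_def)
  then have "card (admissible (replicate (Suc n) False)) = (\<Sum>b\<in>(UNIV :: (bool \<times> bool) set). card ((#) b ` admissible (replicate n False)))"
    by (simp add: admissible_Cons) (subst card_UN_disjoint; auto)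
  then show ?case using Suc by (simp add: card_image card_UNIV_bool card_prod UNIV_Times_UNIV[symmetric] del: UNIV_Times_UNIV)
qed (simp add: admissible_Nil)

lemma resolve_Cons:
  "resolve ((a, b) # bs) w its s =
    (case lift_items (sweep a b (tl w)) its s of None \<Rightarrow> None
     | Some (its', s') \<Rightarrow> resolve bs (sweep a b (tl w)) its' s')"
  by (cases its) simp_all

lemma num_Cons:
  "num (f # fs) w its s k = (\<Sum>(a, b)\<in>choices f. num_opt fs (sweep a b (tl w)) (lift_items (sweep a b (tl w)) its s) k)"
proof -
  let ?v = "\<lambda>(a, b). sweep a b (tl w)"
  let ?S = "\<lambda>b. admissible fs \<inter> (case lift_items (?v b) its s of None \<Rightarrow> {} | Some (its', s') \<Rightarrow> resolved (?v b) its' s' k)"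
  have "admissible (f # fs) \<inter> resolved w its s k = (\<Union>b\<in>choices f. (#) b ` ?S b)"
    by (auto simp: admissible_Cons resolved_def resolve_Cons image_iff split: option.splits prod.splits)
  moreover have "finite (choices f)" by simp
  ultimately have "num (f # fs) w its s k = (\<Sum>b\<in>choices f. card ((#) b ` ?S b))"
    unfolding num_def by (simp add: card_UN_disjoint)  (subst card_UN_disjoint; auto)
  also have "\<dots> = (\<Sum>b\<in>choices f. card (?S b))" by (simp add: card_image)
  also have "\<dots> = (\<Sum>(a, b)\<in>choices f. num_opt fs (sweep a b (tl w)) (lift_items (sweep a b (tl w)) its s) k)"
    by (rule sum.cong) (auto simp: num_opt_def num_def split: option.splits prod.splits)
  finally show ?thesis .
qed

lemma num_Nil_items: "num fs w [] s k = (if ether_class s = k then card (admissible fs) else 0)"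
  by (auto simp: num_def resolved_def)

lemma length_sweep: "length (sweep a b cs) = Suc (length cs)"
  by (induction cs arbitrary: a b) auto

lemma sum_choices_False: "(\<Sum>b\<in>choices False. h b) = h (True, True) + h (True, False) + h (False, True) + h (False, False)" for h :: "_ \<Rightarrow> nat"
proof -
  have "choices False = {(True, True), (True, False), (False, True), (False, False)}" by (auto simp: choices_def)
  then show ?thesis by simp
qed

lemma sum_choices_True: "(\<Sum>b\<in>choices True. h b) = h (False, True) + h (False, False)" for h :: "_ \<Rightarrow> nat"
proof -
  have "choices True = {(False, True), (False, False)}" by (auto simp: choices_def)
  then show ?thesis by simp
qed

text \<open>Moving one cell to the right permutes the four values of a pair of adjacent cells. So
  the pair at \<open>l\<close> is as uniform as the one at 0, and the count for a single item does
  not depend on its position.\<close>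

lemma sum_sweep:
  assumes "Suc l \<le> length cs"
  shows "(\<Sum>(a, b)\<in>choices False. h (sweep a b cs ! l) (sweep a b cs ! Suc l)) = (\<Sum>(a, b)\<in>choices False. h a b :: nat)"
  using assms
proof (induction cs arbitrary: l)
  case (Cons c cs)
  have e: "sweep a b (c # cs) ! Suc j = sweep b (c \<noteq> (a \<noteq> b)) cs ! j" for a b j by simp
  show ?case
  proof (cases l)
    case 0
    have "sweep b d cs ! 0 = b" for b d by (cases cs) auto
    then show ?thesis unfolding 0 by (simp add: sum_choices_False del: One_nat_def)
  next
    case (Suc j)
    have "(\<Sum>(a, b)\<in>choices False. h (sweep a b (c # cs) ! l) (sweep a b (c # cs) ! Suc l)) =
       (\<Sum>(a, b)\<in>choices False. h (sweep b (c \<noteq> (a \<noteq> b)) cs ! j) (sweep b (c \<noteq> (a \<noteq> b)) cs ! Suc j))"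
      unfolding Suc e ..
    also have "\<dots> = (\<Sum>(a, b)\<in>choices False. h (sweep a b cs ! j) (sweep a b cs ! Suc j))"
      by (cases c) (simp_all add: sum_choices_False)
    finally show ?thesis using Cons.IH[of j] Cons.prems Suc by simp
  qed
qed simp

definition ind :: "bool list \<Rightarrow> nat \<Rightarrow> nat" where "ind s k = (if ether_class s = k then 1 else 0)"

lemma xorl_cancel: "length s = length c \<Longrightarrow> xorl (xorl s c) c = s"
  by (induction s c rule: xorl.induct) auto

definition law_bound :: "kind \<Rightarrow> nat \<Rightarrow> bool list \<Rightarrow> bool list \<Rightarrow> nat \<Rightarrow> nat" where
  "law_bound k n s c \<kappa> = ind s \<kappa> * fst (law k n) + ind (xorl s c) \<kappa> * snd (law k n)"

lemma lift_single:
  "Suc l < length v \<Longrightarrow> lift_items v [Item k l c] s =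
    (case lift_item k l c [v ! l, v ! Suc l] of None \<Rightarrow> None | Some (new, flip) \<Rightarrow> Some (new, if flip then xorl s c else s))"
proof -
  assume "Suc l < length v"
  then have "drop l v = v ! l # v ! Suc l # drop (Suc (Suc l)) v" by (simp add: Cons_nth_drop_Suc)
  then have "lift_item k l c (drop l v) = lift_item k l c [v ! l, v ! Suc l]" by simp
  then show ?thesis by (auto split: option.splits)
qed

lemma num_single:
  assumes "length w = 79" "Suc l < 79"
    and "\<And>v a b. length v = 79 \<Longrightarrow> h a b \<le> num_opt (replicate n False) v
      (case lift_item k l c [a, b] of None \<Rightarrow> None | Some (new, flip) \<Rightarrow> Some (new, if flip then xorl s c else s)) \<kappa>"
  shows "h True True + h True False + h False True + h False False \<le> num (replicate (Suc n) False) w [Item k l c] s \<kappa>"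
proof -
  have len: "length (sweep a b (tl w)) = 79" for a b using assms(1) by (simp add: length_sweep)
  have le: "h (v ! l) (v ! Suc l) \<le> num_opt (replicate n False) v (lift_items v [Item k l c] s) \<kappa>" if "length v = 79" for v
    using assms(3)[OF that, of "v ! l" "v ! Suc l"] assms(2) that
    by (simp add: lift_single del: lift_items.simps lift_item.simps)
  have "h True True + h True False + h False True + h False False = (\<Sum>(a, b)\<in>choices False. h a b)"
    by (simp add: sum_choices_False)
  also have "\<dots> = (\<Sum>(a, b)\<in>choices False. h (sweep a b (tl w) ! l) (sweep a b (tl w) ! Suc l))"
    using assms(1,2) by (intro sum_sweep[symmetric]) simp
  also have "\<dots> \<le> (\<Sum>(a, b)\<in>choices False. num_opt (replicate n False) (sweep a b (tl w)) (lift_items (sweep a b (tl w)) [Item k l c] s) \<kappa>)"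
    using le[OF len] by (intro sum_mono) (auto simp del: lift_items.simps)
  also have "\<dots> = num (replicate (Suc n) False) w [Item k l c] s \<kappa>" by (simp add: num_Cons del: lift_items.simps)
  finally show ?thesis .
qed

text \<open>An inequality, because \<open>law\<close> drops the strings in which a run of kind
  \<open>R2\<close> or \<open>R4\<close> widens once more.\<close>

lemma law_count:
  assumes "length w = 79" "length s = 16" "length c = 16" "room n (Item k l c)" "k \<in> {A, R1, R2, R4}"
  shows "law_bound k n s c \<kappa> \<le> num (replicate n False) w [Item k l c] s \<kappa>"
  using assms
proof (induction n arbitrary: w s k l)
  case 0
  then show ?case by (auto simp: law_bound_def)
next
  case (Suc n)
  \<comment> \<open>The contributions of the four pairs of cells at \<open>l\<close> and
    \<open>l + 1\<close>, each of which occurs exactly once by \<open>sum_sweep\<close>.\<close>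
  let ?g = "\<lambda>a b. case (k, a, b) of
      (A, True, _) \<Rightarrow> ind s \<kappa> * 4 ^ n
    | (A, False, True) \<Rightarrow> law_bound A n (xorl s c) c \<kappa>
    | (A, False, False) \<Rightarrow> law_bound R1 n (xorl s c) c \<kappa>
    | (R1, False, False) \<Rightarrow> law_bound R2 n s c \<kappa>
    | (R2, False, False) \<Rightarrow> 0
    | (R4, False, False) \<Rightarrow> 0
    | _ \<Rightarrow> law_bound A n s c \<kappa>"
  have l: "Suc l < 79" "1 \<le> l" using Suc.prems(4) by (cases k; simp)+
  have x: "length (xorl s c) = 16" using Suc.prems by (simp add: length_xorl)
  have g: "?g a b \<le> num_opt (replicate n False) v
      (case lift_item k l c [a, b] of None \<Rightarrow> None | Some (new, flip) \<Rightarrow> Some (new, if flip then xorl s c else s)) \<kappa>"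
    if v: "length v = 79" for v a b
    using Suc.prems(5) Suc.prems(4) l
    by (cases k; cases a; cases b;
      auto simp: num_opt_def num_Nil_items card_admissible ind_def
        intro!: Suc.IH[OF v Suc.prems(2,3)] Suc.IH[OF v x Suc.prems(3)])
  have "?g True True + ?g True False + ?g False True + ?g False False \<le> num (replicate (Suc n) False) w [Item k l c] s \<kappa>"
    by (rule num_single[OF Suc.prems(1) l(1), where h = ?g]) (rule g)
  moreover have "law_bound k (Suc n) s c \<kappa> = ?g True True + ?g True False + ?g False True + ?g False False"
    using Suc.prems by (auto simp: law_bound_def xorl_cancel algebra_simps; cases n; simp)
  ultimately show ?case by simp
qed

lemma bump: "length (bump k x ys) = length ys \<and> (i < length ys \<longrightarrow> bump k x ys ! i = ys ! i + (if i = k then x else 0))"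
  by (induction k x ys arbitrary: i rule: bump.induct) (auto simp: nth_Cons split: nat.split)

definition node_ok :: "nat \<Rightarrow> bool list \<Rightarrow> item list \<Rightarrow> bool list \<Rightarrow> bool" where
  "node_ok n w its s \<longleftrightarrow> length w = 79 \<and> length s = 16 \<and> (\<forall>it\<in>set its. room n it \<and> length (code_of it) = 16)"

text \<open>An upper bound on what the counter adds is the right notion: it makes the computed
  entries lower bounds for the true numbers.\<close>

definition counts :: "bool list \<Rightarrow> counter \<Rightarrow> bool" where
  "counts fs f \<longleftrightarrow> (\<forall>w its s acc k. node_ok (length fs) w its s \<longrightarrow> length (f w its s acc) = length acc \<and>
     (k < length acc \<longrightarrow> f w its s acc ! k \<le> acc ! k + num fs w its s k))"

lemma close_counts:
  assumes "node_ok n w its s" "closed its"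
  shows "length (close n its s acc) = length acc \<and> (k < length acc \<longrightarrow> close n its s acc ! k \<le> acc ! k + num (replicate n False) w its s k)"
proof (cases its)
  case Nil
  then show ?thesis by (simp add: bump num_Nil_items card_admissible)
next
  case (Cons it its')
  then obtain \<kappa> l c where it: "its = [Item \<kappa> l c]" "\<kappa> \<in> {A, R1, R2, R4}"
    using assms(2) by (cases its rule: closed.cases) auto
  have "law_bound \<kappa> n s c k \<le> num (replicate n False) w its s k"
    unfolding it(1) using assms(1) it by (intro law_count) (auto simp: node_ok_def)
  then show ?thesis by (auto simp: it(1) bump law_bound_def ind_def)
qed

lemma room_lift:
  assumes "room (Suc n) (Item k l c)" "lift_item k l c bs = Some (new, flip)"
  shows "\<forall>it\<in>set new. room n it \<and> code_of it = c"
proof -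
  obtain a b bs' where "bs = a # b # bs'" using assms(2) by (cases "(k, l, c, bs)" rule: lift_item.cases) auto
  then show ?thesis using assms by (cases k; cases a; cases b) auto
qed

lemma node_ok_lift:
  assumes "node_ok (Suc n) w its s" "length v = 79" "lift_items v its s = Some (its', s')"
  shows "node_ok n v its' s'"
proof -
  have "(\<forall>it\<in>set its'. room n it \<and> length (code_of it) = 16) \<and> length s' = 16"
    if "\<forall>it\<in>set its. room (Suc n) it \<and> length (code_of it) = 16" "length s = 16" "lift_items v its s = Some (its', s')"
    using that
  proof (induction its arbitrary: its' s')
    case (Cons it its)
    obtain k l c where it: "it = Item k l c" by (cases it)
    obtain new flip its1 s1 where 1: "lift_item k l c (drop l v) = Some (new, flip)"
      "lift_items v its s = Some (its1, s1)" "its' = new @ its1" "s' = (if flip then xorl s1 c else s1)"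
      using Cons.prems(3) unfolding it
      by (cases "lift_item k l c (drop l v)"; cases "lift_items v its s") auto
    show ?case using Cons.IH[OF _ Cons.prems(2) 1(2)] Cons.prems(1) room_lift[OF _ 1(1), of n] 1(3,4)
      by (auto simp: it length_xorl)
  qed auto
  then show ?thesis using assms by (simp add: node_ok_def)
qed

lemma visit_counts:
  fixes a b :: bool
  assumes "counts fs f" "node_ok (Suc (length fs)) w its s"
  defines "v \<equiv> sweep a b (tl w)"
  shows "length (visit f a b w its s acc) = length acc \<and>
    (k < length acc \<longrightarrow> visit f a b w its s acc ! k \<le> acc ! k + num_opt fs v (lift_items v its s) k)"
proof (cases "lift_items v its s")
  case None
  then show ?thesis by (simp add: visit_def visit_opt_def v_def)
next
  case (Some r)
  obtain its' s' where r: "r = (its', s')" by (cases r)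
  have "length v = 79" using assms(2) by (simp add: v_def length_sweep node_ok_def)
  then have "node_ok (length fs) v its' s'" using node_ok_lift[OF assms(2)] Some r by simp
  then show ?thesis using assms(1) Some r unfolding counts_def
    by (simp add: visit_def visit_opt_def v_def num_opt_def)
qed

lemma branch_counts:
  assumes "counts fs f"
  shows "counts (r # fs) (branch r f)"
  unfolding counts_def
proof (intro allI impI)
  fix w its s k and acc :: "nat list" assume ok: "node_ok (length (r # fs)) w its s"
  define acc1 where "acc1 = visit f False False w its s acc"
  define acc2 where "acc2 = visit f False True w its s acc1"
  define acc3 where "acc3 = visit f True False w its s acc2"
  note V = visit_counts[OF assms, of w its s]
  have ok': "node_ok (Suc (length fs)) w its s" using ok by simp
  note 1 = V[OF ok', of False False acc k, folded acc1_def]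
  note 2 = V[OF ok', of False True acc1 k, folded acc2_def]
  note 3 = V[OF ok', of True False acc2 k, folded acc3_def]
  note 4 = V[OF ok', of True True acc3 k]
  show "length (branch r f w its s acc) = length acc \<and>
    (k < length acc \<longrightarrow> branch r f w its s acc ! k \<le> acc ! k + num (r # fs) w its s k)"
    using 1 2 3 4
    by (cases r) (auto simp: branch_def Let_def acc1_def[symmetric] acc2_def[symmetric] acc3_def[symmetric]
        num_Cons sum_choices_False sum_choices_True)
qed

lemma dfs_counts: "counts (replicate n False) (dfs n)"
proof (induction n)
  case 0
  then show ?case using close_counts[of 0] by (auto simp: counts_def)
next
  case (Suc n)
  show ?case
    using branch_counts[OF Suc, of False] close_counts[of "Suc n"] unfolding counts_def
    by (auto simp del: close.simps)
qed

lemma count_top_counts: "counts (fs @ replicate 7 False) (count_top fs)"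
proof (induction fs)
  case Nil
  show ?case using dfs_counts[of 7] by simp
next
  case (Cons f fs)
  show ?case using branch_counts[OF Cons, of f] by simp
qed

section \<open>Ethers\<close>

definition cyc :: "bool list \<Rightarrow> row" where
  "cyc l x = of_bool (l ! nat (x mod int (length l)))"

definition lam_list :: "bool list \<Rightarrow> bool list" where
  "lam_list l = (if l = [] then [] else xorl (xorl (last l # butlast l) l) (rotate1 l))"

definition two :: "row \<Rightarrow> int \<Rightarrow> nat" where
  "two f x = (if f x = 1 then 2 else 0)"

lemma nth_xorl: "i < length a \<Longrightarrow> i < length b \<Longrightarrow> xorl a b ! i = (a ! i \<noteq> b ! i)"
  by (induction a b arbitrary: i rule: xorl.induct) (auto simp: nth_Cons split: nat.split)

lemma length_lam_list [simp]: "length (lam_list l) = length l"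
  by (simp add: lam_list_def length_xorl)

lemma length_lam_list_pow [simp]: "length ((lam_list ^^ n) l) = length l"
  by (induction n) simp_all

lemma cyc_rotate: "l \<noteq> [] \<Longrightarrow> cyc (rotate m l) x = cyc l (x + int m)"
proof -
  assume "l \<noteq> []"
  then have n: "0 < length l" by simp
  have "rotate m l ! nat (x mod int (length l)) = l ! ((m + nat (x mod int (length l))) mod length l)"
    using n by (intro nth_rotate) (simp add: nat_less_iff)
  also have "(m + nat (x mod int (length l))) mod length l = nat ((x + int m) mod int (length l))"
  proof -
    have "int ((m + nat (x mod int (length l))) mod length l) = (int m + x mod int (length l)) mod int (length l)"
      using n by (simp add: zmod_int)
    also have "\<dots> = (x + int m) mod int (length l)" by (simp add: mod_add_right_eq add.commute)
    finally show ?thesis by (metis nat_int)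
  qed
  finally show ?thesis by (simp add: cyc_def)
qed

lemma cyc_xorl:
  assumes "length a = length b" "0 < length a"
  shows "cyc (xorl a b) x = cyc a x + cyc b x"
proof -
  have "nat (x mod int (length b)) < length b" using assms by (cases b) (auto simp: nat_less_iff)
  then show ?thesis using assms by (simp add: cyc_def length_xorl nth_xorl)
qed

lemma cyc_periodic: "cyc l (x + int (length l) * k) = cyc l x"
  by (simp add: cyc_def)

lemma lam_cyc: "l \<noteq> [] \<Longrightarrow> lam (cyc l) = cyc (lam_list l)"
proof
  fix x assume l: "l \<noteq> []"
  have "cyc (last l # butlast l) x = cyc l (x - 1)"
    using cyc_rotate[of "last l # butlast l" 1 "x - 1"] l by simp
  moreover have "cyc (rotate1 l) x = cyc l (x + 1)" using cyc_rotate[OF l, of 1 x] by simp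
  ultimately show "lam (cyc l) x = cyc (lam_list l) x"
    using l by (simp add: lam_list_def lam_def cyc_xorl length_xorl)
qed

lemma lam_pow_cyc: "l \<noteq> [] \<Longrightarrow> (lam ^^ n) (cyc l) = cyc ((lam_list ^^ n) l)"
proof (induction n)
  case (Suc n)
  have ne: "(lam_list ^^ n) l \<noteq> []" using Suc.prems by (metis length_0_conv length_lam_list_pow)
  have "(lam ^^ Suc n) (cyc l) = lam ((lam ^^ n) (cyc l))" by simp
  also have "\<dots> = lam (cyc ((lam_list ^^ n) l))" by (rule arg_cong[OF Suc.IH[OF Suc.prems]])
  also have "\<dots> = cyc (lam_list ((lam_list ^^ n) l))" by (rule lam_cyc[OF ne])
  finally show ?case unfolding funpow.simps o_apply .
qed simp

lemma cyc_inject: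
  assumes "length a = length b" "cyc a = cyc b"
  shows "a = b"
proof (rule nth_equalityI[OF assms(1)])
  fix i assume i: "i < length a"
  have "cyc a (int i) = cyc b (int i)" by (rule fun_cong[OF assms(2)])
  then show "a ! i = b ! i" using i assms(1) by (cases "a ! i"; cases "b ! i"; simp add: cyc_def)
qed

lemma states_two: "states (two f)" "ones (two f) = (\<lambda>_. 0)" "nz (two f) = f"
  by (auto simp: states_def two_def ones_def nz_def fun_eq_iff)

lemma two_nz: "states \<xi> \<Longrightarrow> ones \<xi> = (\<lambda>_. 0) \<Longrightarrow> \<xi> = two (nz \<xi>)"
  by (force simp: states_def two_def ones_def nz_def fun_eq_iff)

lemma piggyback_pow_two: "(piggyback_step ^^ n) (two f) = two ((lam ^^ n) f)"
  using two_nz[of "(piggyback_step ^^ n) (two f)"] void_pow[OF states_two(1,2), of n f]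
    piggyback_pow_ones(1)[OF states_two(1), of n f]
  by (simp add: states_two)

definition bits :: "nat list \<Rightarrow> bool list" where "bits B = map (\<lambda>v. v \<noteq> 0) B"

definition word_ok :: "nat list \<Rightarrow> bool" where
  "word_ok B \<longleftrightarrow> B \<noteq> [] \<and> set B \<subseteq> {0, 2} \<and> length B dvd 16"

lemma bi_infinite_two: "word_ok B \<Longrightarrow> bi_infinite B = two (cyc (bits B))"
proof
  fix x assume B: "word_ok B"
  then have "nat (x mod int (length B)) < length B" by (simp add: word_ok_def nat_less_iff)
  then have "B ! nat (x mod int (length B)) \<in> {0, 2}" using B nth_mem unfolding word_ok_def by blast
  with \<open>nat _ < _\<close> show "bi_infinite B x = two (cyc (bits B)) x"
    by (auto simp: bi_infinite_def two_def cyc_def bits_def)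
qed

lemma bits_nonempty: "word_ok B \<Longrightarrow> bits B \<noteq> []" by (simp add: word_ok_def bits_def)

text \<open>For period 16, \<open>lam ^^ 16\<close> adds three equal values and is the
  identity.\<close>

lemma lam_16:
  assumes "\<And>x. f (x + 16) = f x"
  shows "(lam ^^ (n + 16 * m)) f = (lam ^^ n) f"
proof (induction m)
  case (Suc m)
  have "(lam ^^ 16) f = f"
    using lam_pow_two_power[of 4 f] assms[of "x - 16" for x] assms by (simp add: fun_eq_iff)
  then have "(lam ^^ (n + 16 * Suc m)) f = (lam ^^ (n + 16 * m)) f"
  proof -
    have "n + 16 * Suc m = n + 16 * m + 16" by simp
    then show ?thesis by (simp only: funpow_add o_apply \<open>(lam ^^ 16) f = f\<close>)
  qed
  then show ?case using Suc by simp
qed simp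

lemma cyc_16:
  assumes "length l dvd 16"
  shows "cyc l (x + 16) = cyc l x"
proof -
  obtain k where "16 = length l * k" using assms unfolding dvd_def by blast
  then have "(16::int) = int (length l) * int k" by (metis of_nat_mult of_nat_numeral)
  then show ?thesis using cyc_periodic[of l x "int k"] by simp
qed

lemma lam_mod_16: "(\<And>x. f (x + 16) = f x) \<Longrightarrow> (lam ^^ n) f = (lam ^^ (n mod 16)) f"
  using lam_16[of f "n mod 16" "n div 16"] by simp

text \<open>The backward half of the ether is obtained by reducing the time modulo 16.\<close>

definition eta :: "nat list \<Rightarrow> int \<Rightarrow> int \<Rightarrow> nat" where
  "eta B x t = two ((lam ^^ nat (t mod 16)) (cyc (bits B))) x"

lemma bits_16: "word_ok B \<Longrightarrow> cyc (bits B) (x + 16) = cyc (bits B) x"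
  by (rule cyc_16) (simp add: word_ok_def bits_def)

lemma eta_nat: "word_ok B \<Longrightarrow> eta B x (int n) = two ((lam ^^ n) (cyc (bits B))) x"
  using lam_mod_16[of "cyc (bits B)" n] bits_16[of B] by (simp add: eta_def nat_mod_distrib)

lemma generates_eta:
  assumes "word_ok B"
  shows "generates_ether B (eta B)"
proof -
  have "eta B x t \<in> {0, 2}" for x t by (simp add: eta_def two_def)
  moreover have "eta B (x + 16) t = eta B x t" for x t
  proof -
    have "(lam ^^ n) (cyc (bits B)) (y + 16) = (lam ^^ n) (cyc (bits B)) y" for n y
    proof -
      have "shift 16 (cyc (bits B)) = cyc (bits B)" using bits_16[OF assms] by (simp add: shift_def fun_eq_iff)
      then have "shift 16 ((lam ^^ n) (cyc (bits B))) = (lam ^^ n) (cyc (bits B))"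
        using lam_pow_shift[of n 16 "cyc (bits B)"] by simp
      from fun_cong[OF this, of y] show ?thesis by (simp add: shift_def)
    qed
    then show ?thesis by (simp add: eta_def two_def)
  qed
  moreover have "eta B x (t + 16) = eta B x t" for x t by (simp add: eta_def)
  moreover have "eta B x (int t) = piggyback_evol (bi_infinite B) x t" for x t
    by (simp add: eta_nat[OF assms] piggyback_evol_def bi_infinite_two[OF assms] piggyback_pow_two)
  ultimately show ?thesis unfolding generates_ether_def ether_def by (metis zero_less_numeral)
qed

lemma ether_of_eta: "word_ok B \<Longrightarrow> ether_of B = eta B"
  by (rule ether_of_eq[OF generates_eta])

section \<open>Signatures\<close>

fun lex_less :: "nat list \<Rightarrow> nat list \<Rightarrow> bool" where
  "lex_less (x # xs) (y # ys) \<longleftrightarrow> x < y \<or> x = y \<and> lex_less xs ys"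
| "lex_less _ _ \<longleftrightarrow> False"

lemma lex_less: "length xs = length ys \<Longrightarrow> lex_less xs ys \<Longrightarrow> (xs, ys) \<in> lex {(i, j). i < j}"
  by (induction xs ys rule: lex_less.induct) auto

definition word_row :: "nat list \<Rightarrow> nat \<Rightarrow> bool list" where
  "word_row B t = (lam_list ^^ t) (bits B)"

definition unbits :: "bool list \<Rightarrow> nat list" where
  "unbits l = map (\<lambda>b. if b then 2 else 0) l"

fun all_rotations :: "nat \<Rightarrow> (bool list \<Rightarrow> bool) \<Rightarrow> bool list \<Rightarrow> bool" where
  "all_rotations 0 P l \<longleftrightarrow> True"
| "all_rotations (Suc n) P l \<longleftrightarrow> P l \<and> all_rotations n P (rotate1 l)"

fun all_times :: "nat \<Rightarrow> (bool list \<Rightarrow> bool) \<Rightarrow> bool list \<Rightarrow> bool" where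
  "all_times 0 P l \<longleftrightarrow> True"
| "all_times (Suc n) P l \<longleftrightarrow> P l \<and> all_times n P (lam_list l)"

lemma all_rotations: "all_rotations n P l \<longleftrightarrow> (\<forall>c<n. P (rotate c l))"
proof (induction n arbitrary: l)
  case (Suc n)
  show ?case unfolding all_rotations.simps Suc.IH All_less_Suc2 by (simp add: rotate1_rotate_swap)
qed simp

lemma all_times: "all_times n P l \<longleftrightarrow> (\<forall>t<n. P ((lam_list ^^ t) l))"
proof (induction n arbitrary: l)
  case (Suc n)
  show ?case unfolding all_times.simps Suc.IH All_less_Suc2 by (simp add: funpow_swap1)
qed simp

text \<open>Sixteen consecutive rows are all rows of the ether. As the length is a power of two, any
  shorter word would make half the length a period, which the first condition excludes; the second
  one compares all words of equal length.\<close>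

definition signature_ok :: "nat list \<Rightarrow> bool" where
  "signature_ok B \<longleftrightarrow> all_times 16 (\<lambda>l.
     (length B = 1 \<or> rotate (length B div 2) l \<noteq> l) \<and>
     all_rotations (length B) (\<lambda>r. unbits r = B \<or> lex_less B (unbits r)) l) (bits B)"

lemma eta_row: "word_ok B \<Longrightarrow> eta B x t = two (cyc (word_row B (nat (t mod 16)))) x"
  by (simp add: eta_def word_row_def lam_pow_cyc bits_nonempty)

lemma length_word_row [simp]: "length (word_row B t) = length B"
  by (simp add: word_row_def bits_def)

lemma signature_eta:
  assumes B: "word_ok B" and ok: "signature_ok B"
  shows "is_signature B (eta B)"
proof -
  have n: "0 < length B" using B by (simp add: word_ok_def)
  have "occurs_in B (eta B)"
    unfolding occurs_in_def using eta_nat[OF B, of _ 0] n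
    by (intro conjI exI[of _ 0] allI) (auto simp: bi_infinite_two[OF B])
  moreover have "B' = B \<or> (B, B') \<in> lenlex {(i, j). i < j}" if occ: "occurs_in B' (eta B)" for B'
  proof -
    obtain t a where B': "B' \<noteq> []" "\<And>x. eta B x t = bi_infinite B' (x + a)"
      using occ unfolding occurs_in_def by auto
    define s where "s = nat (t mod 16)"
    define l where "l = word_row B s"
    have s: "s < 16" unfolding s_def by (simp add: nat_less_iff)
    have len: "length l = length B" by (simp add: l_def)
    have row: "two (cyc l) x = bi_infinite B' (x + a)" for x
      using B'(2)[of x] eta_row[OF B] by (simp add: l_def s_def)
    have chk: "length B = 1 \<or> rotate (length B div 2) l \<noteq> l"
      "c < length B \<Longrightarrow> unbits (rotate c l) = B \<or> lex_less B (unbits (rotate c l))" for c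
      using ok s unfolding signature_ok_def all_times all_rotations l_def word_row_def by auto
    consider "length B < length B'" | "length B' = length B" | "length B' < length B" by linarith
    then show ?thesis
    proof cases
      case 1 then show ?thesis by (simp add: lenlex_conv)
    next
      case 2
      define c where "c = nat ((- a) mod int (length B))"
      have c: "c < length B" using n by (simp add: c_def nat_less_iff)
      have "B' = unbits (rotate c l)"
      proof (rule nth_equalityI)
        fix i assume i: "i < length B'"
        have "B' ! i = bi_infinite B' (int i)" using i by (simp add: bi_infinite_def)
        also have "\<dots> = two (cyc l) (int i - a)" using row[of "int i - a"] by simp
        also have "cyc l (int i - a) = cyc (rotate c l) (int i)"
        proof -
          have "cyc (rotate c l) (int i) = cyc l (int i + int c)" using n len by (intro cyc_rotate) auto
          also have "int c = (- a) mod int (length l)" using n by (simp add: c_def len)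
          also have "cyc l (int i + (- a) mod int (length l)) = cyc l (int i - a)"
            by (simp add: cyc_def mod_add_right_eq)
          finally show ?thesis by simp
        qed
        then have "two (cyc l) (int i - a) = two (cyc (rotate c l)) (int i)" by (simp add: two_def)
        also have "\<dots> = unbits (rotate c l) ! i" using i 2 len by (simp add: two_def cyc_def unbits_def)
        finally show "B' ! i = unbits (rotate c l) ! i" .
      qed (simp add: 2 len unbits_def)
      then have "B' = B \<or> lex_less B B'" using chk(2)[OF c] by simp
      then show ?thesis using lex_less[of B B'] 2 by (auto simp: lenlex_conv)
    next
      \<comment> \<open>With a period \<open>m\<close> below the length of \<open>B\<close>, the gcd
        of both is a period by Bezout. It is a proper divisor of a power of two, so it divides half
        the length.\<close>
      case 3
      define m where "m = length B'"
      have m: "0 < m" "m < length B" using 3 B'(1) by (simp_all add: m_def)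
      have p1: "cyc l (x + int m) = cyc l x" for x
      proof -
        have "(x + int m + a) mod int m = (x + a) mod int m" by (metis add.assoc add.commute mod_add_self2)
        then have "two (cyc l) (x + int m) = two (cyc l) x" unfolding row by (simp add: bi_infinite_def m_def)
        then show ?thesis by (simp add: two_def split: if_splits)
      qed
      have pk: "cyc l (x + int m * k) = cyc l x" for x k
      proof -
        have P: "cyc l (x + int m * int j) = cyc l x" for x j
          by (induction j) (use p1[of "x + int m * int j" for j] in \<open>simp_all add: algebra_simps\<close>)
        show ?thesis using P[of x "nat k"] P[of "x + int m * k" "nat (- k)"] by (cases "k \<ge> 0") simp_all
      qed
      obtain u v where uv: "int m * u + int (length B) * v = gcd (int m) (int (length B))"
        using bezout_int by (metis mult.commute)
      have pg: "cyc l (x + gcd (int m) (int (length B))) = cyc l x" for x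
      proof -
        have "x + gcd (int m) (int (length B)) = x + int (length B) * v + int m * u" using uv by linarith
        then have "cyc l (x + gcd (int m) (int (length B))) = cyc l (x + int (length B) * v)"
          using pk[of "x + int (length B) * v" u] by (simp only:)
        then show ?thesis using cyc_periodic[of l x v] len by simp
      qed
      have dvd: "length B dvd 2 ^ 4" using B by (simp add: word_ok_def)
      then obtain i where i: "length B = 2 ^ i" using divides_primepow_nat[of 2 "length B" 4] by auto
      have "gcd m (length B) dvd 2 ^ i" unfolding i by simp
      then obtain j where j: "gcd m (length B) = 2 ^ j" "j \<le> i" using divides_primepow_nat[of 2 _ i] by auto
      have "2 ^ j < (2 :: nat) ^ i" using m i j(1) by (metis gcd_le1_nat le_less_trans less_not_refl2)
      then have ji: "j < i" by simp
      then have half: "length B div 2 = 2 ^ j * 2 ^ (i - 1 - j)"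
      proof -
        obtain i' where i': "i = Suc i'" using ji by (cases i) auto
        then show ?thesis using ji by (simp add: i power_add[symmetric])
      qed
      have pg': "cyc l (x + int (2 ^ j * q)) = cyc l x" for x q
      proof (induction q)
        case (Suc q)
        have "int (2 ^ j) = gcd (int m) (int (length B))" using j(1) by (simp add: gcd_int_int_eq flip: j(1))
        then show ?case using pg[of "x + int (2 ^ j * q)"] Suc by (simp add: algebra_simps)
      qed simp
      have "cyc (rotate (length B div 2) l) = cyc l"
      proof
        fix x
        have "cyc (rotate (length B div 2) l) x = cyc l (x + int (length B div 2))" using n len by (intro cyc_rotate) auto
        also have "\<dots> = cyc l x" unfolding half by (rule pg')
        finally show "cyc (rotate (length B div 2) l) x = cyc l x" .
      qed
      then have "rotate (length B div 2) l = l" by (intro cyc_inject) simp_all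
      then show ?thesis using chk(1) m by auto
    qed
  qed
  ultimately show ?thesis by (simp add: is_signature_def)
qed

section \<open>Reflections\<close>

lemma lam_reflect_step: "lam (\<lambda>x. f (- 1 - x)) = (\<lambda>x. lam f (- 1 - x))"
  by (simp add: lam_def fun_eq_iff algebra_simps)

lemma lam_reflect: "(lam ^^ n) (\<lambda>x. f (- 1 - x)) = (\<lambda>x. (lam ^^ n) f (- 1 - x))"
  by (induction n) (simp_all add: lam_reflect_step)

text \<open>Reversing a list reflects about -1/2 rather than about 0; the difference is the
  translation by one that appears in \<open>reflect_eta\<close>.\<close>

lemma cyc_rev:
  assumes "l \<noteq> []"
  shows "cyc (rev l) x = cyc l (- 1 - x)"
proof -
  let ?n = "int (length l)"
  have n: "0 < ?n" using assms by simp
  define i where "i = nat (x mod ?n)"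
  have i: "i < length l" "int i = x mod ?n" using n by (simp_all add: i_def nat_less_iff)
  have "(- 1 - x) mod ?n = ?n - 1 - x mod ?n"
  proof -
    have "(- 1 - x) mod ?n = (?n - 1 - x mod ?n) mod ?n"
      by (metis (no_types, lifting) diff_diff_eq2 diff_add_eq minus_diff_eq mod_diff_right_eq mod_diff_left_eq mod_self uminus_add_conv_diff add.commute diff_0 minus_mod_self1 mod_minus_eq add_uminus_conv_diff)
    also have "\<dots> = ?n - 1 - x mod ?n" using pos_mod_bound[OF n, of x] pos_mod_sign[OF n, of x] by (intro mod_pos_pos_trivial) linarith+
    finally show ?thesis .
  qed
  then have "nat ((- 1 - x) mod ?n) = length l - Suc i" using i by linarith
  then show ?thesis using i by (simp add: cyc_def rev_nth i_def[symmetric])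
qed

definition asymmetric_word :: "nat list \<Rightarrow> bool" where
  "asymmetric_word B \<longleftrightarrow> all_times 16 (all_rotations (length B) (\<lambda>r. rev (bits B) \<noteq> r)) (bits B)"

lemma reflect_eta:
  assumes "word_ok B"
  shows "reflect (eta B) x t = two ((lam ^^ nat (t mod 16)) (cyc (rev (bits B)))) (x - 1)"
proof -
  have "cyc (rev (bits B)) = (\<lambda>x. cyc (bits B) (- 1 - x))" using cyc_rev[OF bits_nonempty[OF assms]] by (simp add: fun_eq_iff)
  then show ?thesis using lam_reflect[of "nat (t mod 16)" "cyc (bits B)"] by (simp add: reflect_def eta_def two_def)
qed

lemma symmetric_eta:
  assumes B: "word_ok B" and s: "\<not> asymmetric_word B"
  shows "symmetric_ether (eta B)"
proof -
  obtain c t where c: "rev (bits B) = rotate c ((lam_list ^^ t) (bits B))"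
    using s by (auto simp: asymmetric_word_def all_times all_rotations)
  have "(lam_list ^^ t) (bits B) \<noteq> []" using bits_nonempty[OF B] by (metis length_0_conv length_lam_list_pow)
  then have rev: "cyc (rev (bits B)) = shift (int c) ((lam ^^ t) (cyc (bits B)))"
    using cyc_rotate c by (simp add: shift_def fun_eq_iff lam_pow_cyc[OF bits_nonempty[OF B]])
  have "reflect (eta B) x u = eta B (x + (int c - 1)) (u + int t)" for x u
  proof -
    have "nat ((u + int t) mod 16) = (nat (u mod 16) + t) mod 16"
      using nat_mod_distrib[of "u mod 16 + int t" 16] by (simp add: nat_add_distrib mod_add_left_eq)
    then have "(lam ^^ nat ((u + int t) mod 16)) (cyc (bits B)) = (lam ^^ (nat (u mod 16) + t)) (cyc (bits B))"
      using lam_mod_16[of "cyc (bits B)", OF bits_16[OF B]] by metis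
    then have "(lam ^^ nat (u mod 16)) ((lam ^^ t) (cyc (bits B))) = (lam ^^ nat ((u + int t) mod 16)) (cyc (bits B))"
      by (simp only: funpow_add o_apply)
    then show ?thesis
      by (simp add: reflect_eta[OF B] rev lam_pow_shift eta_def two_def shift_def algebra_simps)
  qed
  then show ?thesis unfolding symmetric_ether_def ether_equiv_def by blast
qed

lemma asymmetric_eta:
  assumes B: "word_ok B" and s: "asymmetric_word B"
  shows "\<not> symmetric_ether (eta B)"
proof
  assume "symmetric_ether (eta B)"
  then obtain a b where ab: "\<And>x t. reflect (eta B) x t = eta B (x + a) (t + b)"
    unfolding symmetric_ether_def ether_equiv_def by blast
  define l where "l = word_row B (nat (b mod 16))"
  have n: "0 < length B" using B by (simp add: word_ok_def)
  have "length l = length B" by (simp add: l_def)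
  with n have l: "l \<noteq> []" "length l = length B" by auto
  define c where "c = nat ((1 + a) mod int (length B))"
  have c: "c < length B" "int c = (1 + a) mod int (length B)" using n by (simp_all add: c_def nat_less_iff)
  have "cyc (rev (bits B)) x = cyc (rotate c l) x" for x
  proof -
    have "two (cyc (rev (bits B))) x = two (cyc l) (x + 1 + a)"
      using ab[of "x + 1" 0] by (simp add: reflect_eta[OF B] eta_row[OF B] l_def)
    then have "cyc (rev (bits B)) x = cyc l (x + 1 + a)" by (cases "cyc l (x + 1 + a)"; simp add: two_def split: if_splits)
    also have "\<dots> = cyc l (x + int c)" unfolding c(2) by (simp add: cyc_def l(2) mod_add_right_eq add.assoc)
    finally show ?thesis using cyc_rotate[OF l(1)] by simp
  qed
  then have "rev (bits B) = rotate c l" by (intro cyc_inject) (auto simp: l(2) bits_def)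
  moreover have "nat (b mod 16) < 16" by (simp add: nat_less_iff)
  ultimately show False using s c(1) unfolding asymmetric_word_def l_def word_row_def all_times all_rotations by auto
qed

section \<open>Orbits under translation and time evolution\<close>

definition orbit_rel :: "row \<Rightarrow> row \<Rightarrow> bool" where
  "orbit_rel f g \<longleftrightarrow> (\<exists>a b. f = shift a ((lam ^^ b) g))"

lemma shift_shift: "shift a (shift b f) = shift (a + b) f"
  by (simp add: shift_def fun_eq_iff algebra_simps)

lemma shift_0 [simp]: "shift 0 f = f"
  by (simp add: shift_def fun_eq_iff)

lemma orbit_rel_trans: "orbit_rel f g \<Longrightarrow> orbit_rel g h \<Longrightarrow> orbit_rel f h"
  unfolding orbit_rel_def by (metis (no_types, lifting) lam_pow_shift shift_shift funpow_add o_apply)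

lemma orbit_rel_refl: "orbit_rel f f"
  unfolding orbit_rel_def by (rule exI[of _ 0], rule exI[of _ 0]) simp

text \<open>On rows of period 16 time is invertible: \<open>15 * b\<close> further steps undo
  \<open>b\<close> steps.\<close>

lemma orbit_rel_sym:
  assumes "orbit_rel f g" "\<And>x. g (x + 16) = g x"
  shows "orbit_rel g f"
proof -
  obtain a b where f: "f = shift a ((lam ^^ b) g)" using assms(1) by (auto simp: orbit_rel_def)
  have "(lam ^^ (15 * b)) f = shift a ((lam ^^ (15 * b)) ((lam ^^ b) g))" by (simp add: f lam_pow_shift)
  also have "(lam ^^ (15 * b)) ((lam ^^ b) g) = (lam ^^ (0 + 16 * b)) g"
    by (simp add: funpow_add[symmetric, THEN fun_cong, unfolded o_apply])
  also have "\<dots> = g" using lam_16[of g 0 b] assms(2) by simp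
  finally have "g = shift (- a) ((lam ^^ (15 * b)) f)" by (simp add: shift_shift)
  then show ?thesis unfolding orbit_rel_def by blast
qed

lemma dl_pow_two_4_8: "(dl ^^ 1) f x = f x + f (x - 1)" "(dl ^^ 2) f x = f x + f (x - 2)"
  "(dl ^^ 4) f x = f x + f (x - 4)" "(dl ^^ 8) f x = f x + f (x - 8)"
  using dl_pow_two_power[of 0 f x] dl_pow_two_power[of 1 f x] dl_pow_two_power[of 2 f x] dl_pow_two_power[of 3 f x] by simp_all

lemma lam_pow_two_4: "(lam ^^ 1) f x = f (x - 1) + f x + f (x + 1)" "(lam ^^ 2) f x = f (x - 2) + f x + f (x + 2)"
  "(lam ^^ 4) f x = f (x - 4) + f x + f (x + 4)"
  using lam_pow_two_power[of 0 f x] lam_pow_two_power[of 1 f x] lam_pow_two_power[of 2 f x] by simp_all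

text \<open>\<open>1 + u^d = X^d\<close> for a power of two \<open>d\<close>, and
  \<open>1 + u^3 = X^2 (X^-1 + 1 + X)\<close> is a translation composed with one time step. The
  cases 6 and 12 are its square and its fourth power.\<close>

lemma elim_orbit:
  assumes "d \<in> {1, 2, 3, 4, 6, 8, 12}"
  shows "orbit_rel (\<lambda>x. f x + (dl ^^ d) f x) f"
proof -
  have split: "(dl ^^ 3) f = (dl ^^ 1) ((dl ^^ 2) f)" "(dl ^^ 6) f = (dl ^^ 2) ((dl ^^ 4) f)" "(dl ^^ 12) f = (dl ^^ 4) ((dl ^^ 8) f)"
  proof -
    have n: "(3 :: nat) = 1 + 2" "(6 :: nat) = 2 + 4" "(12 :: nat) = 4 + 8" by simp_all
    show "(dl ^^ 3) f = (dl ^^ 1) ((dl ^^ 2) f)" unfolding n(1) funpow_add o_apply ..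
    show "(dl ^^ 6) f = (dl ^^ 2) ((dl ^^ 4) f)" unfolding n(2) funpow_add o_apply ..
    show "(dl ^^ 12) f = (dl ^^ 4) ((dl ^^ 8) f)" unfolding n(3) funpow_add o_apply ..
  qed
  consider "d = 1" | "d = 2" | "d = 3" | "d = 4" | "d = 6" | "d = 8" | "d = 12" using assms by auto
  then show ?thesis
  proof cases
    case 1 then show ?thesis unfolding orbit_rel_def
      by (intro exI[of _ "-1"] exI[of _ 0]) (simp only: dl_pow_two_4_8 shift_def fun_eq_iff, simp)
  next
    case 2 then show ?thesis unfolding orbit_rel_def
      by (intro exI[of _ "-2"] exI[of _ 0]) (simp only: dl_pow_two_4_8 shift_def fun_eq_iff, simp)
  next
    case 3 then show ?thesis unfolding orbit_rel_def
      by (intro exI[of _ "-2"] exI[of _ 1]) (simp only: split dl_pow_two_4_8 lam_pow_two_4 shift_def fun_eq_iff, simp add: add.commute add.left_commute)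
  next
    case 4 then show ?thesis unfolding orbit_rel_def
      by (intro exI[of _ "-4"] exI[of _ 0]) (simp only: dl_pow_two_4_8 shift_def fun_eq_iff, simp)
  next
    case 5 then show ?thesis unfolding orbit_rel_def
      by (intro exI[of _ "-4"] exI[of _ 2]) (simp only: split dl_pow_two_4_8 lam_pow_two_4 shift_def fun_eq_iff, simp add: add.commute add.left_commute)
  next
    case 6 then show ?thesis unfolding orbit_rel_def
      by (intro exI[of _ "-8"] exI[of _ 0]) (simp only: dl_pow_two_4_8 shift_def fun_eq_iff, simp)
  next
    case 7 then show ?thesis unfolding orbit_rel_def
      by (intro exI[of _ "-8"] exI[of _ 4]) (simp only: split dl_pow_two_4_8 lam_pow_two_4 shift_def fun_eq_iff, simp add: add.commute add.left_commute)
  qed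
qed

lemma elim_list_orbit:
  assumes "length c = n" "k + n = 16" "d \<in> {1, 2, 3, 4, 6, 8, 12}"
  shows "orbit_rel ((dl ^^ k) (rowY (elim d c))) ((dl ^^ k) (rowY c)) \<and> length (elim d c) = n"
proof -
  have "orbit_rel ((dl ^^ k) (rowY (xorl c (replicate d False @ c)))) ((dl ^^ k) (rowY c))"
    unfolding rowY_elim_step[OF assms(1,2)] using elim_orbit[OF assms(3), of "(dl ^^ k) (rowY c)"]
    by (simp add: funpow_add add.commute[of k])
  then show ?thesis using assms(1) by (auto simp: elim_def orbit_rel_refl length_xorl split: list.split bool.split)
qed

lemma fold_elim_orbit:
  assumes "length c = n" "k + n = 16" "set ds \<subseteq> {1, 2, 3, 4, 6, 8, 12}"
  shows "orbit_rel ((dl ^^ k) (rowY (fold elim ds c))) ((dl ^^ k) (rowY c)) \<and> length (fold elim ds c) = n"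
  using assms
proof (induction ds arbitrary: c)
  case (Cons d ds)
  have 1: "orbit_rel ((dl ^^ k) (rowY (elim d c))) ((dl ^^ k) (rowY c)) \<and> length (elim d c) = n"
    using Cons.prems by (intro elim_list_orbit) auto
  then show ?case using Cons.IH[of "elim d c"] Cons.prems by (auto intro: orbit_rel_trans)
qed (simp add: orbit_rel_refl)

text \<open>An executable form of \<open>rowY\<close>: rotating by 15 moves the row one cell to the
  right, so the last summand is the factor \<open>1 + X\<close>.\<close>

fun row_of_code :: "bool list \<Rightarrow> bool list" where
  "row_of_code [] = replicate 16 False"
| "row_of_code (c # cs) = (let l = row_of_code cs in xorl (c # replicate 15 False) (xorl l (rotate 15 l)))"

lemma row_of_code: "cyc (row_of_code c) = rowY c \<and> length (row_of_code c) = 16"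
proof (induction c)
  case Nil
  have "nat (x mod 16) < 16" for x by (simp add: nat_less_iff)
  then show ?case by (simp add: fun_eq_iff cyc_def)
next
  case (Cons a c)
  let ?l = "row_of_code c"
  have l: "?l \<noteq> []" "length ?l = 16" using Cons by auto
  have "cyc (a # replicate 15 False) x = of_bool (a \<and> 16 dvd x)" for x
  proof -
    have "(a # replicate 15 False) ! nat (x mod 16) \<longleftrightarrow> a \<and> nat (x mod 16) = 0"
      by (cases "nat (x mod 16)") (simp_all add: nth_Cons' nat_less_iff)
    moreover have "nat (x mod 16) = 0 \<longleftrightarrow> 16 dvd x" by (simp add: dvd_eq_mod_eq_0) (smt (verit) pos_mod_sign)
    ultimately show ?thesis by (simp add: cyc_def)
  qed
  moreover have "cyc (rotate 15 ?l) x = rowY c (x - 1)" for x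
    using cyc_rotate[OF l(1), of 15 x] cyc_periodic[of ?l "x - 1" 1] l(2) Cons by (simp add: algebra_simps)
  ultimately show ?case using Cons
    by (simp add: Let_def fun_eq_iff cyc_xorl length_xorl dl_def)
qed

section \<open>The ten words and the normal forms\<close>

definition words :: "nat list list" where
  "words = [[0], [2], [0,2], [0,0,0,2], [0,0,0,0,0,0,0,2], [0,0,0,0,2,0,2,2], [0,0,0,2,0,2,2,2],
    [0,0,0,2,2,2,2,2], [0,0,0,2,0,0,0,2,0,0,0,2,2,2,2,2], [0,0,0,2,0,0,0,2,0,0,2,0,2,0,0,2]]"

definition extend16 :: "bool list \<Rightarrow> bool list" where
  "extend16 l = map (\<lambda>i. l ! (i mod length l)) [0..<16]"

lemma cyc_extend16:
  assumes "length l dvd 16"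
  shows "cyc (extend16 l) = cyc l"
proof
  fix x
  have l: "0 < length l" using assms by (cases "length l") auto
  obtain k where k: "16 = length l * k" using assms unfolding dvd_def by blast
  have "nat (x mod 16) < 16" by (simp add: nat_less_iff)
  then have "extend16 l ! nat (x mod 16) = l ! (nat (x mod 16) mod length l)" by (simp add: extend16_def)
  also have "nat (x mod 16) mod length l = nat (x mod int (length l))"
  proof -
    have "int (length l) dvd 16" using k by (metis dvd_triv_left int_dvd_int_iff of_nat_numeral)
    then have "x mod 16 mod int (length l) = x mod int (length l)" by (rule mod_mod_cancel)
    then show ?thesis using nat_mod_distrib[of "x mod 16" "int (length l)"] by simp
  qed
  finally show "cyc (extend16 l) x = cyc l x" by (simp add: cyc_def extend16_def)
qed

text \<open>The leading \<open>False\<close> entries restore the power of \<open>u\<close> that was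
  stripped off. The negated universal search asserts that some rotation of some iterate of the word,
  or for class 5 of its reversal, equals the row.\<close>

definition normal_form_ok :: "bool list \<times> nat \<Rightarrow> bool" where
  "normal_form_ok = (\<lambda>(nf, k). let b = extend16 (bits (words ! k)); r = row_of_code (replicate (16 - length nf) False @ nf) in
     \<exists>b'\<in>set (if k = 5 then [b, rev b] else [b]). \<not> all_times 16 (all_rotations 16 (\<lambda>r'. r \<noteq> r')) b')"

lemma words_ok: "\<forall>B\<in>set words. word_ok B"
  by code_simp

lemma words_signature: "\<forall>B\<in>set words. signature_ok B"
  by code_simp

lemma words_symmetry:
  "\<forall>B\<in>set words. asymmetric_word B \<longleftrightarrow> B = [0,0,0,0,2,0,2,2]"
  by code_simp

lemma normal_forms_ok:
  "\<forall>p\<in>set normal_forms. normal_form_ok p \<and> length (fst p) \<le> 16 \<and> snd p < length words"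
  by code_simp

theorem ether_class_sound:
  assumes "length r = 16" "ether_class r = k" "k < 10"
  shows "orbit_rel (rowY r) (cyc (bits (words ! k))) \<or> k = 5 \<and> orbit_rel (rowY r) (cyc (rev (bits (words ! k))))"
proof -
  define j where "j = length (takeWhile Not r)"
  define c where "c = dropWhile Not r"
  have tw: "takeWhile Not r = replicate j False"
    unfolding j_def by (rule replicate_eqI[symmetric, THEN sym]) (auto dest: set_takeWhileD)
  have r: "r = replicate j False @ c" unfolding c_def tw[symmetric] by simp
  have len: "j + length c = 16" using assms(1) r by (metis length_append length_replicate)
  have row: "rowY r = (dl ^^ j) (rowY c)" by (subst r) (simp add: rowY_append rowY_replicate_False)
  define nf where "nf = fold elim [1, 2, 3, 4, 6, 8, 12] c"
  have nf: "orbit_rel ((dl ^^ j) (rowY nf)) (rowY r)" "length nf = length c"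
    using fold_elim_orbit[OF refl len, of "[1, 2, 3, 4, 6, 8, 12]"] by (simp_all add: nf_def row del: fold.simps)
  have "map_of normal_forms nf = Some k"
  proof -
    have "nf_class nf = k" using assms(2) unfolding ether_class_def nf_def c_def .
    then show ?thesis using assms(3) by (auto simp: nf_class_def split: option.splits)
  qed
  then have mem: "(nf, k) \<in> set normal_forms" by (rule map_of_SomeD)
  let ?B = "words ! k"
  have k: "k < length words" using normal_forms_ok mem by fastforce
  then have B: "word_ok ?B" using words_ok nth_mem by blast
  have dvd: "length (bits ?B) dvd 16" using B by (simp add: word_ok_def bits_def)
  let ?b = "extend16 (bits ?B)"
  obtain b' t a where b': "b' = ?b \<or> k = 5 \<and> b' = rev ?b"
      and eq: "row_of_code (replicate (16 - length nf) False @ nf) = rotate a ((lam_list ^^ t) b')"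
    using normal_forms_ok mem unfolding normal_form_ok_def by (fastforce simp: Let_def all_times all_rotations split: if_splits)
  have b'_ne: "b' \<noteq> []" using b' by (auto simp: extend16_def)
  have "(dl ^^ j) (rowY nf) = rowY (replicate (16 - length nf) False @ nf)"
  proof -
    have "16 - length nf = j" using len nf(2) by simp
    then show ?thesis by (simp add: rowY_append rowY_replicate_False)
  qed
  also have "\<dots> = cyc (rotate a ((lam_list ^^ t) b'))" using row_of_code[of "replicate (16 - length nf) False @ nf"] eq by simp
  also have "\<dots> = shift (int a) ((lam ^^ t) (cyc b'))"
  proof -
    have "(lam_list ^^ t) b' \<noteq> []" using b'_ne by (metis length_0_conv length_lam_list_pow)
    then show ?thesis using cyc_rotate lam_pow_cyc[OF b'_ne] by (simp add: shift_def fun_eq_iff)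
  qed
  finally have "orbit_rel ((dl ^^ j) (rowY nf)) (cyc b')" unfolding orbit_rel_def by blast
  moreover have "orbit_rel (rowY r) ((dl ^^ j) (rowY nf))"
    by (rule orbit_rel_sym[OF nf(1)]) (rule rowY_periodic)
  ultimately have o: "orbit_rel (rowY r) (cyc b')" by (rule orbit_rel_trans[rotated])
  show ?thesis
  proof (cases "b' = ?b")
    case True then show ?thesis using o cyc_extend16[OF dvd] by simp
  next
    case False
    then have "k = 5" "b' = rev ?b" using b' by auto
    moreover have "cyc (rev ?b) = cyc (rev (bits ?B))"
      using cyc_rev[of ?b] cyc_rev[OF bits_nonempty[OF B]] cyc_extend16[OF dvd] by (simp add: extend16_def fun_eq_iff)
    ultimately show ?thesis using o by simp
  qed
qed

section \<open>Voids of the Pascal triangle\<close>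

definition pt :: "nat \<Rightarrow> row" where
  "pt n = (lam ^^ n) (\<lambda>y. of_bool (y = 0))"

lemma lambda_step_bit: "lambda_step (\<lambda>x. if f x = 1 then 1 else 0) = (\<lambda>x. if lam f x = 1 then 1 else 0)" for f :: row
proof
  fix x
  show "lambda_step (\<lambda>x. if f x = 1 then 1 else 0) x = (if lam f x = 1 then 1 else 0)"
    by (cases "f (x - 1)"; cases "f x"; cases "f (x + 1)"; simp add: lambda_step_def lam_def)
qed

lemma lambda_bullet_pt: "lambda_bullet x t = (if pt t x = 1 then 1 else 0)"
proof -
  have "(lambda_step ^^ t) (\<lambda>y. if y = 0 then 1 else 0) = (\<lambda>x. if pt t x = 1 then 1 else 0)"
  proof (induction t)
    case (Suc t)
    then show ?case using lambda_step_bit[of "pt t"] by (simp add: pt_def)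
  qed (auto simp: pt_def fun_eq_iff)
  then show ?thesis by (simp add: lambda_bullet_def)
qed

lemma Lam_iff: "(x, t) \<in> Lam \<longleftrightarrow> 0 \<le> t \<and> pt (nat t) x = 1"
  by (auto simp: Lam_def lambda_bullet_pt) (metis nat_0_le)

lemma pt_Suc: "pt (Suc n) x = pt n (x - 1) + pt n x + pt n (x + 1)"
  by (simp add: pt_def lam_def)

lemma pt_add: "pt (m + n) = (lam ^^ m) (pt n)"
  by (simp add: pt_def funpow_add)

lemma pt_outside: "int n < \<bar>x\<bar> \<Longrightarrow> pt n x = 0"
  using lam_pow_cong[of x n "\<lambda>y. of_bool (y = 0)" "\<lambda>_. 0"] by (force simp: pt_def)

lemma pt_edge: "pt n (int n) = 1" "pt n (- int n) = 1"
proof -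
  show "pt n (int n) = 1"
  proof (induction n)
    case (Suc n) then show ?case by (simp add: pt_Suc pt_outside)
  qed (simp add: pt_def)
  show "pt n (- int n) = 1"
  proof (induction n)
    case (Suc n) then show ?case by (simp add: pt_Suc pt_outside)
  qed (simp add: pt_def)
qed

text \<open>Self-similarity, again by Frobenius: row \<open>2^k q\<close> is row \<open>q\<close>
  spread out by the factor \<open>2^k\<close>.\<close>

lemma pt_scaled: "pt (2 ^ k * q) x = (if 2 ^ k dvd x then pt q (x div 2 ^ k) else 0)"
proof (induction q arbitrary: x)
  case 0
  then show ?case by (auto simp: pt_def elim!: dvdE)
next
  case (Suc q)
  have "pt (2 ^ k * Suc q) x = (lam ^^ (2 ^ k)) (pt (2 ^ k * q)) x" by (simp add: pt_add[symmetric])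
  also have "\<dots> = pt (2 ^ k * q) (x - 2 ^ k) + pt (2 ^ k * q) x + pt (2 ^ k * q) (x + 2 ^ k)"
    by (rule lam_pow_two_power)
  also have "\<dots> = (if 2 ^ k dvd x then pt (Suc q) (x div 2 ^ k) else 0)"
  proof (cases "2 ^ k dvd x")
    case True
    then obtain y where "x = 2 ^ k * y" by auto
    then show ?thesis by (simp add: Suc.IH pt_Suc left_diff_distrib flip: distrib_left[of "2 ^ k" y 1, simplified] right_diff_distrib[of "2 ^ k" y 1, simplified])
  next
    case False
    then have "\<not> 2 ^ k dvd x - 2 ^ k" "\<not> 2 ^ k dvd x + 2 ^ k"
      using dvd_add[of "2 ^ k" "x - 2 ^ k" "2 ^ k"] dvd_diff[of "2 ^ k" "x + 2 ^ k" "2 ^ k"] by auto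
    then show ?thesis using False by (simp add: Suc.IH)
  qed
  finally show ?case .
qed

lemma bit_sum3_zero: "a + b + c = 0 \<Longrightarrow> c = b + a" for a b c :: bit
  by (cases a; cases b; cases c; simp)

text \<open>\<open>lam f = 0\<close> is the Fibonacci recursion modulo 2. Its solutions are zero and
  the three translates of 110110....\<close>

lemma extend_period3:
  fixes f :: row
  assumes "a < b" and z: "\<And>y. a < y \<Longrightarrow> y < b \<Longrightarrow> lam f y = 0"
  obtains g where "\<And>x. lam g x = 0" "\<And>y. a \<le> y \<Longrightarrow> y \<le> b \<Longrightarrow> f y = g y"
    "(\<forall>x. g x = 0) \<or> (\<exists>c. \<forall>x. g x = of_bool ((x + c) mod 3 \<noteq> 2))"
proof -
  define g where "g y = (if (y - a) mod 3 = 0 then f a else if (y - a) mod 3 = 1 then f (a + 1) else f a + f (a + 1))" for y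
  have m: "(y - a) mod 3 = 0 \<or> (y - a) mod 3 = 1 \<or> (y - a) mod 3 = 2" for y by presburger
  have s: "(y - 1 - a) mod 3 = ((y - a) mod 3 + 2) mod 3" "(y + 1 - a) mod 3 = ((y - a) mod 3 + 1) mod 3" for y by presburger+
  have lam_g: "\<And>x. lam g x = 0"
    subgoal for x using m[of x] unfolding lam_def g_def s by (elim disjE) (simp_all add: add.commute add.left_commute)
    done
  have fg: "f (a + int n) = g (a + int n) \<and> (a + int n + 1 \<le> b \<longrightarrow> f (a + int n + 1) = g (a + int n + 1))" if "a + int n \<le> b" for n
    using that
  proof (induction n)
    case (Suc n)
    have IH: "f (a + int n) = g (a + int n)" "f (a + int n + 1) = g (a + int n + 1)" using Suc by auto
    define y where "y = a + int n + 1"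
    have y: "f (y - 1) = g (y - 1)" "f y = g y" using IH by (simp_all add: y_def)
    have "f (y + 1) = g (y + 1)" if "y + 1 \<le> b"
    proof -
      have "lam f y = 0" by (rule z) (use that in \<open>auto simp: y_def\<close>)
      then have "f (y + 1) = f y + f (y - 1)" unfolding lam_def by (rule bit_sum3_zero)
      moreover have "g (y + 1) = g y + g (y - 1)" using lam_g[of y] unfolding lam_def by (rule bit_sum3_zero)
      ultimately show ?thesis using y by simp
    qed
    moreover have "a + int (Suc n) = y" by (simp add: y_def)
    ultimately show ?case using y by simp
  qed (simp add: g_def)
  have f_eq: "f y = g y" if "a \<le> y" "y \<le> b" for y
    using fg[of "nat (y - a)"] that by simp
  have "(\<forall>x. g x = 0) \<or> (\<exists>c. \<forall>x. g x = of_bool ((x + c) mod 3 \<noteq> 2))"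
  proof (cases "f a = 0 \<and> f (a + 1) = 0")
    case True then show ?thesis by (simp add: g_def)
  next
    case False
    define c where "c = (if f a = 0 then 2 - a else if f (a + 1) = 0 then 1 - a else - a)"
    have "g x = of_bool ((x + c) mod 3 \<noteq> 2)" for x
    proof -
      consider "f a = 0" "f (a + 1) = 1" "c = 2 - a" | "f a = 1" "f (a + 1) = 0" "c = 1 - a" | "f a = 1" "f (a + 1) = 1" "c = - a"
        using False unfolding c_def by (cases "f a"; cases "f (a + 1)") simp_all
      then show ?thesis
      proof cases
        case 1
        have "(x + c) mod 3 = ((x - a) mod 3 + 2) mod 3" unfolding 1 by presburger
        then show ?thesis using m[of x] 1(1,2) unfolding g_def by (elim disjE) simp_all
      next
        case 2
        have "(x + c) mod 3 = ((x - a) mod 3 + 1) mod 3" unfolding 2 by presburger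
        then show ?thesis using m[of x] 2(1,2) unfolding g_def by (elim disjE) simp_all
      next
        case 3
        have "(x + c) mod 3 = (x - a) mod 3" unfolding 3 by presburger
        then show ?thesis using m[of x] 3(1,2) unfolding g_def by (elim disjE) simp_all
      qed
    qed
    then show ?thesis by blast
  qed
  then show ?thesis using that[OF lam_g f_eq] by blast
qed

text \<open>The last condition singles out the opening: if the previous row were zero between
  \<open>a\<close> and \<open>b\<close> inclusive, the void would have opened earlier.\<close>

definition void :: "nat \<Rightarrow> int \<Rightarrow> int \<Rightarrow> bool" where
  "void T a b \<longleftrightarrow> 0 < T \<and> a < b \<and> pt T a = 1 \<and> pt T b = 1 \<and> (\<forall>y. a < y \<longrightarrow> y < b \<longrightarrow> pt T y = 0) \<and>
     (\<exists>y. a \<le> y \<and> y \<le> b \<and> pt (T - 1) y = 1)"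

lemma void_rows:
  assumes "void T a b" "a + int n < b - int n"
  shows "pt (T + n) (a + int n) = 1 \<and> pt (T + n) (b - int n) = 1 \<and>
    (\<forall>y. a + int n < y \<longrightarrow> y < b - int n \<longrightarrow> pt (T + n) y = 0)"
  using assms(2)
proof (induction n)
  case (Suc n)
  then show ?case by (auto simp: pt_Suc algebra_simps)
qed (use assms(1) in \<open>simp add: void_def\<close>)

text \<open>Followed backwards in time, a zero stretch whose previous row is also empty widens by
  one cell on each side. This ends, since row 0 has a single 1.\<close>

lemma void_above:
  assumes "a < b" "pt t a = 1" "pt t b = 1" "\<And>y. a < y \<Longrightarrow> y < b \<Longrightarrow> pt t y = 0"
  shows "\<exists>T n. t = T + n \<and> void T (a - int n) (b + int n)"
  using assms
proof (induction t arbitrary: a b)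
  case 0
  then show ?case by (auto simp: pt_def split: if_splits)
next
  case (Suc t)
  show ?case
  proof (cases "\<exists>y. a \<le> y \<and> y \<le> b \<and> pt t y = 1")
    case True
    then have "void (Suc t) a b" using Suc.prems by (auto simp: void_def)
    then show ?thesis by (intro exI[of _ "Suc t"] exI[of _ 0]) simp
  next
    case False
    then have z: "pt t y = 0" if "a \<le> y" "y \<le> b" for y using that by (metis bit_not_one_iff)
    have "pt t (a - 1) = 1" "pt t (b + 1) = 1"
      using Suc.prems(1-3) z by (simp_all add: pt_Suc)
    then obtain T n where "t = T + n" "void T (a - 1 - int n) (b + 1 + int n)"
      using Suc.IH[of "a - 1" "b + 1"] Suc.prems(1) z by fastforce
    then show ?thesis by (intro exI[of _ T] exI[of _ "Suc n"]) (simp add: algebra_simps)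
  qed
qed

lemma void_exists:
  assumes "pt t x = 0" "\<bar>x\<bar> \<le> int t"
  shows "\<exists>T n a b. t = T + n \<and> void T a b \<and> a + int n < x \<and> x < b - int n"
proof -
  let ?A = "{y. - int t \<le> y \<and> y < x \<and> pt t y = 1}" and ?B = "{y. y \<le> int t \<and> x < y \<and> pt t y = 1}"
  have fin: "finite ?A" "finite ?B"
    by (rule finite_subset[of _ "{- int t..x}"]; auto) (rule finite_subset[of _ "{x..int t}"]; auto)
  have "x \<noteq> int t" "x \<noteq> - int t" using assms(1) pt_edge[of t] by auto
  then have ne: "?A \<noteq> {}" "?B \<noteq> {}" using assms(2) pt_edge[of t] by (auto intro: exI[of _ "- int t"] exI[of _ "int t"])
  define a where "a = Max ?A"
  define b where "b = Min ?B"
  have a: "a \<in> ?A" "\<And>y. y \<in> ?A \<Longrightarrow> y \<le> a" using Max_in[OF fin(1) ne(1)] Max_ge[OF fin(1)] by (auto simp: a_def)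
  have b: "b \<in> ?B" "\<And>y. y \<in> ?B \<Longrightarrow> b \<le> y" using Min_in[OF fin(2) ne(2)] Min_le[OF fin(2)] by (auto simp: b_def)
  have "pt t y = 0" if "a < y" "y < b" for y
  proof (rule ccontr)
    assume "pt t y \<noteq> 0"
    then have "pt t y = 1" by simp
    moreover have "y \<noteq> x" using assms(1) \<open>pt t y = 1\<close> by auto
    ultimately have "y \<in> ?A \<or> y \<in> ?B" using a(1) b(1) that by simp linarith
    then show False using a(2)[of y] b(2)[of y] that by linarith
  qed
  then obtain T n where "t = T + n" "void T (a - int n) (b + int n)"
    using void_above[of a b t] a(1) b(1) by auto
  then show ?thesis using a(1) b(1)
    by (intro exI[of _ T] exI[of _ n] exI[of _ "a - int n"] exI[of _ "b + int n"]) auto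
qed

text \<open>The row before the opening is annihilated by \<open>lam\<close> over the void and is not
  zero there, so it reads 110110... and any two adjacent cells contain a 1. This row seals the void
  from above.\<close>

lemma void_roof:
  assumes "void T a b" "a < x" "x < b"
  shows "\<exists>y. \<bar>y - x\<bar> \<le> 1 \<and> pt (T - 1) y = 1"
proof -
  have T: "T = Suc (T - 1)" "a < b" using assms(1) by (simp_all add: void_def)
  have "lam (pt (T - 1)) y = 0" if "a < y" "y < b" for y
    using assms(1) that pt_Suc[of "T - 1" y] T(1) by (simp add: void_def lam_def)
  from extend_period3[OF T(2) this] obtain g where g: "\<And>y. a \<le> y \<Longrightarrow> y \<le> b \<Longrightarrow> pt (T - 1) y = g y"
    "(\<forall>x. g x = 0) \<or> (\<exists>c. \<forall>x. g x = of_bool ((x + c) mod 3 \<noteq> 2))" by metis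
  have "\<exists>y. g y = 1" using assms(1) g(1) by (auto simp: void_def)
  then obtain c where c: "\<And>x. g x = of_bool ((x + c) mod 3 \<noteq> 2)" using g(2) by fastforce
  have "(x + c) mod 3 \<noteq> 2 \<or> (x + 1 + c) mod 3 \<noteq> 2" by presburger
  then have "g x = 1 \<or> g (x + 1) = 1" by (auto simp: c)
  then show ?thesis using g(1)[of x] g(1)[of "x + 1"] assms(2,3) by (auto intro: exI[of _ x] exI[of _ "x + 1"])
qed

section \<open>Bounded components lie in voids\<close>

definition inside :: "nat \<Rightarrow> nat \<Rightarrow> int \<Rightarrow> int \<Rightarrow> int \<times> int \<Rightarrow> bool" where
  "inside \<rho> T a b p \<longleftrightarrow> int T \<le> snd p \<and> a + (snd p - int T) + int \<rho> < fst p \<and> fst p < b - (snd p - int T) - int \<rho>"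

lemma far: "p \<notin> Lam_nbhd \<rho> \<Longrightarrow> pt n y = 1 \<Longrightarrow> int \<rho> < \<bar>fst p - y\<bar> + \<bar>snd p - int n\<bar>"
proof (rule ccontr)
  assume a: "p \<notin> Lam_nbhd \<rho>" "pt n y = 1" "\<not> int \<rho> < \<bar>fst p - y\<bar> + \<bar>snd p - int n\<bar>"
  then have "(y, int n) \<in> Lam" by (simp add: Lam_iff)
  moreover have "l1_dist p (y, int n) \<le> int \<rho>" using a(3) by (simp add: l1_dist_def)
  ultimately show False using a(1) unfolding Lam_nbhd_def by blast
qed

text \<open>A step back across the opening would come within distance 1 of the roof, and a step
  sideways or forward would come within distance \<open>\<rho>\<close> of an edge, since the edges
  themselves close in at unit speed.\<close>

lemma inside_neighbour:
  assumes v: "void T a b" and \<rho>: "2 \<le> \<rho>" and p: "inside \<rho> T a b p" and out: "p \<notin> Lam_nbhd \<rho>" "q \<notin> Lam_nbhd \<rho>" and d: "l1_dist p q = 1"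
  shows "inside \<rho> T a b q"
proof -
  obtain x t where pq: "p = (x, t)" by (cases p)
  obtain x' t' where q: "q = (x', t')" by (cases q)
  have t: "int T \<le> t" "a + (t - int T) + int \<rho> < x" "x < b - (t - int T) - int \<rho>" using p by (simp_all add: pq inside_def)
  have d': "\<bar>x - x'\<bar> + \<bar>t - t'\<bar> = 1" using d by (simp add: l1_dist_def pq q)
  have "int T \<le> t'"
  proof (rule ccontr)
    assume "\<not> int T \<le> t'"
    then have tt: "t' = int T - 1" "t = int T" "x' = x" using d' t by auto
    obtain y where y: "\<bar>y - x\<bar> \<le> 1" "pt (T - 1) y = 1" using void_roof[OF v, of x] t tt \<rho> by auto
    have "int (T - 1) = int T - 1" using v by (auto simp: void_def)
    then show False using far[OF out(2) y(2)] y(1) \<rho> by (simp add: q tt)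
  qed
  define n where "n = nat (t' - int T)"
  have n: "t' = int T + int n" using \<open>int T \<le> t'\<close> by (simp add: n_def)
  have "\<bar>t - t'\<bar> \<le> 1" "\<bar>x - x'\<bar> \<le> 1" using d' by auto
  then have "a + int n < b - int n" using t n \<rho> by linarith
  from void_rows[OF v this] have "pt (T + n) (a + int n) = 1" "pt (T + n) (b - int n) = 1" by auto
  from far[OF out(2) this(1)] far[OF out(2) this(2)]
  have f: "int \<rho> < \<bar>x' - (a + int n)\<bar>" "int \<rho> < \<bar>x' - (b - int n)\<bar>" by (simp_all add: q n)
  have "a + int n \<le> x'" "x' \<le> b - int n" using d' t n \<rho> by linarith+
  then show ?thesis using f n \<open>int T \<le> t'\<close> by (simp add: inside_def q)
qed

text \<open>Outside the light cone of the triangle, going back in time never leads closer to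
  \<open>Lam\<close>. The component then contains a whole vertical ray, so bounded components lie
  within the cone.\<close>

lemma outside_dist:
  assumes "t < \<bar>x\<bar>" "(x, t) \<notin> Lam_nbhd \<rho>"
  shows "(x, t - int n) \<notin> Lam_nbhd \<rho>"
proof
  assume "(x, t - int n) \<in> Lam_nbhd \<rho>"
  then obtain y s where q: "pt (nat s) y = 1" "0 \<le> s" "\<bar>x - y\<bar> + \<bar>t - int n - s\<bar> \<le> int \<rho>"
    by (auto simp: Lam_nbhd_def l1_dist_def Lam_iff)
  have "\<bar>y\<bar> \<le> s" using pt_outside[of "nat s" y] q(1,2) by (cases "\<bar>y\<bar> \<le> s") auto
  then have le: "\<bar>x\<bar> - t \<le> int \<rho>" using q(2,3) by linarith
  show False
  proof (cases "t \<ge> 0")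
    case True
    then show False using far[OF assms(2) pt_edge(1)[of "nat t"]] far[OF assms(2) pt_edge(2)[of "nat t"]] le assms(1)
      by (cases "x \<ge> 0") auto
  next
    case False
    then show False using far[OF assms(2), of 0 0] le by (simp add: pt_def)
  qed
qed

lemma component_in_void:
  assumes K: "K \<in> nn_components (- Lam_nbhd \<rho>)" "finite K" and \<rho>: "2 \<le> \<rho>"
  obtains T a b where "void T a b" "\<And>p. p \<in> K \<Longrightarrow> inside \<rho> T a b p \<and> p \<notin> Lam_nbhd \<rho>"
proof -
  let ?S = "- Lam_nbhd \<rho>"
  let ?R = "{(p, q). p \<in> ?S \<and> q \<in> ?S \<and> l1_dist p q = 1}"
  obtain p where p: "p \<in> ?S" "K = ?R\<^sup>* `` {p}" using K(1) by (auto simp: nn_components_def elim!: quotientE)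
  obtain x t where xt: "p = (x, t)" by (cases p)
  have "\<bar>x\<bar> \<le> t"
  proof (rule ccontr)
    assume "\<not> \<bar>x\<bar> \<le> t"
    then have o: "(x, t - int n) \<notin> Lam_nbhd \<rho>" for n using outside_dist[of t x \<rho> n] p(1) xt by auto
    have "(p, (x, t - int n)) \<in> ?R\<^sup>*" for n
    proof (induction n)
      case (Suc n)
      have "((x, t - int n), (x, t - int (Suc n))) \<in> ?R" using o[of n] o[of "Suc n"] by (simp add: l1_dist_def)
      then show ?case using Suc by (meson rtrancl.rtrancl_into_rtrancl)
    qed (simp add: xt)
    then have "range (\<lambda>n. (x, t - int n)) \<subseteq> K" using p(2) by auto
    then have "finite (range (\<lambda>n. (x, t - int n)))" using K(2) finite_subset by blast
    moreover have "inj (\<lambda>n. (x, t - int n))" by (auto intro: injI)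
    ultimately show False using finite_imageD infinite_UNIV_nat by blast
  qed
  then obtain m where m: "t = int m" by (metis abs_ge_zero nonneg_int_cases order_trans)
  have "pt m x = 0"
  proof (rule ccontr)
    assume "pt m x \<noteq> 0"
    then show False using far[of p \<rho> m x] p(1) xt m by simp
  qed
  then obtain T n a b where v: "m = T + n" "void T a b" "a + int n < x" "x < b - int n"
    using void_exists[of m x] \<open>\<bar>x\<bar> \<le> t\<close> m by blast
  have "a + int n < b - int n" using v by linarith
  from void_rows[OF v(2) this] have "pt m (a + int n) = 1" "pt m (b - int n) = 1" unfolding v(1) by simp_all
  then have f: "int \<rho> < \<bar>x - (a + int n)\<bar> + \<bar>t - int m\<bar>" "int \<rho> < \<bar>x - (b - int n)\<bar> + \<bar>t - int m\<bar>"
    using far[of p \<rho> m] p(1) unfolding xt by force+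
  have ins: "inside \<rho> T a b p" using f v(1,3,4) m unfolding inside_def xt by simp
  have "inside \<rho> T a b q \<and> q \<notin> Lam_nbhd \<rho>" if "(p, q) \<in> ?R\<^sup>*" for q
    using that
  proof (induction rule: rtrancl_induct)
    case base then show ?case using p(1) ins by simp
  next
    case (step q r)
    have "q \<notin> Lam_nbhd \<rho>" "r \<notin> Lam_nbhd \<rho>" "l1_dist q r = 1" using step.hyps(2) by simp_all
    then show ?case using inside_neighbour[OF v(2) \<rho>, of q r] step.IH by blast
  qed
  then show ?thesis using that[OF v(2)] unfolding p(2) by blast
qed

section \<open>The rows before a wide void opens\<close>

definition comb :: "nat \<Rightarrow> row" where
  "comb k x = of_bool (2 ^ k dvd x \<and> (x div 2 ^ k) mod 3 \<noteq> 2)"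

text \<open>Between two multiples of \<open>2^k\<close> in time, the rows consist of the cones of
  the cells that are 1 at the earlier multiple. A zero stretch of this width that opened in between
  would show an edge of such a cone, or else be zero already one row earlier.\<close>

lemma void_multiple:
  assumes v: "void T a b" and big: "4 * 2 ^ k < b - a"
  shows "2 ^ k dvd T"
proof (rule ccontr)
  define J :: int where "J = 2 ^ k"
  define q where "q = T div 2 ^ k"
  define s where "s = T mod 2 ^ k"
  assume "\<not> 2 ^ k dvd T"
  then have s0: "0 < s" unfolding s_def dvd_eq_mod_eq_0 by blast
  have "s < 2 ^ k" by (simp add: s_def)
  then have "int s < int (2 ^ k)" by (simp only: of_nat_less_iff)
  then have s: "0 < s" "int s < J" using s0 by (simp_all add: J_def)
  have T: "T = s + 2 ^ k * q" by (simp add: s_def q_def)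
  have J: "0 < J" by (simp add: J_def)
  \<comment> \<open>\<open>(i - 1) * J\<close> is the first multiple of \<open>J\<close> beyond
    \<open>a\<close>; the width leaves room for the next two.\<close>
  define i where "i = a div J + 2"
  have i: "a < (i - 1) * J" "(i + 1) * J < b"
  proof -
    define d m where "d = a div J" and "m = a mod J"
    have "a = d * J + m" "0 \<le> m" "m < J" using J by (simp_all add: d_def m_def)
    moreover have "(i - 1) * J = d * J + J" "(i + 1) * J = d * J + 3 * J" by (simp_all add: i_def d_def algebra_simps)
    ultimately show "a < (i - 1) * J" "(i + 1) * J < b" using big unfolding J_def[symmetric] by linarith+
  qed
  let ?g = "pt q"
  let ?G = "pt (2 ^ k * q)"
  have G: "?G (m * J) = ?g m" "\<not> J dvd x \<Longrightarrow> ?G x = 0" for m x using J by (simp_all add: pt_scaled J_def)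
  have between: "\<not> J dvd x" if "m * J < x" "x < (m + 1) * J" for m x
  proof
    assume "J dvd x"
    then obtain n where "x = n * J" by (metis dvdE mult.commute)
    then have "m < n" "n < m + 1" using that J by (simp_all only: mult_less_cancel_right_pos)
    then show False by simp
  qed
  have zero: "pt T x = 0" if "(i - 1) * J \<le> x" "x \<le> (i + 1) * J" for x
    using v that i by (simp add: void_def)
  have row: "pt T = (lam ^^ s) ?G" unfolding T by (rule pt_add)
  \<comment> \<open>If exactly one of two neighbouring multiples of \<open>J\<close> carried a 1,
    the edge of its cone on the side of the other would be undisturbed and put a 1 into row
    \<open>T\<close> inside the void.\<close>
  have eq: "?g m = ?g (m + 1)" if m: "m = i - 1 \<or> m = i" for m
  proof -
    have bound: "(i - 1) * J \<le> m * J" "(m + 1) * J \<le> (i + 1) * J" using m J by (auto intro!: mult_right_mono)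
    have "(m + 1) * J = m * J + J" by (simp add: algebra_simps)
    have "pt T ((m + 1) * J - int s) = ?g (m + 1)" if "?g m = 0"
    proof -
      have "(lam ^^ s) ?G ((m + 1) * J - int s) = (lam ^^ s) (\<lambda>x. ?g (m + 1) * shift (- ((m + 1) * J)) (\<lambda>y. of_bool (y = 0)) x) ((m + 1) * J - int s)"
      proof (rule lam_pow_cong)
        fix y assume y: "\<bar>y - ((m + 1) * J - int s)\<bar> \<le> int s"
        show "?G y = ?g (m + 1) * shift (- ((m + 1) * J)) (\<lambda>y. of_bool (y = 0)) y"
        proof (cases "y = (m + 1) * J")
          case True then show ?thesis using G(1)[of "m + 1"] by (simp add: shift_def)
        next
          case False
          have "?G y = 0"
          proof (cases "y \<le> m * J")
            case True
            have "(m - 1) * J < y" using y s(2) by (simp add: algebra_simps)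
            then show ?thesis using True between[of "m - 1" y] G \<open>?g m = 0\<close> by (cases "y = m * J") auto
          next
            case 2: False
            then show ?thesis using False y between[of m y] G(2) by auto
          qed
          then show ?thesis using False by (simp add: shift_def)
        qed
      qed
      then show ?thesis using pt_edge(2)[of s] by (simp add: row lam_pow_mult lam_pow_shift) (simp add: shift_def pt_def)
    qed
    moreover have "pt T (m * J + int s) = ?g m" if "?g (m + 1) = 0"
    proof -
      have "(lam ^^ s) ?G (m * J + int s) = (lam ^^ s) (\<lambda>x. ?g m * shift (- (m * J)) (\<lambda>y. of_bool (y = 0)) x) (m * J + int s)"
      proof (rule lam_pow_cong)
        fix y assume y: "\<bar>y - (m * J + int s)\<bar> \<le> int s"
        show "?G y = ?g m * shift (- (m * J)) (\<lambda>y. of_bool (y = 0)) y"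
        proof (cases "y = m * J")
          case True then show ?thesis using G(1)[of m] by (simp add: shift_def)
        next
          case False
          have "?G y = 0"
          proof (cases "y \<ge> (m + 1) * J")
            case True
            have "y < (m + 1 + 1) * J" using y s(2) by (simp add: algebra_simps)
            then show ?thesis using True between[of "m + 1" y] G \<open>?g (m + 1) = 0\<close> by (cases "y = (m + 1) * J") auto
          next
            case 2: False
            then show ?thesis using False y between[of m y] G(2) by auto
          qed
          then show ?thesis using False by (simp add: shift_def)
        qed
      qed
      then show ?thesis using pt_edge(1)[of s] by (simp add: row lam_pow_mult lam_pow_shift) (simp add: shift_def pt_def)
    qed
    moreover have "pt T ((m + 1) * J - int s) = 0" "pt T (m * J + int s) = 0"
    proof -
      have "(i - 1) * J \<le> (m + 1) * J - int s" "(m + 1) * J - int s \<le> (i + 1) * J"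
          "(i - 1) * J \<le> m * J + int s" "m * J + int s \<le> (i + 1) * J"
        using s bound \<open>(m + 1) * J = m * J + J\<close> by linarith+
      then show "pt T ((m + 1) * J - int s) = 0" "pt T (m * J + int s) = 0" by (metis zero)+
    qed
    ultimately show ?thesis by (metis bit_not_one_iff)
  qed
  \<comment> \<open>After \<open>u\<close> more steps the next multiple of \<open>2^k\<close> is
    reached. The cell at \<open>i * J\<close> is still 0 there, but it is the sum of three equal
    values, so these are 0.\<close>
  define u where "u = 2 ^ k - s"
  have u: "u + s = 2 ^ k" using \<open>s < 2 ^ k\<close> by (simp add: u_def)
  then have "int u + int s = int (2 ^ k)" by (simp only: of_nat_add[symmetric])
  then have u: "u + s = 2 ^ k" "int u < J" using u s by (simp_all add: J_def)
  have "pt (2 ^ k * Suc q) (i * J) = (lam ^^ u) (pt T) (i * J)"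
    using pt_add[of u T] u(1) by (simp add: T add.assoc[symmetric])
  also have "\<dots> = (lam ^^ u) (\<lambda>_. 0) (i * J)"
    by (rule lam_pow_cong) (use u(2) in \<open>auto intro!: zero simp: algebra_simps\<close>)
  finally have "pt (Suc q) i = 0" using J by (simp add: pt_scaled J_def del: mult_Suc_right)
  then have g0: "?g (i - 1) = 0" "?g i = 0" "?g (i + 1) = 0"
    using eq[of i] eq[of "i - 1"] by (auto simp: pt_Suc)
  \<comment> \<open>With no sources nearby, row \<open>T - 1\<close> vanishes around
    \<open>i * J\<close>, against \<open>void_roof\<close>.\<close>
  have "pt (T - 1) x = 0" if x: "\<bar>x - i * J\<bar> \<le> 1" for x
  proof -
    have "pt (T - 1) x = (lam ^^ (s - 1)) ?G x" using s(1) by (simp add: T pt_add[symmetric])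
    also have "(lam ^^ (s - 1)) ?G x = (lam ^^ (s - 1)) (\<lambda>_. 0) x"
    proof (rule lam_pow_cong)
      fix y assume "\<bar>y - x\<bar> \<le> int (s - 1)"
      then have y: "(i - 1) * J < y" "y < (i + 1) * J" using x s by (auto simp: algebra_simps)
      then show "?G y = 0" using between[of "i - 1" y] between[of i y] G g0 by (cases "y = i * J") (auto, force)
    qed
    finally show ?thesis by simp
  qed
  moreover have "a < i * J" "i * J < b" using i J by (simp_all add: algebra_simps)
  ultimately show False using void_roof[OF v] by fastforce
qed

text \<open>Row \<open>T - 2^k\<close> is a spread-out row \<open>r\<close>, and over the void
  \<open>lam\<close> annihilates row \<open>r\<close>. The zero solution is excluded because it
  would keep the void empty one row before its opening.\<close>

lemma void_comb:
  assumes v: "void T a b" and big: "4 * 2 ^ k < b - a"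
  shows "2 ^ k \<le> T \<and> (\<exists>c. \<forall>x. a \<le> x \<longrightarrow> x \<le> b \<longrightarrow> pt (T - 2 ^ k) x = comb k (x + c))"
proof -
  define J :: int where "J = 2 ^ k"
  have J: "0 < J" by (simp add: J_def)
  obtain q where "T = 2 ^ k * q" using void_multiple[OF assms] by auto
  moreover have "0 < T" using v by (simp add: void_def)
  ultimately obtain r where T: "T = 2 ^ k * Suc r" by (cases q) auto
  then have le: "2 ^ k \<le> T" and Tr: "T - 2 ^ k = 2 ^ k * r" by simp_all
  have ab: "pt T a = 1" "pt T b = 1" "a < b" using v by (simp_all add: void_def)
  obtain a' b' where a': "a = J * a'" and b': "b = J * b'"
    using ab(1,2) unfolding T pt_scaled J_def by (auto split: if_splits elim!: dvdE)
  have "a' < b'" using ab(3) J by (simp add: a' b')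
  have "lam (pt r) y = 0" if "a' < y" "y < b'" for y
  proof -
    have "a < J * y" "J * y < b" using that J by (simp_all add: a' b')
    then have "pt T (J * y) = 0" using v by (simp add: void_def)
    then show ?thesis using J pt_Suc[of r y] by (simp add: T pt_scaled J_def lam_def del: mult_Suc_right)
  qed
  from extend_period3[OF \<open>a' < b'\<close> this] obtain g where g: "\<And>y. a' \<le> y \<Longrightarrow> y \<le> b' \<Longrightarrow> pt r y = g y"
    "(\<forall>x. g x = 0) \<or> (\<exists>c. \<forall>x. g x = of_bool ((x + c) mod 3 \<noteq> 2))" by metis
  have row: "pt (T - 2 ^ k) x = (if J dvd x then pt r (x div J) else 0)" for x by (simp add: Tr pt_scaled J_def)
  have "\<not> (\<forall>x. g x = 0)"
  proof
    assume z: "\<forall>x. g x = 0"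
    have *: "pt (T - 2 ^ k) x = 0" if "a - J < x" "x < b + J" for x
    proof (cases "J dvd x")
      case True
      then obtain y where y: "x = J * y" by auto
      then have "J * (a' - 1) < J * y" "J * y < J * (b' + 1)" using that by (simp_all add: a' b' algebra_simps)
      then have "a' - 1 < y" "y < b' + 1" using J by (simp_all only: mult_less_cancel_left_pos)
      then show ?thesis using row[of x] y J g(1)[of y] z by simp
    qed (simp add: row)
    have pos: "0 < (2::nat) ^ k" by simp
    have "pt (T - 1) y = 0" if "a \<le> y" "y \<le> b" for y
    proof -
      have "pt (T - 1) y = (lam ^^ (2 ^ k - 1)) (pt (T - 2 ^ k)) y" using le pos by (simp add: pt_add[symmetric] del: zero_less_power)
      also have "(lam ^^ (2 ^ k - 1)) (pt (T - 2 ^ k)) y = (lam ^^ (2 ^ k - 1)) (\<lambda>_. 0) y"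
      proof (rule lam_pow_cong)
        fix x assume "\<bar>x - y\<bar> \<le> int (2 ^ k - 1)"
        then have "\<bar>x - y\<bar> < J" using pos by (simp add: J_def of_nat_diff)
        then show "pt (T - 2 ^ k) x = 0" using that by (intro *) auto
      qed
      finally show ?thesis by simp
    qed
    then show False using v by (force simp: void_def)
  qed
  then obtain c where c: "\<And>x. g x = of_bool ((x + c) mod 3 \<noteq> 2)" using g(2) by auto
  have "pt (T - 2 ^ k) x = comb k (x + J * c)" if x: "a \<le> x" "x \<le> b" for x
  proof (cases "J dvd x")
    case True
    then obtain y where y: "x = J * y" by auto
    have "a' \<le> y" "y \<le> b'" using x J by (simp_all add: y a' b')
    then have "pt (T - 2 ^ k) x = of_bool ((y + c) mod 3 \<noteq> 2)" using row[of x] y J g(1)[of y] c by simp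
    moreover have "x + J * c = J * (y + c)" by (simp add: y algebra_simps)
    ultimately show ?thesis using J by (simp add: comb_def flip: J_def)
  next
    case False
    then have "\<not> J dvd x + J * c" using dvd_add_left_iff[of J "J * c" x] by simp
    then show ?thesis using False row[of x] by (simp add: comb_def flip: J_def)
  qed
  then show ?thesis using le by blast
qed

definition comb_row :: "nat \<Rightarrow> nat \<Rightarrow> row" where
  "comb_row k j = (lam ^^ (2 ^ k - j)) (comb k)"

lemma comb_row_Suc: "j < 2 ^ k \<Longrightarrow> lam (comb_row k (Suc j)) = comb_row k j"
proof -
  assume "j < 2 ^ k"
  then have "2 ^ k - j = Suc (2 ^ k - Suc j)" by simp
  then show ?thesis by (simp add: comb_row_def)
qed

lemma comb_row_0: "comb_row k 0 = (\<lambda>_. 0)"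
proof
  fix x :: int
  define J :: int where "J = 2 ^ k"
  have J: "0 < J" by (simp add: J_def)
  have "comb_row k 0 x = comb k (x - J) + comb k x + comb k (x + J)"
    using lam_pow_two_power[of k "comb k" x] by (simp add: comb_row_def J_def)
  also have "\<dots> = 0"
  proof (cases "J dvd x")
    case True
    then obtain y where y: "x = J * y" by auto
    have "x - J = J * (y - 1)" "x + J = J * (y + 1)" by (simp_all add: y algebra_simps)
    moreover have "y mod 3 = 0 \<or> y mod 3 = 1 \<or> y mod 3 = 2" by presburger
    moreover have "(y - 1) mod 3 = (y mod 3 + 2) mod 3" "(y + 1) mod 3 = (y mod 3 + 1) mod 3" by presburger+
    ultimately show ?thesis using J by (elim disjE) (simp_all add: comb_def y flip: J_def)
  next
    case False
    then have "\<not> J dvd x - J" "\<not> J dvd x + J" by (simp_all add: dvd_diff_left_iff)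
    then show ?thesis using False by (simp add: comb_def flip: J_def)
  qed
  finally show "comb_row k 0 x = 0" .
qed

text \<open>Only the tooth at \<open>2^k\<close> is within reach of this cell, which lies on the
  right edge of its cone; the next tooth position is a gap. So the row just before the opening is
  not zero.\<close>

lemma comb_row_1: "comb_row k 1 (2 ^ (k + 1) - 1) = 1"
proof -
  define J :: int where "J = 2 ^ k"
  have J: "0 < J" by (simp add: J_def)
  let ?n = "2 ^ k - 1 :: nat"
  have n: "int ?n = J - 1" by (simp add: J_def of_nat_diff)
  have "comb_row k 1 (J + int ?n) = (lam ^^ ?n) (shift (- J) (\<lambda>y. of_bool (y = 0))) (J + int ?n)"
    unfolding comb_row_def
  proof (rule lam_pow_cong)
    fix y assume "\<bar>y - (J + int ?n)\<bar> \<le> int ?n"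
    then have y: "J \<le> y" "y < 3 * J" using n by auto
    show "comb k y = shift (- J) (\<lambda>y. of_bool (y = 0)) y"
    proof (cases "J dvd y")
      case True
      then obtain m where m: "y = J * m" by auto
      have "J * 1 \<le> J * m" "J * m < J * 3" using y unfolding m by linarith+
      then have "1 \<le> m" "m < 3" unfolding mult_less_cancel_left_pos[OF J] mult_le_cancel_left_pos[OF J] .
      then have "m = 1 \<or> m = 2" by auto
      then show ?thesis using J by (elim disjE) (simp_all add: m comb_def shift_def flip: J_def)
    next
      case False
      then have "y \<noteq> J" by auto
      then show ?thesis using False by (simp add: comb_def shift_def flip: J_def)
    qed
  qed
  also have "\<dots> = 1" using pt_edge(1)[of ?n] by (simp only: lam_pow_shift) (simp add: shift_def pt_def)
  finally show ?thesis using n by (simp add: J_def)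
qed

section \<open>Replication\<close>

fun lam_pre :: "row \<Rightarrow> nat \<Rightarrow> bit" where
  "lam_pre f 0 = 0"
| "lam_pre f (Suc 0) = 0"
| "lam_pre f (Suc (Suc n)) = f (int n + 1) + lam_pre f (Suc n) + lam_pre f n"

lemma lam_surj: "\<exists>g. lam g = f"
proof
  let ?f' = "\<lambda>x. f (1 - x)"
  define g where "g x = (if x \<ge> 0 then lam_pre f (nat x) else lam_pre ?f' (nat (1 - x)))" for x
  have g0: "g (int n) = lam_pre f n" for n by (simp add: g_def)
  have g1: "g (1 - int n) = lam_pre ?f' n" for n
    by (cases "n = 0 \<or> n = 1") (auto simp: g_def)
  show "lam g = f"
  proof
    fix x :: int
    show "lam g x = f x"
    proof (cases "x \<ge> 1")
      case True
      define n where "n = nat (x - 1)"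
      have "x - 1 = int n" "x = int (Suc n)" "x + 1 = int (Suc (Suc n))" using True by (simp_all add: n_def)
      then show ?thesis unfolding lam_def by (simp only: g0) (simp add: add.commute add.left_commute)
    next
      case False
      define n where "n = nat (- x)"
      have "x + 1 = 1 - int n" "x = 1 - int (Suc n)" "x - 1 = 1 - int (Suc (Suc n))" using False by (simp_all add: n_def)
      then show ?thesis unfolding lam_def by (simp only: g1) (simp add: add.commute add.left_commute)
    qed
  qed
qed

text \<open>\<open>resolved_void\<close> speaks about sequences that go back forever, while the rows
  attached to a seed go back only \<open>2^k\<close> steps; surjectivity of \<open>lam\<close>
  supplies the rest.\<close>

lemma lam_extend:
  assumes "\<And>j. j < n \<Longrightarrow> lam (V (Suc j)) = V j"
  obtains W where "\<And>j. lam (W (Suc j)) = W j" "\<And>j. j \<le> n \<Longrightarrow> W j = V j"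
proof -
  define pre where "pre f = (SOME g. lam g = f)" for f
  have pre: "lam (pre f) = f" for f unfolding pre_def by (rule someI_ex[OF lam_surj])
  define W where "W j = (if j \<le> n then V j else (pre ^^ (j - n)) (V n))" for j
  have "lam (W (Suc j)) = W j" for j
  proof (cases "j < n")
    case False
    then have "Suc j - n = Suc (j - n)" by simp
    then show ?thesis using False by (cases "j = n") (simp_all add: W_def pre)
  qed (simp add: W_def assms)
  then show ?thesis using that[of W] by (simp add: W_def)
qed

section \<open>Superposition over the seed\<close>

definition seed_row :: "nat \<Rightarrow> nat \<Rightarrow> row \<Rightarrow> nat \<Rightarrow> row" where
  "seed_row k L o1 j x = (\<Sum>i\<in>{0..int L}. o1 i * comb_row k j (x - i))"

lemma seed_row_eq: "seed_row k L o1 j = (\<lambda>x. \<Sum>i\<in>{0..int L}. o1 i * shift (- i) (comb_row k j) x)"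
  by (simp add: seed_row_def shift_def fun_eq_iff)

lemma lam_seed_row: "lam (seed_row k L o1 j) = (\<lambda>x. \<Sum>i\<in>{0..int L}. o1 i * shift (- i) (lam (comb_row k j)) x)"
  by (simp only: seed_row_eq lam_sum lam_mult lam_shift)

lemma seed_row_Suc: "j < 2 ^ k \<Longrightarrow> lam (seed_row k L o1 (Suc j)) = seed_row k L o1 j"
  unfolding lam_seed_row by (simp add: comb_row_Suc seed_row_eq)

lemma seed_row_0: "seed_row k L o1 0 = (\<lambda>_. 0)"
  by (simp add: seed_row_def comb_row_0 fun_eq_iff)

lemma seed_expand:
  assumes "\<And>x. x \<notin> {0..int L} \<Longrightarrow> o1 x = (0::bit)"
  shows "o1 = (\<lambda>x. \<Sum>i\<in>{0..int L}. o1 i * shift (- i) (\<lambda>y. of_bool (y = 0)) x)"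
proof
  fix x
  have "(\<Sum>i\<in>{0..int L}. o1 i * shift (- i) (\<lambda>y. of_bool (y = 0)) x) = (\<Sum>i\<in>{0..int L}. if x = i then o1 i else 0)"
    by (intro sum.cong) (auto simp: shift_def)
  also have "\<dots> = o1 x" using assms[of x] by (simp only: sum.delta'[OF finite_atLeastAtMost_int]) auto
  finally show "o1 x = (\<Sum>i\<in>{0..int L}. o1 i * shift (- i) (\<lambda>y. of_bool (y = 0)) x)" by simp
qed

lemma lam_pow_seed:
  assumes "\<And>x. x \<notin> {0..int L} \<Longrightarrow> o1 x = (0::bit)"
  shows "(lam ^^ n) o1 x = (\<Sum>i\<in>{0..int L}. o1 i * pt n (x - i))"
proof -
  have "(lam ^^ n) o1 = (lam ^^ n) (\<lambda>x. \<Sum>i\<in>{0..int L}. o1 i * shift (- i) (\<lambda>y. of_bool (y = 0)) x)"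
    using seed_expand[of L o1, OF assms] by (rule arg_cong)
  also have "\<dots> = (\<lambda>x. \<Sum>i\<in>{0..int L}. o1 i * shift (- i) (pt n) x)"
    by (simp only: lam_pow_sum lam_pow_mult lam_pow_shift pt_def)
  finally show ?thesis by (simp add: shift_def)
qed

text \<open>By linearity each 1 of the seed, at \<open>i\<close> in \<open>[0, L]\<close>,
  contributes the same void displaced by \<open>i\<close>; this costs the margin \<open>L\<close> on
  the left.\<close>

lemma seed_row_in_void:
  assumes v: "void T a b" and big: "4 * 2 ^ k < b - a" and j: "j \<le> 2 ^ k"
    and o1: "\<And>x. x \<notin> {0..int L} \<Longrightarrow> o1 x = (0::bit)"
    and c: "\<And>x. a \<le> x \<Longrightarrow> x \<le> b \<Longrightarrow> pt (T - 2 ^ k) x = comb k (x + c)"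
    and T: "2 ^ k \<le> T"
    and x: "a + 2 ^ k + int L \<le> x" "x \<le> b - 2 ^ k"
  shows "(lam ^^ (T - j)) o1 x = seed_row k L o1 j (x + c)"
proof -
  have "pt (T - j) (x - i) = comb_row k j (x + c - i)" if i: "i \<in> {0..int L}" for i
  proof -
  have "int j \<le> int (2 ^ k)" using j by (simp only: of_nat_le_iff)
  then have J: "int (2 ^ k - j) \<le> 2 ^ k" by simp
  have "T - j = (2 ^ k - j) + (T - 2 ^ k)" using j T by simp
  then have "pt (T - j) (x - i) = (lam ^^ (2 ^ k - j)) (pt (T - 2 ^ k)) (x - i)" by (simp only: pt_add)
  also have "\<dots> = (lam ^^ (2 ^ k - j)) (shift c (comb k)) (x - i)"
  proof (rule lam_pow_cong)
    fix y assume "\<bar>y - (x - i)\<bar> \<le> int (2 ^ k - j)"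
    moreover have "0 \<le> i" "i \<le> int L" using i by auto
    ultimately have "a \<le> y" "y \<le> b" using J x by linarith+
    then show "pt (T - 2 ^ k) y = shift c (comb k) y" by (simp add: c shift_def)
  qed
  also have "\<dots> = comb_row k j (x + c - i)"
    by (simp only: lam_pow_shift comb_row_def) (simp add: shift_def algebra_simps)
  finally show ?thesis .
  qed
  then have "(\<Sum>i\<in>{0..int L}. o1 i * pt (T - j) (x - i)) = seed_row k L o1 j (x + c)"
    unfolding seed_row_def by (intro sum.cong refl) simp
  moreover have "(lam ^^ (T - j)) o1 x = (\<Sum>i\<in>{0..int L}. o1 i * pt (T - j) (x - i))" by (rule lam_pow_seed[OF o1])
  ultimately show ?thesis by simp
qed

lemma nz_two_eq: "ones \<xi> x = 0 \<Longrightarrow> states \<xi> \<Longrightarrow> \<xi> x = two (nz \<xi>) x"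
  by (force simp: states_def two_def ones_def nz_def)

text \<open>Here \<open>v\<close> is the number of rows before the opening in which the superposed
  ones have already cancelled. The constants \<open>A\<close> and \<open>C\<close> may depend on the
  void, as each component may carry its own translate of the ether.\<close>

lemma filled_void:
  fixes k L v :: nat and p c :: int
  defines "J \<equiv> 2 ^ k :: int"
  assumes \<xi>: "states \<xi>" "\<And>x. x \<notin> {0..int L} \<Longrightarrow> ones \<xi> x = 0"
    and k: "v + 16 \<le> 2 ^ k"
    and W: "\<And>j. j \<le> 16 \<Longrightarrow> V j = shift p (seed_row k L (ones \<xi>) (v + j))"
    and V0: "V 0 = (\<lambda>_. 0)" and V1: "\<And>x. V 1 x = of_bool (x mod 3 \<noteq> 2)"
    and res: "resolve (map (\<lambda>j. (V (Suc j) 0 = 1, V (Suc j) 1 = 1)) [1..<16]) root_row root_items (replicate 16 False) = Some r"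
    and v: "void T a b" and big: "4 * J < b - a"
  obtains A C where "\<And>x t. int T + J \<le> t \<Longrightarrow> a + int L + 5 * J + (t - int T) \<le> x \<Longrightarrow> x \<le> b - 5 * J - (t - int T) \<Longrightarrow>
    (piggyback_step ^^ nat t) \<xi> x = two ((lam ^^ nat ((t + C) mod 16)) (rowY r)) (x + A)"
proof -
  obtain c where T: "2 ^ k \<le> T" and c: "\<And>x. a \<le> x \<Longrightarrow> x \<le> b \<Longrightarrow> pt (T - 2 ^ k) x = comb k (x + c)"
    using void_comb[OF v] big unfolding J_def by metis
  define d where "d = c - p"
  have J16: "16 + int v \<le> J" using of_nat_mono[OF k, where 'a = int] by (simp add: J_def)
  have V_Suc: "lam (V (Suc j)) = V j" if "j < 16" for j
    using W[of j] W[of "Suc j"] that k by (simp add: lam_shift seed_row_Suc)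
  obtain X where X: "\<And>j. lam (X (Suc j)) = X j" "\<And>j. j \<le> 16 \<Longrightarrow> X j = V j" using lam_extend[of 16 V, OF V_Suc] by metis
  define t0 where "t0 = T - (v + 16)"
  define \<xi>0 where "\<xi>0 = (piggyback_step ^^ t0) \<xi>"
  have t0: "int t0 = int T - int v - 16" using T k by (simp add: t0_def)
  have \<xi>0: "states \<xi>0" "ones \<xi>0 = (lam ^^ t0) (ones \<xi>)" unfolding \<xi>0_def by (rule piggyback_pow_ones[OF \<xi>(1)])+
  have V16: "ones \<xi>0 x = V 16 (x + d)" if "a + J + int L \<le> x" "x \<le> b - J" for x
    using seed_row_in_void[OF v big[unfolded J_def] k \<xi>(2) c T that[unfolded J_def]] W[of 16]
    by (simp add: \<xi>0(2) t0_def d_def shift_def algebra_simps)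
  \<comment> \<open>\<open>resolved_void\<close> concerns the whole line, but the known pattern only
    covers a window. Outside of it the configuration is replaced by the bare pattern.\<close>
  define \<zeta> where "\<zeta> x = (if a + J + int L \<le> x - d \<and> x - d \<le> b - J then \<xi>0 (x - d) else if V 16 x = 1 then 1 else 0)" for x
  have "states \<zeta>" using \<xi>0(1) by (simp add: \<zeta>_def states_def)
  moreover have "ones \<zeta> x = V 16 x" for x
  proof (cases "a + J + int L \<le> x - d \<and> x - d \<le> b - J")
    case True then show ?thesis using V16[of "x - d"] by (simp add: ones_def \<zeta>_def)
  next
    case False
    then have "\<zeta> x = (if V 16 x = 1 then 1 else 0)" unfolding \<zeta>_def by (rule if_not_P)
    then show ?thesis by (simp add: ones_def)
  qed
  ultimately have \<zeta>: "states \<zeta>" "ones \<zeta> = X 16" using X(2) by (simp_all add: fun_eq_iff)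
  have resX: "resolve (map (\<lambda>j. (X (Suc j) 0 = 1, X (Suc j) 1 = 1)) [1..<16]) root_row root_items (replicate 16 False) = Some r"
  proof -
    have "map (\<lambda>j. (X (Suc j) 0 = 1, X (Suc j) 1 = 1)) [1..<16] = map (\<lambda>j. (V (Suc j) 0 = 1, V (Suc j) 1 = 1)) [1..<16]"
      by (intro map_cong) (simp_all add: X(2))
    then show ?thesis using res by (simp only:)
  qed
  have "states ((piggyback_step ^^ 32) \<zeta>) \<and> ones ((piggyback_step ^^ 32) \<zeta>) = (\<lambda>_. 0) \<and> nz ((piggyback_step ^^ 32) \<zeta>) = lam (rowY r)"
    by (rule resolved_void[OF X(1) _ _ resX \<zeta>]) (use V1 in \<open>simp_all add: X(2) V0\<close>)
  then have Z: "(piggyback_step ^^ 32) \<zeta> = two (lam (rowY r))" using two_nz by metis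
  \<comment> \<open>Time \<open>T + J\<close> is reached after \<open>m\<close> steps from
    \<open>t0\<close>, and \<open>m \<le> 2 * J\<close>. The Piggyback rule has radius two, so the
    replacement spoils at most \<open>4 * J\<close> further cells on each side; with the margin
    \<open>J\<close> of the window this makes \<open>5 * J\<close>.\<close>
  define m where "m = nat J + v + 16"
  have m: "int m = J + int v + 16" "32 \<le> m" using J16 by (simp_all add: m_def)
  have "(piggyback_step ^^ m) \<zeta> = (piggyback_step ^^ (m - 32)) ((piggyback_step ^^ 32) \<zeta>)"
    using m(2) by (simp flip: funpow_add[THEN fun_cong, unfolded o_apply])
  also have "\<dots> = two ((lam ^^ (m - 31)) (rowY r))"
  proof -
    have "m - 31 = Suc (m - 32)" using m(2) by simp
    then show ?thesis by (simp only: Z piggyback_pow_two) (simp add: funpow_swap1)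
  qed
  finally have Zm: "(piggyback_step ^^ m) \<zeta> = two ((lam ^^ (m - 31)) (rowY r))" .
  have Tm: "t0 + m = T + nat J" using t0 m(1) J16 by linarith
  have base: "(piggyback_step ^^ (T + nat J)) \<xi> x = two ((lam ^^ (m - 31)) (rowY r)) (x + d)"
    if "a + int L + 5 * J \<le> x" "x \<le> b - 5 * J" for x
  proof -
    have "(piggyback_step ^^ (T + nat J)) \<xi> x = (piggyback_step ^^ m) \<xi>0 x"
      unfolding \<xi>0_def Tm[symmetric] by (simp only: add.commute[of t0] funpow_add o_apply)
    also have "\<dots> = (piggyback_step ^^ m) (\<lambda>x. \<zeta> (x + d)) x"
    proof (rule piggyback_step_cong)
      fix y assume "\<bar>y - x\<bar> \<le> 2 * int m"
      then have "a + J + int L \<le> y" "y \<le> b - J" using that m J16 by linarith+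
      then show "\<xi>0 y = \<zeta> (y + d)" by (simp add: \<zeta>_def)
    qed
    finally show ?thesis by (simp only: piggyback_pow_shift Zm)
  qed
  have ones_zero: "ones ((piggyback_step ^^ (T + n)) \<xi>) x = 0" if "a + int n + int L < x" "x < b - int n" for n x
  proof -
    have "pt (T + n) (x - i) = 0" if "i \<in> {0..int L}" for i
    proof -
      have "a + int n < x - i" "x - i < b - int n" using \<open>a + int n + int L < x\<close> \<open>x < b - int n\<close> that by auto
      then show ?thesis using void_rows[OF v, of n] by force
    qed
    then have "(\<Sum>i\<in>{0..int L}. ones \<xi> i * pt (T + n) (x - i)) = 0" by (simp add: sum.neutral)
    moreover have "(lam ^^ (T + n)) (ones \<xi>) x = (\<Sum>i\<in>{0..int L}. ones \<xi> i * pt (T + n) (x - i))"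
      by (rule lam_pow_seed[OF \<xi>(2)])
    ultimately show ?thesis by (simp only: piggyback_pow_ones(2)[OF \<xi>(1)])
  qed
  \<comment> \<open>From now on there are no ones nearby and only the additive rule acts. It has
    radius one, so the margin moves exactly as fast as the edges of the void.\<close>
  have main: "(piggyback_step ^^ (T + nat J + n)) \<xi> x = two ((lam ^^ (m - 31 + n)) (rowY r)) (x + d)"
    if "a + int L + 5 * J + int n \<le> x" "x \<le> b - 5 * J - int n" for n x
    using that
  proof (induction n arbitrary: x)
    case 0 then show ?case using base by simp
  next
    case (Suc n)
    let ?\<eta> = "(piggyback_step ^^ (T + nat J + n)) \<xi>"
    let ?R = "(lam ^^ (m - 31 + n)) (rowY r)"
    have st: "states ?\<eta>" by (rule piggyback_pow_ones(1)[OF \<xi>(1)])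
    have o: "ones (piggyback_step ?\<eta>) y = 0" if "\<bar>y - x\<bar> \<le> 1" for y
    proof -
      have "ones ((piggyback_step ^^ (T + (nat J + Suc n))) \<xi>) y = 0"
        by (rule ones_zero) (use that Suc.prems J16 in auto)
      then show ?thesis by (simp add: add.assoc)
    qed
    have IH: "nz ?\<eta> y = shift d ?R y" if "\<bar>y - x\<bar> \<le> 1" for y
    proof -
      have "?\<eta> y = two ?R (y + d)" by (rule Suc.IH) (use that Suc.prems in auto)
      then show ?thesis using fun_cong[OF states_two(3)[of ?R], of "y + d"] by (simp add: nz_def shift_def)
    qed
    have "nz (piggyback_step ?\<eta>) x = lam (nz ?\<eta>) x" by (rule piggyback_step_nz(2)[OF st]) (auto intro!: o)
    also have "\<dots> = lam (shift d ?R) x" using IH by (simp add: lam_def)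
    also have "\<dots> = lam ?R (x + d)" by (simp add: lam_shift) (simp add: shift_def)
    finally have "nz (piggyback_step ?\<eta>) x = lam ?R (x + d)" .
    moreover have "piggyback_step ?\<eta> x = two (nz (piggyback_step ?\<eta>)) x"
      by (intro nz_two_eq o piggyback_step_ones(2)[OF st]) simp
    ultimately show ?case by (simp add: two_def)
  qed
  show ?thesis
  proof (rule that[of "- int t0 - 31" d])
    fix x t
    assume t: "int T + J \<le> t" and x: "a + int L + 5 * J + (t - int T) \<le> x" "x \<le> b - 5 * J - (t - int T)"
    define n where "n = nat (t - int T - J)"
    have n: "t = int T + J + int n" using t by (simp add: n_def)
    have nt: "nat t = T + nat J + n" using n J16 by linarith
    have "(piggyback_step ^^ nat t) \<xi> x = two ((lam ^^ (m - 31 + n)) (rowY r)) (x + d)"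
      unfolding nt by (rule main) (use x n J16 in auto)
    also have "(lam ^^ (m - 31 + n)) (rowY r) = (lam ^^ ((m - 31 + n) mod 16)) (rowY r)" by (rule lam_mod_16) (rule rowY_periodic)
    also have "(m - 31 + n) mod 16 = nat ((t + (- int t0 - 31)) mod 16)"
    proof -
      have "t + (- int t0 - 31) = int (m - 31 + n)" using m t0 n by simp
      moreover have "int ((m - 31 + n) mod 16) = int (m - 31 + n) mod 16" by (simp only: zmod_int of_nat_numeral)
      ultimately show ?thesis by (metis nat_int)
    qed
    finally show "(piggyback_step ^^ nat t) \<xi> x = two ((lam ^^ nat ((t + (- int t0 - 31)) mod 16)) (rowY r)) (x + d)" .
  qed
qed

lemma replicator_of_void:
  assumes big: "8 * J + int L \<le> int \<rho>" "2 \<le> J"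
    and f: "\<And>T a b. void T a b \<Longrightarrow> 4 * J < b - a \<Longrightarrow>
      \<exists>\<eta>'. ether_equiv \<eta> \<eta>' \<and> (\<forall>x t. int T + J \<le> t \<longrightarrow> a + int L + 5 * J + (t - int T) \<le> x \<longrightarrow> x \<le> b - 5 * J - (t - int T) \<longrightarrow>
        (piggyback_step ^^ nat t) \<xi> x = \<eta>' x t)"
  shows "replicator (piggyback_evol \<xi>) \<eta>"
  unfolding replicator_def
proof (intro exI[of _ \<rho>] ballI impI)
  fix K assume K: "K \<in> nn_components (- Lam_nbhd \<rho>)" "finite K"
  have "2 \<le> \<rho>" using big by linarith
  from component_in_void[OF K this] obtain T a b where v: "void T a b"
    and ins: "\<And>p. p \<in> K \<Longrightarrow> inside \<rho> T a b p \<and> p \<notin> Lam_nbhd \<rho>" by metis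
  have T: "int (T - 1) = int T - 1" using v by (auto simp: void_def)
  have pos: "int T + J \<le> t \<and> a + int L + 5 * J + (t - int T) \<le> x \<and> x \<le> b - 5 * J - (t - int T)" if "(x, t) \<in> K" for x t
  proof -
    have i: "int T \<le> t" "a + (t - int T) + int \<rho> < x" "x < b - (t - int T) - int \<rho>" "(x, t) \<notin> Lam_nbhd \<rho>"
      using ins[OF that] by (simp_all add: inside_def)
    have "a < x" "x < b" using i(1,2,3) by linarith+
    \<comment> \<open>Distance from the roof forces \<open>t\<close> beyond \<open>T\<close> by more
      than \<open>\<rho> - 2\<close>, hence beyond the first \<open>J\<close> rows of the
      void.\<close>
    then obtain y where y: "\<bar>y - x\<bar> \<le> 1" "pt (T - 1) y = 1" using void_roof[OF v] by blast
    have "int \<rho> < \<bar>x - y\<bar> + \<bar>t - int (T - 1)\<bar>" using far[OF i(4) y(2)] by simp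
    then have "int \<rho> < 1 + (t - int T + 1)" using y(1) i(1) T by linarith
    then show ?thesis using i big by linarith
  qed
  show "filled (piggyback_evol \<xi>) \<eta> K"
  proof (cases "K = {}")
    case True
    then show ?thesis by (auto simp: filled_def ether_equiv_def intro!: exI[of _ "\<eta>"] exI[of _ 0])
  next
    case False
    then obtain x t where "(x, t) \<in> K" by auto
    from pos[OF this] have "4 * J < b - a" using big by linarith
    from f[OF v this] obtain \<eta>' where \<eta>': "ether_equiv \<eta> \<eta>'"
      "\<And>x t. int T + J \<le> t \<Longrightarrow> a + int L + 5 * J + (t - int T) \<le> x \<Longrightarrow> x \<le> b - 5 * J - (t - int T) \<Longrightarrow>
        (piggyback_step ^^ nat t) \<xi> x = \<eta>' x t" by metis
    have "0 \<le> t" if "(x, t) \<in> K" for x t using pos[OF that] big(2) by linarith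
    then have "K \<subseteq> UNIV \<times> {0..}" by auto
    moreover have "\<forall>(x, t)\<in>K. piggyback_evol \<xi> x (nat t) = \<eta>' x t"
      using pos \<eta>'(2) by (auto simp: piggyback_evol_def)
    ultimately show ?thesis using \<eta>'(1) unfolding filled_def by blast
  qed
qed

section \<open>Random seeds\<close>

definition seeds :: "nat \<Rightarrow> row set" where
  "seeds L = {o1. \<forall>x. x \<notin> {0..int L} \<longrightarrow> o1 x = 0}"

definition seed_states :: "nat \<Rightarrow> (int \<Rightarrow> nat) set" where
  "seed_states L = PiE_dflt {0..int L} 0 (\<lambda>_. {0, 1})"

lemma card_seed_states: "card (seed_states L) = 2 ^ (L + 1)" "finite (seed_states L)"
proof -
  have two: "card {0, 1::nat} = 2" by simp
  have "card (seed_states L) = (\<Prod>x\<in>{0..int L}. card {0, 1::nat})" unfolding seed_states_def by (rule card_PiE_dflt) auto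
  also have "\<dots> = 2 ^ card {0..int L}" unfolding two by simp
  also have "card {0..int L} = L + 1" by simp
  finally show "card (seed_states L) = 2 ^ (L + 1)" .
  then show "finite (seed_states L)" by (intro card_ge_0_finite) simp
qed

definition of_row :: "row \<Rightarrow> int \<Rightarrow> nat" where
  "of_row f x = (if f x = 1 then 1 else 0)"

lemma of_row: "states (of_row f)" "ones (of_row f) = f" "inj of_row"
proof -
  show "states (of_row f)" by (simp add: states_def of_row_def)
  show o: "ones (of_row f) = f" for f by (auto simp: ones_def of_row_def fun_eq_iff)
  show "inj of_row" by (rule inj_on_inverseI[of _ ones]) (rule o)
qed

lemma of_row_seeds: "of_row ` seeds L = seed_states L"
proof (intro equalityI subsetI)
  fix \<xi> assume \<xi>: "\<xi> \<in> seed_states L"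
  have v: "\<xi> x = 0 \<or> \<xi> x = 1 \<and> x \<in> {0..int L}" for x using \<xi> by (auto simp: seed_states_def PiE_dflt_def dest!: spec[of _ x])
  have "of_row (ones \<xi>) = \<xi>" using v by (force simp: of_row_def ones_def fun_eq_iff)
  moreover have "ones \<xi> \<in> seeds L" using v by (force simp: seeds_def ones_def)
  ultimately show "\<xi> \<in> of_row ` seeds L" by (metis image_eqI)
qed (auto simp: seed_states_def PiE_dflt_def seeds_def of_row_def split: if_splits)

lemma card_seeds: "card (seeds L) = 2 ^ (L + 1)" "finite (seeds L)"
proof -
  have i: "inj_on of_row (seeds L)" using of_row(3) by (rule inj_on_subset) simp
  show "card (seeds L) = 2 ^ (L + 1)" unfolding card_image[OF i, symmetric] of_row_seeds by (rule card_seed_states)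
  show "finite (seeds L)" by (rule finite_imageD[OF _ i]) (simp only: of_row_seeds card_seed_states)
qed

lemma prob_seed:
  assumes "\<And>\<xi>. states \<xi> \<Longrightarrow> ones \<xi> \<in> seeds L \<Longrightarrow> ones \<xi> \<in> E \<Longrightarrow> \<xi> \<in> S"
  shows "real (card (seeds L \<inter> E)) / 2 ^ (L + 1) \<le> measure_pmf.prob (uniform_seed L) S"
proof -
  have "uniform_seed L = pmf_of_set (seed_states L)"
    unfolding uniform_seed_def seed_states_def by (rule Pi_pmf_of_set) auto
  moreover have "measure_pmf.prob (pmf_of_set (seed_states L)) S = real (card (seed_states L \<inter> S)) / real (card (seed_states L))"
  proof (rule measure_pmf_of_set)
    show "seed_states L \<noteq> {}" using card_seed_states(1)[of L] by (metis card.empty power_eq_0_iff zero_neq_numeral)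
  qed (rule card_seed_states)
  moreover have "card (seeds L \<inter> E) \<le> card (seed_states L \<inter> S)"
  proof (rule card_inj_on_le)
    show "inj_on of_row (seeds L \<inter> E)" using of_row(3) by (rule inj_on_subset) simp
    show "of_row ` (seeds L \<inter> E) \<subseteq> seed_states L \<inter> S"
      using of_row_seeds[of L] assms of_row(1,2) by fastforce
  qed (intro finite_Int disjI1 card_seed_states)
  ultimately show ?thesis by (simp add: card_seed_states divide_right_mono)
qed

section \<open>Independence of the boundary bits\<close>

lemma comb_row_pow: "n \<le> j \<Longrightarrow> j \<le> 2 ^ k \<Longrightarrow> (lam ^^ n) (comb_row k j) = comb_row k (j - n)"
proof (induction n)
  case (Suc n)
  then have "j - n = Suc (j - Suc n)" by simp
  then show ?case using Suc comb_row_Suc[of "j - Suc n" k] by simp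
qed simp

lemma comb_row_pow_zero:
  assumes "j \<le> n" "j \<le> 2 ^ k" shows "(lam ^^ n) (comb_row k j) = (\<lambda>_. 0)"
proof -
  have "(lam ^^ n) (comb_row k j) = (lam ^^ (n - j)) ((lam ^^ j) (comb_row k j))"
    using assms(1) by (simp flip: funpow_add[THEN fun_cong, unfolded o_apply])
  then show ?thesis using assms comb_row_pow[of j j k] by (simp add: comb_row_0)
qed

text \<open>Summation by parts; as the support of \<open>f\<close> avoids both ends of
  \<open>[0, L]\<close>, no boundary terms arise.\<close>

lemma seed_row_lam:
  assumes "\<And>x. x \<notin> {1..int L - 1} \<Longrightarrow> f x = 0"
  shows "seed_row k L (lam f) j = lam (seed_row k L f j)"
proof
  fix x
  have sup: "1 \<le> y \<and> y \<le> int L - 1" if "f y = 1" for y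
    using assms[of y] that by (cases "y \<in> {1..int L - 1}") auto
  have *: "(\<Sum>i\<in>{0..int L}. f (i + e) * h i) = (\<Sum>i\<in>{0..int L}. f i * h (i - e))" if "e = 1 \<or> e = - 1" for e and h :: row
    by (rule sum.reindex_bij_witness_not_neutral[where S' = "{i \<in> {0..int L}. f (i + e) = 0}" and T' = "{i \<in> {0..int L}. f i = 0}"
          and i = "\<lambda>i. i - e" and j = "\<lambda>i. i + e"])
      (use that in \<open>auto intro: finite_subset[OF _ finite_atLeastAtMost_int[of 0 "int L"]] dest!: sup\<close>)
  have "seed_row k L (lam f) j x = (\<Sum>i\<in>{0..int L}. f (i + - 1) * comb_row k j (x - i)) +
      (\<Sum>i\<in>{0..int L}. f i * comb_row k j (x - i)) + (\<Sum>i\<in>{0..int L}. f (i + 1) * comb_row k j (x - i))"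
    by (simp add: seed_row_def lam_def algebra_simps sum.distrib)
  also have "\<dots> = lam (seed_row k L f j) x"
    by (subst (1 2) *) (simp_all add: lam_def seed_row_def algebra_simps)
  finally show "seed_row k L (lam f) j x = lam (seed_row k L f j) x" .
qed

text \<open>A seed shaped like row \<open>n\<close> contributes zero to the rows
  \<open>j \<le> n\<close> and a translate of \<open>comb_row k 1\<close> to row
  \<open>n + 1\<close>. These seeds make the system triangular.\<close>

lemma pt_seed:
  assumes "int n \<le> s" "s + int n \<le> int L"
  shows "shift (- s) (pt n) \<in> seeds L"
    "seed_row k L (shift (- s) (pt n)) j = shift (- s) ((lam ^^ n) (comb_row k j))"
proof -
  have sup: "shift (- s) (pt n) x = 0" if "x \<notin> {s - int n..s + int n}" for x n
    using that by (auto simp: shift_def intro!: pt_outside)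
  show "shift (- s) (pt n) \<in> seeds L" using sup[of _ n] assms by (fastforce simp: seeds_def)
  show "seed_row k L (shift (- s) (pt n)) j = shift (- s) ((lam ^^ n) (comb_row k j))"
    using assms
  proof (induction n)
    case 0
    have "(\<Sum>i\<in>{0..int L}. shift (- s) (pt 0) i * comb_row k j (x - i)) = (\<Sum>i\<in>{0..int L}. if i = s then comb_row k j (x - s) else 0)" for x
      by (intro sum.cong) (auto simp: shift_def pt_def)
    then show ?case using 0 by (simp add: seed_row_def shift_def fun_eq_iff)
  next
    case (Suc n)
    have e: "shift (- s) (pt (Suc n)) = lam (shift (- s) (pt n))" by (simp add: lam_shift pt_def)
    have "seed_row k L (shift (- s) (pt (Suc n))) j = lam (seed_row k L (shift (- s) (pt n)) j)"
      unfolding e by (rule seed_row_lam) (rule sup, use Suc.prems in auto)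
    then show ?case using Suc by (simp add: lam_shift)
  qed
qed

lemma seed_row_add: "seed_row k L (\<lambda>x. f x + g x) j x = seed_row k L f j x + seed_row k L g j x"
  by (simp add: seed_row_def algebra_simps sum.distrib)

lemma seed_row_mult: "seed_row k L (\<lambda>x. c * f x) j x = c * seed_row k L f j x"
  by (simp add: seed_row_def sum_distrib_left mult.assoc)

lemma period3:
  assumes "lam f = (\<lambda>_. 0)" shows "f (x + 3 * m) = f x"
proof -
  have P: "f (x + 3 * int n) = f x" for x n
  proof (induction n)
    case (Suc n)
    have "x + 3 * int (Suc n) = (x + 3 * int n) + 3" by simp
    then show ?case using lam_periodic(2)[OF assms] Suc by metis
  qed simp
  show ?thesis
  proof (cases "m \<ge> 0")
    case True then show ?thesis using P[of x "nat m"] by simp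
  next
    case False then show ?thesis using P[of "x + 3 * m" "nat (- m)"] by simp
  qed
qed

lemma lam_zero_values:
  assumes "lam f = (\<lambda>_. 0)"
  shows "f x = (if (x - p) mod 3 = 0 then f p else if (x - p) mod 3 = 1 then f (p + 1) else f p + f (p + 1))"
proof -
  define m where "m = (x - p) div 3"
  define e where "e = (x - p) mod 3"
  have x: "x = p + e + 3 * m" by (simp add: m_def e_def)
  have "f x = f (p + e)" unfolding x by (rule period3[OF assms])
  moreover have "e = 0 \<or> e = 1 \<or> e = 2" unfolding e_def by presburger
  moreover have "f (p + 2) = f p + f (p + 1)" using lam_periodic(1)[OF assms, of "p + 1"] by (simp add: add.commute)
  ultimately show ?thesis unfolding e_def[symmetric] by auto
qed

lemma seed_row_onto:
  assumes "2 * N \<le> L" "N \<le> 2 ^ k" "n \<le> N"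
  shows "\<exists>f\<in>seeds L. \<forall>j. 1 \<le> j \<and> j \<le> n \<longrightarrow> seed_row k L f j p = fst (\<tau> j) \<and> seed_row k L f j (p + 1) = snd (\<tau> j)"
  using assms(3)
proof (induction n)
  case 0
  show ?case by (rule bexI[of _ "\<lambda>_. 0"]) (auto simp: seeds_def)
next
  case (Suc n)
  then obtain f where f: "f \<in> seeds L" "\<And>j. 1 \<le> j \<Longrightarrow> j \<le> n \<Longrightarrow> seed_row k L f j p = fst (\<tau> j) \<and> seed_row k L f j (p + 1) = snd (\<tau> j)" by auto
  \<comment> \<open>Two neighbouring centres give two free parameters for the two bits of row
    \<open>n + 1\<close>. The condition \<open>2 * N \<le> L\<close> makes both seeds fit.\<close>
  define g where "g s = shift (- s) (pt n)" for s
  have g: "g s \<in> seeds L" "seed_row k L (g s) j = shift (- s) ((lam ^^ n) (comb_row k j))" if "s = int N \<or> s = int N + 1" for s j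
    unfolding g_def by (rule pt_seed; use that assms(1) Suc.prems in auto)+
  let ?u = "comb_row k 1"
  have lu: "lam ?u = (\<lambda>_. 0)" using comb_row_Suc[of 0 k] by (simp add: comb_row_0)
  have "(lam ^^ n) (comb_row k (Suc n)) = ?u" using comb_row_pow[of n "Suc n" k] Suc.prems assms(2) by simp
  then have g1: "seed_row k L (g s) (Suc n) x = ?u (x - s)" if "s = int N \<or> s = int N + 1" for s x
    using g(2)[OF that] by (simp add: shift_def)
  have g0: "seed_row k L (g s) j x = 0" if "s = int N \<or> s = int N + 1" "j \<le> n" for s x j
    using g(2)[OF that(1)] comb_row_pow_zero[of j n k] that(2) Suc.prems assms(2) by (simp add: shift_def)
  define u where "u = ?u (p - int N - 1)"
  define v where "v = ?u (p - int N)"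
  have "?u (p - int N + 1) = v + u" using lam_periodic(1)[OF lu, of "p - int N"] by (simp add: u_def v_def)
  moreover have "u = 1 \<or> v = 1"
  proof (rule ccontr)
    assume "\<not> (u = 1 \<or> v = 1)"
    then have "?u (p - int N - 1) = 0" "?u (p - int N - 1 + 1) = 0" by (auto simp: u_def v_def)
    then have "?u x = 0" for x using lam_zero_values[OF lu, of x "p - int N - 1"] by simp
    then show False using comb_row_1[of k] by simp
  qed
  define c where "c = fst (\<tau> (Suc n)) + seed_row k L f (Suc n) p"
  define d where "d = snd (\<tau> (Suc n)) + seed_row k L f (Suc n) (p + 1)"
  \<comment> \<open>The determinant \<open>v^2 + u v + u^2\<close> is 1 unless
    \<open>u = v = 0\<close>.\<close>
  have "\<exists>\<alpha> \<beta>. \<alpha> * v + \<beta> * u = c \<and> \<alpha> * (v + u) + \<beta> * v = d"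
  proof -
    have "\<exists>\<alpha>\<in>{0,1}. \<exists>\<beta>\<in>{0,1}. \<alpha> * v + \<beta> * u = c \<and> \<alpha> * (v + u) + \<beta> * v = d"
      using \<open>u = 1 \<or> v = 1\<close> by (cases u; cases v; cases c; cases d; simp)
    then show ?thesis by blast
  qed
  then obtain \<alpha> \<beta> where ab: "\<alpha> * v + \<beta> * u = c" "\<alpha> * (v + u) + \<beta> * v = d" by blast
  define h where "h x = f x + (\<alpha> * g (int N) x + \<beta> * g (int N + 1) x)" for x
  have h: "seed_row k L h j x = seed_row k L f j x + (\<alpha> * seed_row k L (g (int N)) j x + \<beta> * seed_row k L (g (int N + 1)) j x)" for j x
    unfolding h_def by (simp only: seed_row_add seed_row_mult)
  have "h \<in> seeds L" using f(1) g(1)[of "int N"] g(1)[of "int N + 1"] by (simp add: seeds_def h_def)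
  moreover have "seed_row k L h j p = fst (\<tau> j) \<and> seed_row k L h j (p + 1) = snd (\<tau> j)" if j: "1 \<le> j" "j \<le> Suc n" for j
  proof (cases "j = Suc n")
    case True
    have "seed_row k L h j p = seed_row k L f (Suc n) p + c"
      unfolding h True using g1 ab(1) by (simp add: u_def v_def algebra_simps)
    moreover have "seed_row k L h j (p + 1) = seed_row k L f (Suc n) (p + 1) + d"
      unfolding h True using g1 ab(2) \<open>?u (p - int N + 1) = v + u\<close> by (simp add: u_def v_def algebra_simps)
    ultimately show ?thesis by (simp add: c_def d_def True add.commute[of "fst _"] add.commute[of "snd _"])
  next
    case False
    then show ?thesis using f(2)[of j] j g0[of _ j] by (simp add: h)
  qed
  ultimately show ?case by blast
qed

definition pairs :: "nat \<Rightarrow> nat \<Rightarrow> int \<Rightarrow> nat \<Rightarrow> row \<Rightarrow> (bool \<times> bool) list" where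
  "pairs k L p N f = map (\<lambda>j. (seed_row k L f j p = 1, seed_row k L f j (p + 1) = 1)) [1..<N + 1]"

lemma pairs_eq_iff: "pairs k L p N f = pairs k L p N g \<longleftrightarrow>
  (\<forall>j. 1 \<le> j \<and> j \<le> N \<longrightarrow> seed_row k L f j p = seed_row k L g j p \<and> seed_row k L f j (p + 1) = seed_row k L g j (p + 1))"
proof -
  have b: "(x = 1) = (y = 1) \<longleftrightarrow> x = y" for x y :: bit by (cases x; cases y; simp)
  show ?thesis by (auto simp: pairs_def b)
qed

text \<open>\<open>pairs\<close> is linear and onto, so its \<open>4 ^ N\<close> fibres are cosets
  of the same size; adding \<open>f + f'\<close> carries one fibre into another.\<close>

lemma card_fibre:
  assumes "2 * N \<le> L" "N \<le> 2 ^ k" "length l = N"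
  shows "card {f \<in> seeds L. pairs k L p N f = l} * 4 ^ N = 2 ^ (L + 1)"
proof -
  let ?F = "\<lambda>l. {f \<in> seeds L. pairs k L p N f = l}"
  have onto: "\<exists>f\<in>seeds L. pairs k L p N f = l" if l: "length l = N" for l
  proof -
    obtain f where f: "f \<in> seeds L" "\<And>j. 1 \<le> j \<Longrightarrow> j \<le> N \<Longrightarrow> seed_row k L f j p = of_bool (fst (l ! (j - 1))) \<and> seed_row k L f j (p + 1) = of_bool (snd (l ! (j - 1)))"
      using seed_row_onto[OF assms(1,2) order_refl, of p "\<lambda>j. (of_bool (fst (l ! (j - 1))), of_bool (snd (l ! (j - 1))))"] by auto
    have len: "length (pairs k L p N f) = N" by (simp add: pairs_def)
    have "pairs k L p N f = l"
    proof (rule nth_equalityI)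
      fix i assume "i < length (pairs k L p N f)"
      then have i: "i < N" by (simp only: len)
      then have "pairs k L p N f ! i = (seed_row k L f (Suc i) p = 1, seed_row k L f (Suc i) (p + 1) = 1)"
        by (simp add: pairs_def del: upt_Suc)
      also have "\<dots> = l ! i" using f(2)[of "Suc i"] i by (simp add: prod_eq_iff)
      finally show "pairs k L p N f ! i = l ! i" .
    qed (simp only: len l)
    then show ?thesis using f(1) by blast
  qed
  have same: "card (?F l) = card (?F l')" if "length l = N" "length l' = N" for l l'
  proof -
    have le: "card (?F l) \<le> card (?F l')" if l: "length l = N" "length l' = N" for l l'
    proof -
      obtain f where f: "f \<in> seeds L" "pairs k L p N f = l" using onto[OF l(1)] by blast
      obtain f' where f': "f' \<in> seeds L" "pairs k L p N f' = l'" using onto[OF l(2)] by blast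
      let ?t = "\<lambda>h. \<lambda>x. h x + (f x + f' x)"
      show ?thesis
      proof (rule card_inj_on_le)
        show "inj_on ?t (?F l)" by (auto simp: inj_on_def fun_eq_iff)
        show "?t ` ?F l \<subseteq> ?F l'"
        proof
          fix h' assume "h' \<in> ?t ` ?F l"
          then obtain h where h: "h \<in> seeds L" "pairs k L p N h = pairs k L p N f" "h' = ?t h" using f(2) by auto
          have "pairs k L p N h' = pairs k L p N f'"
            unfolding pairs_eq_iff using h(2)[unfolded pairs_eq_iff] by (simp add: h(3) seed_row_add)
          moreover have "h' \<in> seeds L" using h(1) f(1) f'(1) by (simp add: h(3) seeds_def)
          ultimately show "h' \<in> ?F l'" using f'(2) by simp
        qed
      qed (simp add: card_seeds)
    qed
    show ?thesis by (rule antisym[OF le[OF that] le[OF that(2,1)]])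
  qed
  let ?A = "{l :: (bool \<times> bool) list. set l \<subseteq> UNIV \<and> length l = N}"
  have "card (UNIV :: (bool \<times> bool) set) = 4" by (simp add: card_cartesian_product flip: UNIV_Times_UNIV)
  then have A: "finite ?A" "card ?A = 4 ^ N"
    using finite_lists_length_eq[of "UNIV :: (bool \<times> bool) set" N] card_lists_length_eq[of "UNIV :: (bool \<times> bool) set" N] by simp_all
  have "seeds L = (\<Union>l\<in>?A. ?F l)" by (auto simp: pairs_def)
  then have "card (seeds L) = card (\<Union>l\<in>?A. ?F l)" by simp
  also have "\<dots> = (\<Sum>l\<in>?A. card (?F l))" by (rule card_UN_disjoint) (use A(1) card_seeds(2) in auto)
  also have "\<dots> = (\<Sum>l'\<in>?A. card (?F l))" by (rule sum.cong[OF refl], rule same) (use assms(3) in auto)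
  also have "\<dots> = 4 ^ N * card (?F l)" using A(2) by simp
  finally show ?thesis by (simp add: card_seeds(1))
qed

lemma card_pairs:
  assumes "2 * N \<le> L" "N \<le> 2 ^ k" "\<And>l. l \<in> S \<Longrightarrow> length l = N"
  shows "card {f \<in> seeds L. pairs k L p N f \<in> S} * 4 ^ N = card S * 2 ^ (L + 1)"
proof -
  let ?F = "\<lambda>l. {f \<in> seeds L. pairs k L p N f = l}"
  have "S \<subseteq> {l. set l \<subseteq> UNIV \<and> length l = N}" using assms(3) by auto
  then have fin: "finite S" by (rule finite_subset) (rule finite_lists_length_eq, simp)
  have "{f \<in> seeds L. pairs k L p N f \<in> S} = (\<Union>l\<in>S. ?F l)" by auto
  then have "card {f \<in> seeds L. pairs k L p N f \<in> S} = card (\<Union>l\<in>S. ?F l)" by simp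
  also have "\<dots> = (\<Sum>l\<in>S. card (?F l))" by (rule card_UN_disjoint) (use fin card_seeds(2) in auto)
  finally have "card {f \<in> seeds L. pairs k L p N f \<in> S} * 4 ^ N = (\<Sum>l\<in>S. card (?F l) * 4 ^ N)" by (simp add: sum_distrib_right)
  also have "\<dots> = (\<Sum>l\<in>S. 2 ^ (L + 1))" by (intro sum.cong refl card_fibre assms) auto
  finally show ?thesis by simp
qed

section \<open>Winning boundary data\<close>

lemma resolve_length: "resolve bs w its s = Some r \<Longrightarrow> node_ok (length bs) w its s \<Longrightarrow> length r = 16"
proof (induction bs w its s rule: resolve.induct)
  case (3 a b bs w it its s)
  have "length (sweep a b (tl w)) = 79" using 3(3) by (simp add: node_ok_def length_sweep)
  then show ?case using 3 node_ok_lift[of "length bs" w "it # its" s "sweep a b (tl w)"]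
    by (auto split: option.splits)
qed (auto simp: node_ok_def)

lemma node_ok_root: "node_ok 15 root_row root_items (replicate 16 False)"
  unfolding node_ok_def root_items_eq by (auto simp: root_row_def rowY_monomial)

definition weight :: "nat list" where
  "weight = [33554432, 2809292, 1003704, 1776808, 719680, 2062900, 1442028, 9182360, 2481888, 1525972]"

definition winning :: "nat \<Rightarrow> (bool \<times> bool) list set" where
  "winning \<kappa> = admissible (restrictions @ replicate 7 False) \<inter> resolved root_row root_items (replicate 16 False) \<kappa>"

lemma weight_le: "\<kappa> < 10 \<Longrightarrow> weight ! \<kappa> \<le> card (winning \<kappa>)"
proof -
  assume \<kappa>: "\<kappa> < 10"
  have z: "[False, False, False, False, False, False, False, False, False, False, False, False, False, False, False, False] = replicate 16 False"
      "[0, 0, 0, 0, 0, 0, 0, 0, 0, 0 :: nat] = replicate 10 0" by (simp_all add: numeral_eq_Suc)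
  have n: "length (restrictions @ replicate 7 False) = 15" by (simp add: restrictions_def)
  have "count_top restrictions root_row root_items (replicate 16 False) (replicate 10 0) ! \<kappa> \<le>
      replicate 10 0 ! \<kappa> + num (restrictions @ replicate 7 False) root_row root_items (replicate 16 False) \<kappa>"
    using count_top_counts[of restrictions] node_ok_root \<kappa> unfolding counts_def n
    by (metis length_replicate)
  then show ?thesis using \<kappa> count_result[unfolded z] by (simp add: weight_def num_def winning_def)
qed

lemma winning_length: "l \<in> winning \<kappa> \<Longrightarrow> length l = 15"
  by (auto simp: winning_def admissible_def restrictions_def dest: list_all2_lengthD)

lemma winning_resolve:
  assumes "l \<in> winning \<kappa>"
  shows "\<exists>r. resolve l root_row root_items (replicate 16 False) = Some r \<and> ether_class r = \<kappa> \<and> length r = 16"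
proof -
  obtain r where r: "resolve l root_row root_items (replicate 16 False) = Some r" "ether_class r = \<kappa>"
    using assms by (auto simp: winning_def resolved_def)
  have "node_ok (length l) root_row root_items (replicate 16 False)" unfolding winning_length[OF assms] by (rule node_ok_root)
  then show ?thesis using r resolve_length[OF r(1)] by blast
qed

lemma winning_zero: "l \<in> winning \<kappa> \<Longrightarrow> i \<le> 3 \<Longrightarrow> \<not> fst (l ! (2 ^ i - 1))"
proof -
  assume l: "l \<in> winning \<kappa>" and "i \<le> 3"
  have *: "n < 15 \<Longrightarrow> (restrictions @ replicate 7 False) ! n \<Longrightarrow> \<not> fst (l ! n)" for n
    using l list_all2_nthD[of _ "restrictions @ replicate 7 False" l n] by (auto simp: winning_def admissible_def restrictions_def)
  have "i = 0 \<or> i = 1 \<or> i = 2 \<or> i = 3" using \<open>i \<le> 3\<close> by auto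
  then show ?thesis by (elim disjE) (rule *; simp add: restrictions_def numeral_eq_Suc)+
qed

text \<open>The pair \<open>(True, True)\<close> at \<open>p\<close> and \<open>p + 1\<close> fixes
  the phase of the first nonzero row, whose gaps are then the cells \<open>x\<close> with
  \<open>(x - p) mod 3 = 2\<close>.\<close>

definition event :: "nat \<Rightarrow> nat \<Rightarrow> nat \<Rightarrow> int \<Rightarrow> nat \<Rightarrow> row set" where
  "event k L v p \<kappa> = {f \<in> seeds L. pairs k L p (v + 16) f \<in> (\<lambda>l. replicate v (False, False) @ (True, True) # l) ` winning \<kappa>}"

lemma event_rows:
  assumes "f \<in> event k L v p \<kappa>" "v + 16 \<le> 2 ^ k"
  defines "W \<equiv> seed_row k L f"
  shows "map (\<lambda>j. (W (v + Suc j) p = 1, W (v + Suc j) (p + 1) = 1)) [1..<16] \<in> winning \<kappa>"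
    "j \<le> v \<Longrightarrow> W j = (\<lambda>_. 0)" "W (v + 1) x = of_bool ((x - p) mod 3 \<noteq> 2)"
proof -
  let ?b = "\<lambda>j. (W j p = 1, W j (p + 1) = 1)"
  obtain l where l: "l \<in> winning \<kappa>" "pairs k L p (v + 16) f = replicate v (False, False) @ (True, True) # l"
    using assms(1) by (auto simp: event_def)
  have n: "v + 16 + 1 = v + 17" "v + 17 = (v + 1) + 16" by simp_all
  have u: "[1..<v + 17] = [1..<v + 1] @ [v + 1..<v + 17]"
    unfolding n(2) by (rule upt_add_eq_append) simp
  have n3: "v + 2 = Suc (v + 1)" by simp
  have u': "[v + 1..<v + 17] = (v + 1) # [v + 2..<v + 17]" unfolding n3 by (rule upt_conv_Cons) simp
  have e: "map ?b [1..<v + 1] @ ?b (v + 1) # map ?b [v + 2..<v + 17] = replicate v (False, False) @ (True, True) # l"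
    using l(2) unfolding pairs_def n(1) u u' W_def by (simp only: map_append list.map)
  then have e: "map ?b [1..<v + 1] = replicate v (False, False)" "?b (v + 1) = (True, True)" "map ?b [v + 2..<v + 17] = l"
    by (simp_all add: append_eq_append_conv del: upt_Suc)
  have low: "W j p = 0 \<and> W j (p + 1) = 0" if "1 \<le> j" "j \<le> v" for j
  proof -
    have "j \<in> set [1..<v + 1]" using that by (simp del: upt_Suc)
    then have "?b j \<in> ?b ` set [1..<v + 1]" by (rule imageI)
    then show ?thesis unfolding set_map[symmetric] e(1) by (auto split: if_splits)
  qed
  have Suc: "lam (W (Suc j)) = W j" if "j < 2 ^ k" for j unfolding W_def by (rule seed_row_Suc[OF that])
  show zero: "W j = (\<lambda>_. 0)" if "j \<le> v" for j
    using that
  proof (induction j)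
    case 0 then show ?case by (simp add: W_def seed_row_0)
  next
    case (Suc j)
    have "lam (W (Suc j)) = (\<lambda>_. 0)" using Suc \<open>\<And>j. j < 2 ^ k \<Longrightarrow> lam (W (Suc j)) = W j\<close>[of j] assms(2) by simp
    then have "W (Suc j) x = 0" for x using lam_zero_values[of "W (Suc j)" x p] low[of "Suc j"] Suc.prems by simp
    then show ?case by (simp only: fun_eq_iff) simp
  qed
  show "W (v + 1) x = of_bool ((x - p) mod 3 \<noteq> 2)" for x
  proof -
    have "lam (W (v + 1)) = (\<lambda>_. 0)" using Suc[of v] zero[of v] assms(2) by simp
    note lam_zero_values[OF this, of x p]
    moreover have "(x - p) mod 3 = 0 \<or> (x - p) mod 3 = 1 \<or> (x - p) mod 3 = 2" by presburger
    ultimately show ?thesis using e(2) by auto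
  qed
  have "map (\<lambda>j. ?b (v + Suc j)) [1..<16] = l"
  proof -
    have "[v + 2..<v + 17] = map (\<lambda>j. j + (v + 1)) [1..<16]" by (rule nth_equalityI) (simp_all del: upt_Suc)
    then show ?thesis unfolding e(3)[symmetric] by (simp add: comp_def add.commute del: upt_Suc)
  qed
  then show "map (\<lambda>j. ?b (v + Suc j)) [1..<16] \<in> winning \<kappa>" using l(1) by simp
qed

lemma orbit_row:
  assumes "orbit_rel f g" "\<And>x. g (x + 16) = g x"
  obtains a b where "\<And>t x. two ((lam ^^ nat (t mod 16)) f) x = two ((lam ^^ nat ((t + b) mod 16)) g) (x + a)"
proof -
  obtain a b where f: "f = shift a ((lam ^^ b) g)" using assms(1) by (auto simp: orbit_rel_def)
  have "two ((lam ^^ nat (t mod 16)) f) x = two ((lam ^^ nat ((t + int b) mod 16)) g) (x + a)" for t x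
  proof -
    have "nat ((t + int b) mod 16) = (nat (t mod 16) + b) mod 16"
      using nat_mod_distrib[of "t mod 16 + int b" 16] by (simp add: nat_add_distrib mod_add_left_eq)
    then have "(lam ^^ nat ((t + int b) mod 16)) g = (lam ^^ (nat (t mod 16) + b)) g" using lam_mod_16[of g, OF assms(2)] by metis
    then show ?thesis by (simp add: f lam_pow_shift funpow_add two_def) (simp add: shift_def)
  qed
  then show ?thesis by (rule that)
qed

lemma nth_words: "\<kappa> < 10 \<Longrightarrow> words ! \<kappa> \<in> set words"
  by (rule nth_mem) (simp add: words_def)

lemma event_replicator:
  assumes \<xi>: "states \<xi>" "ones \<xi> \<in> event k L v p \<kappa>" and k: "v + 16 \<le> 2 ^ k" and "\<kappa> < 10"
  shows "replicator (piggyback_evol \<xi>) (eta (words ! \<kappa>)) \<or> \<kappa> = 5 \<and> replicator (piggyback_evol \<xi>) (reflect (eta (words ! \<kappa>)))"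
proof -
  note rows = event_rows[OF \<xi>(2) k]
  obtain r where r: "resolve (map (\<lambda>j. (seed_row k L (ones \<xi>) (v + Suc j) p = 1, seed_row k L (ones \<xi>) (v + Suc j) (p + 1) = 1)) [1..<16])
      root_row root_items (replicate 16 False) = Some r" "ether_class r = \<kappa>" "length r = 16"
    using winning_resolve[OF rows(1)] by blast
  have sup: "ones \<xi> x = 0" if "x \<notin> {0..int L}" for x using \<xi>(2) that by (simp add: event_def seeds_def)
  define V where "V j = shift p (seed_row k L (ones \<xi>) (v + j))" for j
  have V: "V 0 = (\<lambda>_. 0)" "\<And>x. V 1 x = of_bool (x mod 3 \<noteq> 2)"
    "resolve (map (\<lambda>j. (V (Suc j) 0 = 1, V (Suc j) 1 = 1)) [1..<16]) root_row root_items (replicate 16 False) = Some r"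
    using rows(2)[of v] rows(3) r(1) by (simp_all add: V_def shift_def fun_eq_iff add.commute del: upt_Suc)
  \<comment> \<open>Stated for a general row \<open>g\<close>, to serve both the ether and its
    mirror image; \<open>e\<close> absorbs the translation in \<open>reflect_eta\<close>. The radius
    grows with \<open>L\<close>, which is allowed because it may depend on the seed.\<close>
  have main: "replicator (piggyback_evol \<xi>) \<eta>"
    if \<eta>: "\<And>x t. \<eta> x t = two ((lam ^^ nat (t mod 16)) g) (x - e)" and g: "orbit_rel (rowY r) g" "\<And>x. g (x + 16) = g x" for \<eta> g e
  proof (rule replicator_of_void[where J = "2 ^ k" and L = L and \<rho> = "nat (8 * 2 ^ k + int L)"])
    obtain a0 b0 where ab: "\<And>t x. two ((lam ^^ nat (t mod 16)) (rowY r)) x = two ((lam ^^ nat ((t + b0) mod 16)) g) (x + a0)"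
      using orbit_row[OF g] by metis
    have "(16::int) \<le> int (2 ^ k)" using k by (metis add_leD2 of_nat_le_iff of_nat_numeral)
    then show "(2::int) \<le> 2 ^ k" by simp
    fix T a b assume v: "void T a b" and big: "4 * 2 ^ k < b - a"
    obtain A C where AC: "\<And>x t. int T + 2 ^ k \<le> t \<Longrightarrow> a + int L + 5 * 2 ^ k + (t - int T) \<le> x \<Longrightarrow> x \<le> b - 5 * 2 ^ k - (t - int T) \<Longrightarrow>
      (piggyback_step ^^ nat t) \<xi> x = two ((lam ^^ nat ((t + C) mod 16)) (rowY r)) (x + A)"
      using filled_void[OF \<xi>(1) sup k V_def V v big] by metis
    let ?\<eta>' = "\<lambda>x t. \<eta> (x + (A + a0 + e)) (t + (C + b0))"
    have "two ((lam ^^ nat ((t + C) mod 16)) (rowY r)) (x + A) = ?\<eta>' x t" for x t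
      unfolding \<eta> ab[of "t + C" "x + A"] by (simp add: algebra_simps)
    then show "\<exists>\<eta>'. ether_equiv \<eta> \<eta>' \<and> (\<forall>x t. int T + 2 ^ k \<le> t \<longrightarrow> a + int L + 5 * 2 ^ k + (t - int T) \<le> x \<longrightarrow> x \<le> b - 5 * 2 ^ k - (t - int T) \<longrightarrow>
        (piggyback_step ^^ nat t) \<xi> x = \<eta>' x t)"
      using AC by (intro exI[of _ ?\<eta>']) (auto simp: ether_equiv_def)
  qed simp
  have B: "word_ok (words ! \<kappa>)" using words_ok nth_words[OF assms(4)] by blast
  have "cyc (rev (bits (words ! \<kappa>))) (x + 16) = cyc (rev (bits (words ! \<kappa>))) x" for x
    by (rule cyc_16) (use B in \<open>simp add: word_ok_def bits_def\<close>)
  then show ?thesis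
    using ether_class_sound[OF r(3,2) assms(4)] main[of "eta (words ! \<kappa>)" "cyc (bits (words ! \<kappa>))" 0, OF _ _ bits_16[OF B]]
      main[of "reflect (eta (words ! \<kappa>))" "cyc (rev (bits (words ! \<kappa>)))" 1, OF reflect_eta[OF B]]
    by (auto simp: eta_def)
qed

section \<open>Disjointness of the 48 translates\<close>

lemma odd_part:
  fixes m :: int
  assumes "0 < m" "m < 2 ^ Suc k"
  shows "\<exists>i\<le>k. \<exists>u. m = 2 ^ i * (2 * u + 1)"
  using assms
proof (induction k arbitrary: m)
  case 0
  then have "m = 2 ^ 0 * (2 * 0 + 1)" by simp
  then show ?case by blast
next
  case (Suc k)
  show ?case
  proof (cases "odd m")
    case True
    then obtain u where "m = 2 * u + 1" by (rule oddE)
    then have "m = 2 ^ 0 * (2 * u + 1)" by simp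
    then show ?thesis by blast
  next
    case False
    then obtain n where n: "m = 2 * n" by (auto elim: evenE)
    then have "0 < n" "n < 2 ^ Suc k" using Suc.prems by simp_all
    then obtain i u where "i \<le> k" "n = 2 ^ i * (2 * u + 1)" using Suc.IH by blast
    then have "Suc i \<le> Suc k" "m = 2 ^ Suc i * (2 * u + 1)" by (simp_all add: n)
    then show ?thesis by blast
  qed
qed

text \<open>The phase of the first nonzero row determines \<open>p\<close> modulo 3. Of the
  remaining multiples of 3 below 48, each is an odd multiple of 3, 6, 12 or 24, and translation by
  it flips one of the four bits that \<open>restrictions\<close> fixes as 0.\<close>

lemma event_unique:
  assumes f: "f \<in> event k L v p \<kappa>" "f \<in> event k L v' p' \<kappa>" and k: "v + 16 \<le> 2 ^ k" "v' + 16 \<le> 2 ^ k"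
    and p: "p \<in> {0..<48}" "p' \<in> {0..<48}"
  shows "v = v' \<and> p = p'"
proof -
  let ?W = "seed_row k L f"
  have v: "\<not> v < v'" if "f \<in> event k L v p \<kappa>" "f \<in> event k L v' p' \<kappa>" "v + 16 \<le> 2 ^ k" "v' + 16 \<le> 2 ^ k" for v v' p p'
  proof
    assume "v < v'"
    then show False using event_rows(3)[OF that(1,3), of p] event_rows(2)[OF that(2,4), of "v + 1"] by simp
  qed
  have "v = v'" using v[OF f k] v[OF f(2,1) k(2,1)] by simp
  have p: "\<not> p < p'" if f: "f \<in> event k L v p \<kappa>" "f \<in> event k L v p' \<kappa>" and p: "0 \<le> p" "p' < 48" for p p'
  proof
    assume "p < p'"
    note l = event_rows(1,3)[OF f(1) k(1)] and l' = event_rows(1,3)[OF f(2) k(1)]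
    \<comment> \<open>Both \<open>p'\<close> and \<open>p' + 1\<close> carry ones of the row
      110110..., whose phase is given by \<open>p\<close>.\<close>
    have "(p' - p) mod 3 \<noteq> 2" "(p' + 1 - p) mod 3 \<noteq> 2" using l(2)[of p'] l(2)[of "p' + 1"] l'(2)[of p'] l'(2)[of "p' + 1"] by auto
    then have "(p' - p) mod 3 = 0" by presburger
    then obtain m where m: "p' = p + 3 * m" by (metis add.commute diff_add_cancel dvdE mod_0_imp_dvd)
    then have "0 < m" "m < 16" using \<open>p < p'\<close> p by linarith+
    then obtain i u where i: "i \<le> 3" "m = 2 ^ i * (2 * u + 1)" using odd_part[of m 3] by auto
    define s :: int where "s = 2 ^ i"
    let ?g = "?W (v + 1 + 2 ^ i)"
    have le: "(2::nat) ^ i \<le> 8" using power_increasing[OF i(1), of "2::nat"] by simp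
    have "(lam ^^ n) (?W (v + 1 + n)) = ?W (v + 1)" if "n \<le> 8" for n
      using that
    proof (induction n)
      case (Suc n)
      have "lam (?W (Suc (v + 1 + n))) = ?W (v + 1 + n)" by (rule seed_row_Suc) (use Suc.prems k(1) in simp)
      then show ?case using Suc by (simp add: funpow_swap1)
    qed simp
    then have g: "?g (x - s) + ?g x + ?g (x + s) = ?W (v + 1) x" for x
      using le lam_pow_two_power[of i ?g x] by (simp add: s_def)
    \<comment> \<open>Adding the three-term relations at \<open>x + s\<close> and
      \<open>x + 2 * s\<close> leaves \<open>?g x + ?g (x + 3 * s)\<close>. As \<open>s\<close> is
      not divisible by 3, exactly one of these two cells is a gap of row \<open>v + 1\<close>, so
      the sum is 1.\<close>
    have flip: "?g (x + 3 * s) = ?g x + 1" if "(x - p) mod 3 = 0" for x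
    proof -
      have s3: "s mod 3 = 1 \<or> s mod 3 = 2"
      proof -
        have "i = 0 \<or> i = 1 \<or> i = 2 \<or> i = 3" using i(1) by auto
        then show ?thesis unfolding s_def by (elim disjE) simp_all
      qed
      have "?W (v + 1) (x + s) + ?W (v + 1) (x + 2 * s) = 1"
      proof -
        have "(x + s - p) mod 3 = s mod 3" "(x + 2 * s - p) mod 3 = (2 * (s mod 3)) mod 3" using that by presburger+
        then show ?thesis using s3 l(2)[of "x + s"] l(2)[of "x + 2 * s"] by (elim disjE) simp_all
      qed
      moreover have "?g x + ?g (x + s) + ?g (x + 2 * s) = ?W (v + 1) (x + s)" using g[of "x + s"] by (simp add: algebra_simps)
      moreover have "?g (x + s) + ?g (x + 2 * s) + ?g (x + 3 * s) = ?W (v + 1) (x + 2 * s)" using g[of "x + 2 * s"] by (simp add: algebra_simps)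
      ultimately show ?thesis
        by (cases "?g x"; cases "?g (x + s)"; cases "?g (x + 2 * s)"; cases "?g (x + 3 * s)"; simp)
    qed
    have even: "?g (p + 3 * s * (2 * int n)) = ?g p" for n
    proof (induction n)
      case (Suc n)
      let ?x = "p + 3 * s * (2 * int n)"
      have "(?x - p) mod 3 = 0" "(?x + 3 * s - p) mod 3 = 0" by (simp_all add: mult.assoc)
      then have "?g (?x + 3 * s + 3 * s) = ?g ?x" using flip[of ?x] flip[of "?x + 3 * s"] by (simp add: add.assoc)
      moreover have "?x + 3 * s + 3 * s = p + 3 * s * (2 * int (Suc n))" by (simp add: algebra_simps)
      ultimately show ?case using Suc by metis
    qed simp
    have "0 < s" by (simp add: s_def)
    then have "0 < 2 * u + 1" using \<open>0 < m\<close> i(2) by (simp add: zero_less_mult_iff flip: s_def)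
    then have "0 \<le> u" by simp
    let ?x = "p + 3 * s * (2 * int (nat u))"
    have "p' = ?x + 3 * s" using m i(2) \<open>0 \<le> u\<close> by (simp add: algebra_simps flip: s_def)
    moreover have "(?x - p) mod 3 = 0" by (simp add: mult.assoc)
    ultimately have "?g p' = ?g p + 1" using flip[of ?x] even[of "nat u"] by simp
    moreover have "?g p \<noteq> 1" "?g p' \<noteq> 1"
    proof -
      have j: "2 ^ i - 1 < (15::nat)" "v + 1 + 2 ^ i = v + Suc (1 + (2 ^ i - 1))" using le by (simp_all add: less_eq_Suc_le)
      have n: "map h [1..<16] ! j = h (1 + j)" if "j < 15" for h :: "nat \<Rightarrow> bool \<times> bool" and j using that by (simp del: upt_Suc)
      show "?g p \<noteq> 1" using winning_zero[OF l(1) i(1)] unfolding n[OF j(1)] j(2) by simp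
      show "?g p' \<noteq> 1" using winning_zero[OF l'(1) i(1)] unfolding n[OF j(1)] j(2) by simp
    qed
    ultimately show False by simp
  qed
  show ?thesis using \<open>v = v'\<close> p[of p p'] p[of p' p] f assms(5,6) by fastforce
qed

section \<open>From counts to probabilities\<close>

lemma prob_bound:
  assumes \<kappa>: "\<kappa> < 10" and L: "2 * (n + 16) \<le> L"
    and S: "\<And>\<xi>. replicator (piggyback_evol \<xi>) (eta (words ! \<kappa>)) \<or> \<kappa> = 5 \<and> replicator (piggyback_evol \<xi>) (reflect (eta (words ! \<kappa>))) \<Longrightarrow> \<xi> \<in> S"
  shows "real (weight ! \<kappa>) / 4 ^ 13 * (1 - (1 / 4) ^ n) \<le> measure_pmf.prob (uniform_seed L) S"
proof -
  \<comment> \<open>The scale is chosen before \<open>L\<close>: all \<open>v < n\<close> satisfy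
    \<open>v + 16 \<le> 2^k\<close>, and a longer seed only enlarges the radius.\<close>
  define k where "k = n + 16"
  have k: "v + 16 \<le> 2 ^ k" if "v < n" for v using less_exp[of k] that unfolding k_def by linarith
  let ?I = "{..<n} \<times> {0..<48::int}"
  let ?E = "\<Union>(v, p)\<in>?I. event k L v p \<kappa>"
  have one: "real (card (event k L v p \<kappa>)) / 2 ^ (L + 1) = real (card (winning \<kappa>)) / 4 ^ (v + 16)" if "v < n" for v p
  proof -
    let ?h = "\<lambda>l. replicate v (False, False) @ (True, True) # l"
    have "card (event k L v p \<kappa>) * 4 ^ (v + 16) = card (?h ` winning \<kappa>) * 2 ^ (L + 1)"
      unfolding event_def by (rule card_pairs) (use L that k in \<open>auto simp: winning_length\<close>)
    also have "card (?h ` winning \<kappa>) = card (winning \<kappa>)" by (intro card_image) (simp add: inj_on_def)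
    finally have "real (card (event k L v p \<kappa>) * 4 ^ (v + 16)) = real (card (winning \<kappa>) * 2 ^ (L + 1))" by (rule arg_cong)
    then show ?thesis by (simp add: field_simps)
  qed
  \<comment> \<open>48 translates times the series 1 + 1/4 + 1/16 + ... = 4/3 give 64 = 4^3.\<close>
  have c: "48 * x / 4 ^ 16 * (4 / 3 * y) = x / 4 ^ 13 * y" for x y :: real by simp
  have "seeds L \<inter> ?E = ?E" by (auto simp: event_def)
  then have "card (seeds L \<inter> ?E) = (\<Sum>i\<in>?I. card (case i of (v, p) \<Rightarrow> event k L v p \<kappa>))"
  proof (simp only:, intro card_UN_disjoint ballI impI)
    fix i j assume i: "i \<in> ?I" and j: "j \<in> ?I" and ij: "i \<noteq> j"
    obtain v p v' p' where e: "i = (v, p)" "j = (v', p')" by (cases i; cases j)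
    have "v < n" "v' < n" "p \<in> {0..<48}" "p' \<in> {0..<48}" using i j by (simp_all add: e)
    then have "f \<in> event k L v p \<kappa> \<Longrightarrow> f \<in> event k L v' p' \<kappa> \<Longrightarrow> i = j" for f
      unfolding e using event_unique[of f k L v p \<kappa> v' p'] k by blast
    then show "(case i of (v, p) \<Rightarrow> event k L v p \<kappa>) \<inter> (case j of (v, p) \<Rightarrow> event k L v p \<kappa>) = {}"
      using ij unfolding e prod.case by blast
  qed (use card_seeds(2)[of L] in \<open>auto simp: event_def\<close>)
  then have "real (card (seeds L \<inter> ?E)) / 2 ^ (L + 1) = (\<Sum>i\<in>?I. real (card (case i of (v, p) \<Rightarrow> event k L v p \<kappa>)) / 2 ^ (L + 1))"
    by (simp add: sum_divide_distrib)
  also have "\<dots> = (\<Sum>(v, p)\<in>?I. real (card (winning \<kappa>)) / 4 ^ (v + 16))"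
  proof (rule sum.cong[OF refl])
    fix i assume "i \<in> ?I"
    then show "real (card (case i of (v, p) \<Rightarrow> event k L v p \<kappa>)) / 2 ^ (L + 1) = (case i of (v, p) \<Rightarrow> real (card (winning \<kappa>)) / 4 ^ (v + 16))"
      using one[of "fst i" "snd i"] by (cases i) (simp only: mem_Sigma_iff prod.case lessThan_iff fst_conv snd_conv)
  qed
  also have "\<dots> = (\<Sum>v<n. \<Sum>p\<in>{0..<48::int}. real (card (winning \<kappa>)) / 4 ^ (v + 16))" by (rule sum.cartesian_product[symmetric])
  also have "\<dots> = (\<Sum>v<n. 48 * real (card (winning \<kappa>)) / 4 ^ 16 * (1 / 4) ^ v)"
    by (intro sum.cong refl) (simp add: power_add power_one_over field_simps)
  also have "\<dots> = 48 * real (card (winning \<kappa>)) / 4 ^ 16 * (\<Sum>v<n. (1 / 4) ^ v)" by (rule sum_distrib_left[symmetric])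
  also have "(\<Sum>v<n. (1 / 4) ^ v) = (4 / 3 :: real) * (1 - (1 / 4) ^ n)" by (simp add: sum_gp_strict)
  also note c[of "real (card (winning \<kappa>))" "1 - (1 / 4) ^ n"]
  finally have eq: "real (card (seeds L \<inter> ?E)) / 2 ^ (L + 1) = real (card (winning \<kappa>)) / 4 ^ 13 * (1 - (1 / 4) ^ n)" .
  have "real (weight ! \<kappa>) / 4 ^ 13 * (1 - (1 / 4) ^ n) \<le> real (card (winning \<kappa>)) / 4 ^ 13 * (1 - (1 / 4) ^ n)"
    using weight_le[OF \<kappa>] by (intro mult_right_mono divide_right_mono) (simp_all add: power_le_one)
  also have "\<dots> \<le> measure_pmf.prob (uniform_seed L) S"
    unfolding eq[symmetric]
  proof (rule prob_seed)
    fix \<xi> assume \<xi>: "states \<xi>" "ones \<xi> \<in> ?E"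
    then obtain v p where "v < n" "ones \<xi> \<in> event k L v p \<kappa>" by auto
    then show "\<xi> \<in> S" using S event_replicator[OF \<xi>(1) _ k \<kappa>] by blast
  qed
  finally show ?thesis .
qed

text \<open>The truncation \<open>n\<close> of the geometric series tends to infinity after
  \<open>L\<close>, so the full constant is attained without any loss.\<close>

lemma liminf_bound:
  assumes \<kappa>: "\<kappa> < 10" and p: "p \<le> real (weight ! \<kappa>) / 4 ^ 13"
    and S: "\<And>\<xi>. replicator (piggyback_evol \<xi>) (eta (words ! \<kappa>)) \<or> \<kappa> = 5 \<and> replicator (piggyback_evol \<xi>) (reflect (eta (words ! \<kappa>))) \<Longrightarrow> \<xi> \<in> S"
  shows "ereal p \<le> liminf (\<lambda>L. ereal (measure_pmf.prob (uniform_seed L) S))"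
proof -
  let ?c = "real (weight ! \<kappa>) / 4 ^ 13"
  have b: "ereal (?c * (1 - (1 / 4) ^ n)) \<le> liminf (\<lambda>L. ereal (measure_pmf.prob (uniform_seed L) S))" for n
  proof (rule Liminf_bounded)
    show "\<forall>\<^sub>F L in sequentially. ereal (?c * (1 - (1 / 4) ^ n)) \<le> ereal (measure_pmf.prob (uniform_seed L) S)"
      using eventually_ge_at_top[of "2 * (n + 16)"]
      by eventually_elim (use prob_bound[OF \<kappa> _ S] in simp)
  qed
  have lim: "(\<lambda>n. ereal (?c * (1 - (1 / 4) ^ n))) \<longlonglongrightarrow> ereal ?c"
  proof -
    have "(\<lambda>n. ?c * (1 - (1 / 4) ^ n)) \<longlonglongrightarrow> ?c * (1 - 0)"
      by (intro tendsto_intros LIMSEQ_realpow_zero) simp_all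
    then show ?thesis by simp
  qed
  have "ereal ?c \<le> liminf (\<lambda>L. ereal (measure_pmf.prob (uniform_seed L) S))"
    by (rule LIMSEQ_le_const2[OF lim]) (use b in blast)
  then show ?thesis using p by (meson ereal_less_eq(3) order_trans)
qed

lemma less_10: "\<kappa> < 10 \<Longrightarrow> \<kappa> \<in> {0, 1, 2, 3, 4, 5, 6, 7, 8, 9 :: nat}"
  unfolding insert_iff empty_iff by presburger

lemma nth_words_5: "\<kappa> < 10 \<Longrightarrow> words ! \<kappa> = [0,0,0,0,2,0,2,2] \<longleftrightarrow> \<kappa> = 5"
  by (drule less_10, elim insertE emptyE) (simp_all add: words_def)

definition bounds :: "real list" where
  "bounds = [0.5, 0.0398, 0.0142, 0.0258, 0.0099, 0.0303, 0.0209, 0.1297, 0.0362, 0.0216]"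

text \<open>For the zero ether there is no slack: its count is 33554432 = 2^25, exactly half of
  \<open>4 ^ 13\<close>.\<close>

lemma bounds_weight: "\<kappa> < 10 \<Longrightarrow> bounds ! \<kappa> \<le> real (weight ! \<kappa>) / 4 ^ 13"
  by (drule less_10, elim insertE emptyE) (simp_all add: bounds_def weight_def)

theorem theorem9p8:
  shows "\<forall>(B, p) \<in> {
      ([0], 0.5),
      ([2], 0.0398),
      ([0,2], 0.0142),
      ([0,0,0,2], 0.0258),
      ([0,0,0,0,0,0,0,2], 0.0099),
      ([0,0,0,0,2,0,2,2], 0.0303),
      ([0,0,0,2,0,2,2,2], 0.0209),
      ([0,0,0,2,2,2,2,2], 0.1297),
      ([0,0,0,2,0,0,0,2,0,0,0,2,2,2,2,2], 0.0362),
      ([0,0,0,2,0,0,0,2,0,0,2,0,2,0,0,2], 0.0216 :: real)}.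
    generates_ether B (ether_of B) \<and>
    is_signature B (ether_of B) \<and>
    (symmetric_ether (ether_of B) \<longleftrightarrow> B \<noteq> [0,0,0,0,2,0,2,2]) \<and>
    liminf (\<lambda>L. ereal (measure_pmf.prob (uniform_seed L)
      (if B = [0,0,0,0,2,0,2,2]
       then {\<xi>0. replicator (piggyback_evol \<xi>0) (ether_of B) \<or>
                  replicator (piggyback_evol \<xi>0) (reflect (ether_of B))}
       else {\<xi>0. replicator (piggyback_evol \<xi>0) (ether_of B)}))) \<ge> ereal p"
  (is "\<forall>(B, p) \<in> ?S. ?P B p")
proof -
  have S: "?S = set (zip words bounds)" by (simp add: words_def bounds_def)
  have len: "length words = 10" "length bounds = 10" by (simp_all add: words_def bounds_def)
  have main: "?P (words ! \<kappa>) (bounds ! \<kappa>)" if \<kappa>: "\<kappa> < 10" for \<kappa>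
  proof -
    let ?B = "words ! \<kappa>"
    have B: "word_ok ?B" "signature_ok ?B" "asymmetric_word ?B \<longleftrightarrow> ?B = [0,0,0,0,2,0,2,2]"
      using words_ok words_signature words_symmetry nth_words[OF \<kappa>] by blast+
    have "ereal (bounds ! \<kappa>) \<le> liminf (\<lambda>L. ereal (measure_pmf.prob (uniform_seed L)
      (if ?B = [0,0,0,0,2,0,2,2]
       then {\<xi>0. replicator (piggyback_evol \<xi>0) (eta ?B) \<or> replicator (piggyback_evol \<xi>0) (reflect (eta ?B))}
       else {\<xi>0. replicator (piggyback_evol \<xi>0) (eta ?B)})))"
      by (rule liminf_bound[OF \<kappa> bounds_weight[OF \<kappa>]]) (auto simp: nth_words_5[OF \<kappa>])
    then show ?thesis
      unfolding ether_of_eta[OF B(1)]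
      using generates_eta[OF B(1)] signature_eta[OF B(1,2)] symmetric_eta[OF B(1)] asymmetric_eta[OF B(1)] B(3) by blast
  qed
  show ?thesis
    unfolding S
  proof
    fix q assume "q \<in> set (zip words bounds)"
    then obtain i where "i < 10" "q = (words ! i, bounds ! i)" by (auto simp: set_zip len)
    then show "case q of (B, p) \<Rightarrow> ?P B p" using main[of i] by (simp only: prod.case)
  qed
qed

end
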